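(* Let $\rho\ge 0$, $\varepsilon\in[0,1)$ with $(\rho,\varepsilon)\neq(0,\tfrac12)$. Then the Laguerre functions $\psi_n(x;\rho,\varepsilon)$, $n\in\mathbb Z$, form an orthonormal basis of the Hilbert space $L^2(\mathbb R, w(x;\rho,\varepsilon)\,dx)$.
   Context: Let ${}_1F_1(a;b;z)$ be the confluent hypergeometric function and $U(a;b;z)$ the second (Tricomi) solution of the confluent hypergeometric equation, $$U(a;b;z)=\frac{\Gamma(1-b)}{\Gamma(a-b+1)}{}_1F_1(a;b;z)+\frac{\Gamma(b-1)}{\Gamma(a)}z^{1-b}{}_1F_1(a-b+1;2-b;z)$$ (extended by continuity to integer $b$), with principal branch on $\mathbb C\setminus(-\infty,0]$. The Laguerre functions are, for $n\in\mathbb Z$, $$\psi_n(x;\rho,\varepsilon)=\begin{cases}|\Gamma(\tfrac12-n-\varepsilon-i\rho)|\,U(\tfrac12-n-\varepsilon-i\rho;1-2i\rho;-x),& x<0,\\ (-1)^n|\Gamma(n+\varepsilon+\tfrac12+i\rho)|\,U(n+\varepsilon+\tfrac12+i\rho;1+2i\rho;x),& x>0,\end{cases}$$ and the weight function is $w(x;\rho,\varepsilon)=\frac1{\pi^2}|\sin\pi(\varepsilon+\tfrac12+i\rho)|^2e^{-|x|}$. *)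

theory Defs
  imports "HOL-Analysis.Analysis"
begin

definition hyp1F1 :: "complex \<Rightarrow> complex \<Rightarrow> complex \<Rightarrow> complex" where
  "hyp1F1 a b z = eval_fps (fps_hypergeo [a] [b] 1) z"

lemma hyp1F1_series:
  "hyp1F1 a b z = (\<Sum>n. pochhammer a n / (pochhammer b n * fact n) * z ^ n)"
  by (simp add: hyp1F1_def eval_fps_def)

text \<open>
  The defining formula of the Tricomi function, meaningful for non-integer \<open>b\<close>.
  Since \<^term>\<open>Gamma\<close> is 0 at its poles and \<open>x / 0 = 0\<close>, the divisions by
  \<open>Gamma (a - b + 1)\<close> and \<open>Gamma a\<close> are multiplications by the entire function
  \<open>1/\<Gamma>\<close>, as intended.  The power \<open>powr\<close> uses the principal logarithm.
\<close>
definition tricomi_U_formula :: "complex \<Rightarrow> complex \<Rightarrow> complex \<Rightarrow> complex" where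
  "tricomi_U_formula a b z =
     Gamma (1 - b) / Gamma (a - b + 1) * hyp1F1 a b z
     + Gamma (b - 1) / Gamma a * z powr (1 - b) * hyp1F1 (a - b + 1) (2 - b) z"

text \<open>Extension by continuity in \<open>b\<close>, for fixed \<open>a\<close> and \<open>z\<close>, to integer \<open>b\<close>.\<close>
definition tricomi_U :: "complex \<Rightarrow> complex \<Rightarrow> complex \<Rightarrow> complex" where
  "tricomi_U a b z =
     (if b \<in> \<int> then Lim (at b) (\<lambda>b'. tricomi_U_formula a b' z)
      else tricomi_U_formula a b z)"

text \<open>The value at the single (null) point \<open>x = 0\<close> is immaterial; we take 0 there.\<close>
definition laguerre_psi :: "real \<Rightarrow> real \<Rightarrow> int \<Rightarrow> real \<Rightarrow> complex" where
  "laguerre_psi \<rho> \<epsilon> n x =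
     (if x < 0 then
        of_real (norm (Gamma (1/2 - of_int n - of_real \<epsilon> - \<i> * of_real \<rho>)))
          * tricomi_U (1/2 - of_int n - of_real \<epsilon> - \<i> * of_real \<rho>)
                      (1 - 2 * \<i> * of_real \<rho>) (of_real (- x))
      else if x > 0 then
        (-1) powi n
          * of_real (norm (Gamma (of_int n + of_real \<epsilon> + 1/2 + \<i> * of_real \<rho>)))
          * tricomi_U (of_int n + of_real \<epsilon> + 1/2 + \<i> * of_real \<rho>)
                      (1 + 2 * \<i> * of_real \<rho>) (of_real x)
      else 0)"

definition laguerre_weight :: "real \<Rightarrow> real \<Rightarrow> real \<Rightarrow> real" where
  "laguerre_weight \<rho> \<epsilon> x =
     1 / pi\<^sup>2 * (norm (sin (of_real pi * (of_real \<epsilon> + 1/2 + \<i> * of_real \<rho>) :: complex)))\<^sup>2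
       * exp (- \<bar>x\<bar>)"

definition laguerre_measure :: "real \<Rightarrow> real \<Rightarrow> real measure" where
  "laguerre_measure \<rho> \<epsilon> = density lborel (\<lambda>x. ennreal (laguerre_weight \<rho> \<epsilon> x))"

text \<open>
  Elements of \<open>L\<^sup>2(M)\<close> are given by measurable representatives.  The inner product
  and the norm do not change when a representative is altered on a null set, so the notions
  below are those of the quotient space.
\<close>
definition L2_space :: "'a measure \<Rightarrow> ('a \<Rightarrow> complex) set" where
  "L2_space M = {f \<in> borel_measurable M. integrable M (\<lambda>x. (norm (f x))\<^sup>2)}"

definition L2_inner :: "'a measure \<Rightarrow> ('a \<Rightarrow> complex) \<Rightarrow> ('a \<Rightarrow> complex) \<Rightarrow> complex" where
  "L2_inner M f g = (\<integral>x. f x * cnj (g x) \<partial>M)"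

definition L2_norm :: "'a measure \<Rightarrow> ('a \<Rightarrow> complex) \<Rightarrow> real" where
  "L2_norm M f = sqrt (\<integral>x. (norm (f x))\<^sup>2 \<partial>M)"

definition L2_orthonormal :: "'a measure \<Rightarrow> ('i \<Rightarrow> 'a \<Rightarrow> complex) \<Rightarrow> bool" where
  "L2_orthonormal M e \<longleftrightarrow>
     (\<forall>i. e i \<in> L2_space M) \<and>
     (\<forall>i j. L2_inner M (e i) (e j) = (if i = j then 1 else 0))"

definition L2_orthonormal_basis :: "'a measure \<Rightarrow> ('i \<Rightarrow> 'a \<Rightarrow> complex) \<Rightarrow> bool" where
  "L2_orthonormal_basis M e \<longleftrightarrow>
     L2_orthonormal M e \<and>
     (\<forall>f \<in> L2_space M. \<forall>\<delta>>0. \<exists>I c. finite I \<and>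
        L2_norm M (\<lambda>x. f x - (\<Sum>i\<in>I. c i * e i x)) < \<delta>)"

end

theory Submission
  imports Defs "HOL-Probability.Probability" "HOL-Real_Asymp.Real_Asymp"
begin

text \<open>One of the two gamma densities is reflected, so their convolution lives on both half
  lines, with a different U on each. The halves carry the factors 1/Gamma(\<alpha>) and
  1/Gamma(\<beta>), while psi carries |Gamma(\<beta>)| and |Gamma(\<alpha>)|. The reflection formula
  turns one into the other, and the sine it produces is the sine of the weight; at the excluded
  point (0, 1/2) this sine vanishes. The unimodular factors are of two kinds, one depending on n
  alone and one on x alone, so they disturb neither inner products nor density. The formula defining
  U is hard to use directly: for \<rho> = 0 its second parameter is 1, where both Gamma(1 - b) and
  Gamma(b - 1) have poles, and its behaviour for small and large x is not visible. Hence the detour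
  through an integral that is manifestly continuous in its parameters and easy to bound. It
  converges only for Re a > 0, which explains why recurrences accompany every statement about U. No
  normalising constant remains at the end: the factor 2 pi of Plancherel's formula equals the total
  mass of the density 1/(1/4 + t^2).\<close>

text \<open>Up to unimodular factors, the functions \<open>sqrt w * \<psi>\<^sub>n\<close> are inverse Fourier transforms of
  \<open>(1/2 + i t) powr (- \<alpha>) * (1/2 - i t) powr (- \<beta>)\<close> with \<open>\<alpha> = 1/2 - s + i \<rho>\<close>, \<open>\<beta> = 1/2 + s + i \<rho>\<close>,
  \<open>s = \<epsilon> + n\<close>. For \<open>\<bar>s\<bar> < 1/2\<close> this is the convolution of two gamma densities, which is an Euler
  integral for \<open>U\<close>; the three term recurrences extend it to all non-half-integral \<open>s\<close>, and continuity
  in \<open>s\<close> to the rest. Increasing \<open>n\<close> by one multiplies the transform by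
  \<open>(1/2 + i t) / (1/2 - i t)\<close>, so the Cayley map turns the system into the trigonometric system on
  the circle. Plancherel's formula then gives orthonormality; completeness follows from
  Stone-Weierstrass on the circle, applied to the transforms of a dense class of functions
  \<open>\<plusminus> x exp (\<mp> (j + 1) x)\<close> on the two half lines.\<close>

section \<open>Euler integrals for the Tricomi function\<close>

text \<open>The mean value inequality passes the bound \<open>w\<close> from the derivatives to the
  difference quotients, so dominated convergence applies along every sequence tending to
  \<open>t\<close>. It serves for \<open>tricomi_integral\<close> in \<open>x\<close> and for
  \<open>fourier\<close> in its frequency.\<close>

lemma has_vector_derivative_integral_dominated:
  fixes f f' :: "real \<Rightarrow> 'a \<Rightarrow> complex"
  assumes t: "t \<in> {c<..<d}"
    and int: "\<And>u. u \<in> {c<..<d} \<Longrightarrow> integrable M (f u)"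
    and der: "\<And>u x. u \<in> {c<..<d} \<Longrightarrow> x \<in> space M \<Longrightarrow>
           ((\<lambda>u. f u x) has_vector_derivative f' u x) (at u)"
    and meas: "f' t \<in> borel_measurable M"
    and w: "integrable M w"
    and bound: "\<And>u x. u \<in> {c<..<d} \<Longrightarrow> x \<in> space M \<Longrightarrow> norm (f' u x) \<le> w x"
  shows "((\<lambda>u. \<integral>x. f u x \<partial>M) has_vector_derivative (\<integral>x. f' t x \<partial>M)) (at t)"
proof -
  \<comment> \<open>The bound \<open>w\<close> is available only for parameters in the interval, so
    the limit is first taken within it; openness then gives the full limit at
    \<open>t\<close>.\<close>
  have "((\<lambda>u. (\<integral>x. (f u x - f t x) /\<^sub>R (u - t) \<partial>M)) \<longlongrightarrow> (\<integral>x. f' t x \<partial>M)) (at t within {c<..<d})"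
    unfolding tendsto_at_iff_sequentially comp_def
  proof (intro allI impI)
    fix X assume X: "\<forall>i. X i \<in> {c<..<d} - {t}" and lim: "X \<longlonglongrightarrow> t"
    show "(\<lambda>i. \<integral>x. (f (X i) x - f t x) /\<^sub>R (X i - t) \<partial>M) \<longlonglongrightarrow> (\<integral>x. f' t x \<partial>M)"
    proof (rule integral_dominated_convergence[where w=w])
      show "(\<lambda>x. (f (X i) x - f t x) /\<^sub>R (X i - t)) \<in> borel_measurable M" for i
        using int[of "X i"] int[OF t] X by (auto intro!: borel_measurable_integrable)
      show "AE x in M. (\<lambda>i. (f (X i) x - f t x) /\<^sub>R (X i - t)) \<longlonglongrightarrow> f' t x"
      proof (rule AE_I2)
        fix x assume x: "x \<in> space M"
        have "((\<lambda>u. (f u x - f t x) /\<^sub>R (u - t)) \<longlongrightarrow> f' t x) (at t)"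
        proof -
          have *: "((\<lambda>y. (1 / norm (y - t)) *\<^sub>R (f y x - (f t x + (y - t) *\<^sub>R f' t x))) \<longlongrightarrow> 0) (at t)"
            using der[OF t x] by (simp add: has_vector_derivative_def has_derivative_within)
          have "((\<lambda>y. norm ((f y x - f t x) /\<^sub>R (y - t) - f' t x)) \<longlongrightarrow> 0) (at t)"
          proof (rule Lim_transform_eventually[OF tendsto_norm_zero[OF *]])
            show "\<forall>\<^sub>F y in at t. norm ((1 / norm (y - t)) *\<^sub>R (f y x - (f t x + (y - t) *\<^sub>R f' t x))) =
                    norm ((f y x - f t x) /\<^sub>R (y - t) - f' t x)"
              using eventually_neq_at_within[of t t UNIV]
            proof eventually_elim
              fix y assume "y \<noteq> t"
              then have "(f y x - f t x) /\<^sub>R (y - t) - f' t x = (1 / (y - t)) *\<^sub>R (f y x - (f t x + (y - t) *\<^sub>R f' t x))"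
                by (simp add: scaleR_diff_right scaleR_add_right divide_inverse)
              then show "norm ((1 / norm (y - t)) *\<^sub>R (f y x - (f t x + (y - t) *\<^sub>R f' t x))) =
                    norm ((f y x - f t x) /\<^sub>R (y - t) - f' t x)"
                by simp
            qed
          qed
          then show ?thesis
            by (subst Lim_null, subst tendsto_norm_zero_iff[symmetric]) simp
        qed
        with X lim show "(\<lambda>i. (f (X i) x - f t x) /\<^sub>R (X i - t)) \<longlonglongrightarrow> f' t x"
          unfolding tendsto_at_iff_sequentially comp_def by auto
      qed
      show "AE x in M. norm ((f (X i) x - f t x) /\<^sub>R (X i - t)) \<le> w x" for i
      proof (rule AE_I2)
        fix x assume x: "x \<in> space M"
        have "norm (f (X i) x - f t x) \<le> w x * norm (X i - t)"
        proof (rule differentiable_bound[where S="{c<..<d}" and f'="\<lambda>u h. h *\<^sub>R f' u x"])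
          show "((\<lambda>u. f u x) has_derivative (\<lambda>h. h *\<^sub>R f' u x)) (at u within {c<..<d})" if "u \<in> {c<..<d}" for u
            using der[OF that x] by (auto simp: has_vector_derivative_def intro: has_derivative_at_withinI)
          show "onorm (\<lambda>h. h *\<^sub>R f' u x) \<le> w x" if "u \<in> {c<..<d}" for u
            by (rule onorm_le) (use bound[OF that x] in \<open>auto intro: mult_left_mono simp: mult.commute\<close>)
        qed (use X t in auto)
        moreover have "X i \<noteq> t" using X by auto
        moreover have "norm ((f (X i) x - f t x) /\<^sub>R (X i - t)) = norm (f (X i) x - f t x) / norm (X i - t)"
          by (simp only: norm_scaleR norm_inverse divide_inverse mult.commute) simp
        ultimately show "norm ((f (X i) x - f t x) /\<^sub>R (X i - t)) \<le> w x"
          by (simp only: pos_divide_le_eq zero_less_norm_iff right_minus_eq not_False_eq_True)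
      qed
    qed (use meas w in auto)
  qed
  then have "((\<lambda>u. (\<integral>x. (f u x - f t x) /\<^sub>R (u - t) \<partial>M)) \<longlongrightarrow> (\<integral>x. f' t x \<partial>M)) (at t)"
    unfolding at_within_open[OF t open_greaterThanLessThan] .
  then have L: "((\<lambda>u. ((\<integral>x. f u x \<partial>M) - (\<integral>x. f t x \<partial>M)) /\<^sub>R (u - t)) \<longlongrightarrow> (\<integral>x. f' t x \<partial>M)) (at t)"
  proof (rule Lim_transform_eventually)
    show "\<forall>\<^sub>F u in at t. (\<integral>x. (f u x - f t x) /\<^sub>R (u - t) \<partial>M) =
         ((\<integral>x. f u x \<partial>M) - (\<integral>x. f t x \<partial>M)) /\<^sub>R (u - t)"
      using eventually_at_in_open'[OF open_greaterThanLessThan t]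
      by eventually_elim (use int t in simp)
  qed
  show ?thesis
    unfolding has_vector_derivative_def has_derivative_within
  proof (intro conjI bounded_linear_scaleR_left)
    let ?F = "\<lambda>u. \<integral>x. f u x \<partial>M" and ?D = "\<integral>x. f' t x \<partial>M"
    have "((\<lambda>u. norm ((?F u - ?F t) /\<^sub>R (u - t) - ?D)) \<longlongrightarrow> 0) (at t)"
      using L by (simp add: Lim_null[of _ ?D] tendsto_norm_zero)
    then have "((\<lambda>u. norm ((1 / norm (u - t)) *\<^sub>R (?F u - (?F t + (u - t) *\<^sub>R ?D)))) \<longlongrightarrow> 0) (at t)"
    proof (rule Lim_transform_eventually)
      show "\<forall>\<^sub>F u in at t. norm ((?F u - ?F t) /\<^sub>R (u - t) - ?D) =
            norm ((1 / norm (u - t)) *\<^sub>R (?F u - (?F t + (u - t) *\<^sub>R ?D)))"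
        using eventually_neq_at_within[of t t UNIV]
      proof eventually_elim
        fix y assume "y \<noteq> t"
        then have "(?F y - ?F t) /\<^sub>R (y - t) - ?D = (1 / (y - t)) *\<^sub>R (?F y - (?F t + (y - t) *\<^sub>R ?D))"
          by (simp add: scaleR_diff_right scaleR_add_right divide_inverse)
        then show "norm ((?F y - ?F t) /\<^sub>R (y - t) - ?D) = norm ((1 / norm (y - t)) *\<^sub>R (?F y - (?F t + (y - t) *\<^sub>R ?D)))"
          by simp
      qed
    qed
    then show "((\<lambda>u. (1 / norm (u - t)) *\<^sub>R (?F u - (?F t + (u - t) *\<^sub>R ?D))) \<longlongrightarrow> 0) (at t)"
      by (rule tendsto_norm_zero_cancel)
  qed
qed

section \<open>Complex powers on the half line\<close>

lemma has_vector_derivative_cpowr: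
  "0 < t \<Longrightarrow> ((\<lambda>t. complex_of_real t powr a) has_vector_derivative a * of_real t powr (a - 1)) (at t)"
proof -
  assume t: "0 < t"
  have "((\<lambda>z. z powr a) \<circ> complex_of_real has_vector_derivative 1 * (a * of_real t powr (a - 1))) (at t)"
  proof (rule field_vector_diff_chain_at)
    show "(complex_of_real has_vector_derivative 1) (at t)"
      using has_vector_derivative_of_real[OF DERIV_ident] by simp
    show "((\<lambda>z. z powr a) has_field_derivative a * of_real t powr (a - 1)) (at (complex_of_real t))"
      using t by (intro has_field_derivative_powr) (auto simp: complex_nonpos_Reals_iff)
  qed
  then show ?thesis by (simp add: o_def)
qed

lemma cpowr_measurable [measurable]: "(\<lambda>t. complex_of_real t powr a) \<in> borel_measurable borel"
proof -
  \<comment> \<open>On the negative axis the principal logarithm has imaginary part pi, and at 0 the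
    power takes the default value 0.\<close>
  have "complex_of_real t powr a =
      (if t > 0 then exp (a * of_real (ln t)) else if t < 0 then exp (a * (of_real (ln (- t)) + of_real pi * \<i>)) else 0)" for t
    by (auto simp: powr_def Ln_of_real Ln_of_real' not_less)
  then show ?thesis by (simp only:) measurable
qed

lemma norm_cpowr: "0 \<le> t \<Longrightarrow> norm (complex_of_real t powr a) = t powr Re a"
  by (simp add: norm_powr_real_powr)

lemma set_integrable_powr_exp:
  fixes p x :: real assumes "p > 0" "x > 0"
  shows "set_integrable lborel {0<..} (\<lambda>t. t powr (p - 1) * exp (- (x * t)))"
proof -
  have "(\<lambda>t. complex_of_real t powr (of_real p - 1) / of_real (exp (x * t))) absolutely_integrable_on {0<..}"
    using absolutely_integrable_Gamma_integral[of "of_real p" x] assms by simp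
  then have "(\<lambda>t. norm (complex_of_real t powr (of_real p - 1) / of_real (exp (x * t)))) absolutely_integrable_on {0<..}"
    using absolutely_integrable_norm by (simp add: comp_def)
  then have "(\<lambda>t. t powr (p - 1) * exp (- (x * t))) absolutely_integrable_on {0<..}"
    by (rule set_integrable_cong[THEN iffD1, rotated -1])
       (auto simp: norm_divide norm_cpowr exp_minus field_simps)
  \<comment> \<open>The Gamma integral is absolutely integrable for the completed measure; Borel
    measurability of the integrand brings this back to \<open>lborel\<close>.\<close>
  then show ?thesis
    by (simp add: set_integrable_def integrable_completion)
qed

lemma one_plus_powr_le:
  fixes t q :: real assumes "t > 0" "q \<ge> 0"
  shows "(1 + t) powr q \<le> 2 powr q * (1 + t powr q)"
proof -
  have "(1 + t) powr q \<le> (2 * max 1 t) powr q"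
    using assms by (intro powr_mono2) auto
  also have "\<dots> = 2 powr q * max 1 t powr q"
    using assms by (simp add: powr_mult)
  also have "max 1 t powr q \<le> 1 + t powr q"
    by (auto simp: max_def)
  finally show ?thesis by simp
qed

section \<open>The Euler integral and its relations\<close>

text \<open>Integrand of the classical representation of Gamma(a) U(a; b; x) for Re a > 0. The
  factor 1/Gamma(a) is left out; it is put back by \<open>tricomi_U_eq_integral\<close>.\<close>

definition tricomi_integrand :: "complex \<Rightarrow> complex \<Rightarrow> real \<Rightarrow> real \<Rightarrow> complex" where
  "tricomi_integrand a b x t = of_real (exp (- (x * t))) * of_real t powr (a - 1) * of_real (1 + t) powr (b - a - 1)"

definition tricomi_integral :: "complex \<Rightarrow> complex \<Rightarrow> real \<Rightarrow> complex" where
  "tricomi_integral a b x = (LBINT t:{0<..}. tricomi_integrand a b x t)"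

lemma norm_tricomi_integrand:
  "t > 0 \<Longrightarrow> norm (tricomi_integrand a b x t) = exp (- (x * t)) * t powr (Re a - 1) * (1 + t) powr (Re b - Re a - 1)"
  by (simp add: tricomi_integrand_def norm_mult norm_cpowr del: of_real_add)

lemma tricomi_integrand_measurable [measurable]: "tricomi_integrand a b x \<in> borel_measurable borel"
  unfolding tricomi_integrand_def
  using measurable_compose[OF _ cpowr_measurable[of "b - a - 1"], of "\<lambda>t. 1 + t" borel]
  by (intro borel_measurable_times cpowr_measurable) auto

lemma continuous_tricomi_integrand: "t > 0 \<Longrightarrow> isCont (tricomi_integrand a b x) t"
proof -
  assume t: "t > 0"
  have 1: "isCont (\<lambda>t. complex_of_real t powr c) t" if "t > 0" for t c
    using has_vector_derivative_cpowr[OF that, of c] by (rule has_vector_derivative_continuous)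
  have 2: "isCont (\<lambda>t. complex_of_real (1 + t) powr c) t" for c
    using isCont_o2[of t "\<lambda>t. 1 + t" "\<lambda>t. complex_of_real t powr c"] 1[of "1 + t" c] t by simp
  have 3: "isCont (\<lambda>t. complex_of_real (exp (- (x * t)))) t"
    by (intro continuous_intros)
  show ?thesis
    unfolding tricomi_integrand_def[abs_def] by (intro continuous_mult 1 2 3 t)
qed

text \<open>Since (1 + t)^q <= 2^|q| (1 + t^|q|) for either sign of q, two Gamma integrands
  dominate, with exponents p and p + |q|.\<close>

lemma set_integrable_powr_powr_exp:
  fixes p q x :: real assumes "p > 0" "x > 0"
  shows "set_integrable lborel {0<..} (\<lambda>t. exp (- (x * t)) * t powr (p - 1) * (1 + t) powr q)"
proof (rule set_integrable_bound)
  show "set_integrable lborel {0<..} (\<lambda>t. 2 powr \<bar>q\<bar> * (t powr (p - 1) * exp (- (x * t))) +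
      2 powr \<bar>q\<bar> * (t powr (p + \<bar>q\<bar> - 1) * exp (- (x * t))))"
    using assms by (intro set_integral_add set_integrable_mult_right set_integrable_powr_exp) auto
  show "AE t in lborel. t \<in> {0<..} \<longrightarrow> norm (exp (- (x * t)) * t powr (p - 1) * (1 + t) powr q) \<le> norm (2 powr \<bar>q\<bar> * (t powr (p - 1) * exp (- (x * t))) +
      2 powr \<bar>q\<bar> * (t powr (p + \<bar>q\<bar> - 1) * exp (- (x * t))))"
  proof (intro AE_I2 impI)
    fix t :: real assume "t \<in> {0<..}" then have t: "t > 0" by simp
    have "(1 + t) powr q \<le> (1 + t) powr \<bar>q\<bar>" using t by (intro powr_mono) auto
    also have "\<dots> \<le> 2 powr \<bar>q\<bar> * (1 + t powr \<bar>q\<bar>)" using t by (intro one_plus_powr_le) auto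
    finally have "exp (- (x * t)) * t powr (p - 1) * (1 + t) powr q \<le> exp (- (x * t)) * t powr (p - 1) * (2 powr \<bar>q\<bar> * (1 + t powr \<bar>q\<bar>))"
      by (intro mult_left_mono) auto
    also have "\<dots> = 2 powr \<bar>q\<bar> * (t powr (p - 1) * exp (- (x * t))) +
      2 powr \<bar>q\<bar> * (t powr (p - 1) * t powr \<bar>q\<bar> * exp (- (x * t)))"
      by (simp add: algebra_simps)
    also have "t powr (p - 1) * t powr \<bar>q\<bar> = t powr (p + \<bar>q\<bar> - 1)"
      using t by (simp add: powr_add[symmetric])  (simp add: algebra_simps)
    finally show "norm (exp (- (x * t)) * t powr (p - 1) * (1 + t) powr q) \<le> norm (2 powr \<bar>q\<bar> * (t powr (p - 1) * exp (- (x * t))) +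
      2 powr \<bar>q\<bar> * (t powr (p + \<bar>q\<bar> - 1) * exp (- (x * t))))"
      using t by simp
  qed
qed (auto simp: set_borel_measurable_def)

lemma set_integrable_tricomi:
  assumes "Re a > 0" "x > 0"
  shows "set_integrable lborel {0<..} (tricomi_integrand a b x)"
proof (rule set_integrable_bound)
  show "set_integrable lborel {0<..} (\<lambda>t. exp (- (x * t)) * t powr (Re a - 1) * (1 + t) powr (Re b - Re a - 1))"
    using assms by (rule set_integrable_powr_powr_exp)
  show "AE t in lborel. t \<in> {0<..} \<longrightarrow> norm (tricomi_integrand a b x t) \<le> norm (exp (- (x * t)) * t powr (Re a - 1) * (1 + t) powr (Re b - Re a - 1))"
    by (auto simp: norm_tricomi_integrand)
qed (auto simp: set_borel_measurable_def)

text \<open>Raising both parameters keeps b - a - 1 and adds a factor t; raising \<open>b\<close>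
  alone adds a factor 1 + t. All relations between neighbouring integrals below rest on
  this.\<close>

lemma tricomi_integrand_shift:
  assumes "t > 0"
  shows "tricomi_integrand (a + 1) (b + 1) x t = of_real t * tricomi_integrand a b x t"
    and "tricomi_integrand a (b + 1) x t = of_real (1 + t) * tricomi_integrand a b x t"
proof -
  have A: "complex_of_real t powr (a + 1 - 1) = t * complex_of_real t powr (a - 1)"
    using assms powr_add[of "complex_of_real t" "a - 1" 1] by (simp add: mult_ac)
  have B: "complex_of_real (1 + t) powr (b + 1 - a - 1) = of_real (1 + t) * complex_of_real (1 + t) powr (b - a - 1)" for b
    using assms powr_add[of "complex_of_real (1 + t)" "b - a - 1" 1]
    by (simp add: mult_ac add_divide_distrib algebra_simps del: of_real_add)
  show "tricomi_integrand (a + 1) (b + 1) x t = of_real t * tricomi_integrand a b x t"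
    unfolding tricomi_integrand_def A by (simp add: algebra_simps)
  show "tricomi_integrand a (b + 1) x t = of_real (1 + t) * tricomi_integrand a b x t"
    unfolding tricomi_integrand_def B by (simp add: algebra_simps)
qed

lemma set_integral_FTC_Ioi:
  fixes F f :: "real \<Rightarrow> complex"
  assumes "\<And>t. t > c \<Longrightarrow> (F has_vector_derivative f t) (at t)" "\<And>t. t > c \<Longrightarrow> isCont f t"
    and "set_integrable lborel {c<..} f" "(F \<longlongrightarrow> A) (at_right c)" "(F \<longlongrightarrow> B) at_top"
  shows "(LBINT t:{c<..}. f t) = B - A"
proof -
  have "(LBINT t=ereal c..\<infinity>. f t) = B - A"
  proof (rule interval_integral_FTC_integrable[where F=F])
    show "((F \<circ> real_of_ereal) \<longlongrightarrow> A) (at_right (ereal c))"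
      using assms(4) by (simp only: ereal_tendsto_simps)
    show "((F \<circ> real_of_ereal) \<longlongrightarrow> B) (at_left \<infinity>)"
      using assms(5) by (simp only: ereal_tendsto_simps)
  qed (use assms in auto)
  then show ?thesis by (simp add: interval_lebesgue_integral_def)
qed

lemma tricomi_integral_add:
  assumes "Re a > 0" "x > 0"
  shows "tricomi_integral a (b + 1) x = tricomi_integral a b x + tricomi_integral (a + 1) (b + 1) x"
proof -
  have "tricomi_integral a (b + 1) x = (LBINT t:{0<..}. tricomi_integrand a b x t + tricomi_integrand (a + 1) (b + 1) x t)"
    unfolding tricomi_integral_def
    by (rule set_lebesgue_integral_cong) (auto simp: tricomi_integrand_shift[of _ a b] ring_distribs)
  also have "\<dots> = tricomi_integral a b x + tricomi_integral (a + 1) (b + 1) x"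
    unfolding tricomi_integral_def using assms
    by (intro set_integral_add(2) set_integrable_tricomi) auto
  finally show ?thesis .
qed

text \<open>Integrate the derivative of \<open>exp (- x t) t powr a (1 + t) powr (b - a - 1)\<close>.\<close>
lemma tricomi_integral_by_parts:
  assumes "Re a > 0" "x > 0"
  shows "x * tricomi_integral (a + 1) (b + 1) x = a * tricomi_integral a b x + (b - a - 1) * tricomi_integral (a + 1) b x"
proof -
  define G where "G = (\<lambda>t. tricomi_integrand (a + 1) (b + 1) x t)"
  define g where "g = (\<lambda>t. - x * tricomi_integrand (a + 1) (b + 1) x t + a * tricomi_integrand a b x t + (b - a - 1) * tricomi_integrand (a + 1) b x t)"
  have int: "set_integrable lborel {0<..} g"
    unfolding g_def using assms
    by (auto intro!: set_integral_add set_integral_diff set_integrable_mult_right set_integrable_tricomi)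
  have lim0: "(G \<longlongrightarrow> 0) (at_right 0)"
  proof (rule Lim_null_comparison)
    show "\<forall>\<^sub>F t in at_right 0. norm (G t) \<le> exp (- (x * t)) * t powr Re a * (1 + t) powr (Re b - Re a - 1)"
      by (rule eventually_at_right_less[THEN eventually_mono]) (simp add: G_def norm_tricomi_integrand)
    have "((\<lambda>t. exp (- (x * t)) * t powr Re a * (1 + t) powr (Re b - Re a - 1)) \<longlongrightarrow> exp (- (x * 0)) * 0 * (1 + 0) powr (Re b - Re a - 1)) (at_right 0)"
      using assms by (intro tendsto_intros tendsto_zero_powrI[where b="Re a"]) (auto simp: eventually_at_right_less[THEN eventually_mono])
    then show "((\<lambda>t. exp (- (x * t)) * t powr Re a * (1 + t) powr (Re b - Re a - 1)) \<longlongrightarrow> 0) (at_right 0)" by simp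
  qed
  have limi: "(G \<longlongrightarrow> 0) at_top"
  proof (rule Lim_null_comparison)
    show "\<forall>\<^sub>F t in at_top. norm (G t) \<le> exp (- (x * t)) * t powr Re a * (1 + t) powr (Re b - Re a - 1)"
      by (rule eventually_gt_at_top[of 0, THEN eventually_mono]) (simp add: G_def norm_tricomi_integrand)
    show "((\<lambda>t. exp (- (x * t)) * t powr Re a * (1 + t) powr (Re b - Re a - 1)) \<longlongrightarrow> 0) at_top"
      using assms by real_asymp
  qed
  have "(LBINT t:{0<..}. g t) = 0 - 0"
  proof (rule set_integral_FTC_Ioi[where F=G])
    fix t :: real assume t: "t > 0"
    have r: "b + 1 - (a + 1) - 1 = b - a - 1" "a + 1 - 1 = a" "b - (a + 1) - 1 = b - a - 1 - 1" by simp_all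
    have E: "((\<lambda>t. complex_of_real (exp (- (x * t)))) has_vector_derivative of_real (- x * exp (- (x * t)))) (at t)"
      by (intro has_vector_derivative_of_real) (auto intro!: derivative_eq_intros)
    have D1: "((\<lambda>t. 1 + t) has_vector_derivative 1) (at t)"
      by (auto intro!: derivative_eq_intros simp: has_real_derivative_iff_has_vector_derivative[symmetric])
    have S: "((\<lambda>t. complex_of_real (1 + t) powr c) has_vector_derivative c * of_real (1 + t) powr (c - 1)) (at t)" for c
      using vector_diff_chain_at[OF D1 has_vector_derivative_cpowr[of "1 + t" c]] t
      by (simp only: o_def scaleR_one)
    have "(G has_vector_derivative
        (of_real (exp (- (x * t))) * (of_real t powr a) * ((b - a - 1) * of_real (1 + t) powr (b - a - 1 - 1))
       + (of_real (exp (- (x * t))) * (a * of_real t powr (a - 1)) + of_real (- x * exp (- (x * t))) * (of_real t powr a)) * of_real (1 + t) powr (b - a - 1))) (at t)"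
      using has_vector_derivative_mult[OF has_vector_derivative_mult[OF E has_vector_derivative_cpowr[OF t, of a]] S[of "b - a - 1"]]
      unfolding G_def tricomi_integrand_def[abs_def] by (simp only: r)
    also have "(of_real (exp (- (x * t))) * (of_real t powr a) * ((b - a - 1) * of_real (1 + t) powr (b - a - 1 - 1))
       + (of_real (exp (- (x * t))) * (a * of_real t powr (a - 1)) + of_real (- x * exp (- (x * t))) * (of_real t powr a)) * of_real (1 + t) powr (b - a - 1)) = g t"
    proof -
      have gen: "E * T * (c * S') + (E * (a * T') + (- X * E) * T) * S = - X * (E * T * S) + a * (E * T' * S) + c * (E * T * S')" for E T T' S S' c X :: complex
        by (simp add: algebra_simps)
      show ?thesis
        unfolding g_def tricomi_integrand_def r of_real_mult of_real_minus by (rule gen)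
    qed
    finally show "(G has_vector_derivative g t) (at t)" .
    show "isCont g t" unfolding g_def using t
      by (intro continuous_add continuous_diff continuous_mult continuous_const continuous_tricomi_integrand)
  qed (fact lim0 limi int)+
  moreover have "(LBINT t:{0<..}. g t) = - x * tricomi_integral (a + 1) (b + 1) x + a * tricomi_integral a b x + (b - a - 1) * tricomi_integral (a + 1) b x"
  proof -
    have I: "set_integrable lborel {0<..} (\<lambda>t. c * tricomi_integrand a b x t)" "set_integrable lborel {0<..} (\<lambda>t. c * tricomi_integrand (a + 1) b x t)" for b c
      using assms by (auto intro!: set_integrable_mult_right set_integrable_tricomi)
    show ?thesis
      unfolding g_def tricomi_integral_def
        set_integral_add(2)[OF set_integral_add(1)[OF I(2) I(1)] I(2)] set_integral_add(2)[OF I(2) I(1)]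
      by (simp only: set_integral_mult_right)
  qed
  ultimately have "- x * tricomi_integral (a + 1) (b + 1) x + a * tricomi_integral a b x + (b - a - 1) * tricomi_integral (a + 1) b x = 0"
    by (simp only: diff_self)
  then show ?thesis
    unfolding of_real_minus by algebra
qed

text \<open>Differentiating exp(-x t) brings down -t, which the shift of both parameters
  absorbs.\<close>

lemma has_vector_derivative_tricomi_integral:
  assumes a: "Re a > 0" and x: "x > 0"
  shows "(tricomi_integral a b has_vector_derivative - tricomi_integral (a + 1) (b + 1) x) (at x)"
proof -
  have "((\<lambda>u. \<integral>t. indicator {0<..} t *\<^sub>R tricomi_integrand a b u t \<partial>lborel) has_vector_derivative
      (\<integral>t. indicator {0<..} t *\<^sub>R (- tricomi_integrand (a + 1) (b + 1) x t) \<partial>lborel)) (at x)"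
  proof (rule has_vector_derivative_integral_dominated)
    \<comment> \<open>For u > x/2 the exponential is at most exp(-(x/2) t), so the shifted integrand
      at x/2 dominates on the whole interval.\<close>
    show "x \<in> {x/2<..<2*x}" using x by auto
    show "integrable lborel (\<lambda>t. indicator {0<..} t *\<^sub>R tricomi_integrand a b u t)" if "u \<in> {x/2<..<2*x}" for u
      using set_integrable_tricomi[OF a, of u b] that x by (auto simp: set_integrable_def)
    show "((\<lambda>u. indicator {0<..} t *\<^sub>R tricomi_integrand a b u t) has_vector_derivative
        indicator {0<..} t *\<^sub>R (- tricomi_integrand (a + 1) (b + 1) u t)) (at u)" for u t :: real
    proof (cases "t > 0")
      case True
      have E: "((\<lambda>u. complex_of_real (exp (- (u * t)))) has_vector_derivative of_real (- t * exp (- (u * t)))) (at u)"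
        by (intro has_vector_derivative_of_real) (auto intro!: derivative_eq_intros)
      have "(\<lambda>u. tricomi_integrand a b u t) = (\<lambda>u. complex_of_real (exp (- (u * t))) * (of_real t powr (a - 1) * of_real (1 + t) powr (b - a - 1)))"
        by (simp add: tricomi_integrand_def mult_ac)
      moreover have "- tricomi_integrand (a + 1) (b + 1) u t = of_real (- t * exp (- (u * t))) * (of_real t powr (a - 1) * of_real (1 + t) powr (b - a - 1))"
        by (simp only: tricomi_integrand_shift(1)[OF True]) (simp add: tricomi_integrand_def mult_ac)
      ultimately show ?thesis using True has_vector_derivative_mult_left[OF E] by simp
    qed auto
    show "integrable lborel (\<lambda>t. norm (indicator {0<..} t *\<^sub>R tricomi_integrand (a + 1) (b + 1) (x/2) t))"
      using set_integrable_tricomi[of "a + 1" "x/2" "b + 1"] a x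
      by (intro integrable_norm) (auto simp: set_integrable_def)
    show "norm (indicator {0<..} t *\<^sub>R (- tricomi_integrand (a + 1) (b + 1) u t))
        \<le> norm (indicator {0<..} t *\<^sub>R tricomi_integrand (a + 1) (b + 1) (x/2) t)" if "u \<in> {x/2<..<2*x}" for u t
      using that by (auto simp: indicator_def norm_tricomi_integrand intro!: mult_right_mono)
  qed (use x in auto)
  then show ?thesis
    by (simp add: tricomi_integral_def[abs_def] set_lebesgue_integral_def)
qed

text \<open>With the first two derivatives written as shifted integrals this is Kummer's equation x
  w'' = (x - b) w' + a w. It results from eliminating the integrals at (a + 1, b) and (a + 2, b + 1)
  between two integrations by parts and one addition relation.\<close>

lemma tricomi_integral_ode:
  assumes "Re a > 0" "x > 0"
  shows "x * tricomi_integral (a + 2) (b + 2) x = (b - x) * tricomi_integral (a + 1) (b + 1) x + a * tricomi_integral a b x"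
proof -
  have 1: "x * tricomi_integral (a + 2) (b + 2) x = (a + 1) * tricomi_integral (a + 1) (b + 1) x + (b - a - 1) * tricomi_integral (a + 2) (b + 1) x"
    using tricomi_integral_by_parts[of "a + 1" x "b + 1"] assms by (simp add: add.assoc)
  have 2: "tricomi_integral (a + 1) (b + 1) x = tricomi_integral (a + 1) b x + tricomi_integral (a + 2) (b + 1) x"
    using tricomi_integral_add[of "a + 1" x b] assms by (simp add: add.assoc)
  note 3 = tricomi_integral_by_parts[OF assms, of b]
  show ?thesis unfolding 1 using 2 3 by algebra
qed

section \<open>Scaled Gamma integrals\<close>

lemma set_integral_scale:
  fixes f :: "real \<Rightarrow> complex"
  assumes "c > 0"
  shows "(LBINT t:{0<..}. f t) = c * (LBINT t:{0<..}. f (c * t))"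
proof -
  have "(LBINT t:{0<..}. f t) = \<bar>c\<bar> *\<^sub>R (\<integral>t. indicator {0<..} (0 + c * t) *\<^sub>R f (0 + c * t) \<partial>lborel)"
    unfolding set_lebesgue_integral_def using assms by (intro lborel_integral_real_affine) auto
  also have "(\<lambda>t. indicator {0<..} (0 + c * t) *\<^sub>R f (0 + c * t)) = (\<lambda>t. indicator {0<..} t *\<^sub>R f (c * t))"
    using assms by (auto simp: indicator_def zero_less_mult_iff)
  finally show ?thesis using assms by (simp add: set_lebesgue_integral_def scaleR_conv_of_real)
qed

lemma set_integrable_cpowr_exp:
  assumes "Re a > 0" "x > 0"
  shows "set_integrable lborel {0<..} (\<lambda>t. of_real (exp (- (x * t))) * complex_of_real t powr (a - 1))"
proof -
  have "(\<lambda>t. complex_of_real t powr (a - 1) / of_real (exp (x * t))) absolutely_integrable_on {0<..}"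
    using absolutely_integrable_Gamma_integral[of a x] assms by simp
  then have "(\<lambda>t. of_real (exp (- (x * t))) * complex_of_real t powr (a - 1)) absolutely_integrable_on {0<..}"
    by (rule set_integrable_cong[THEN iffD1, rotated -1]) (auto simp: exp_minus field_simps)
  moreover have "(\<lambda>t. indicator {0<..} t *\<^sub>R (complex_of_real (exp (- (x * t))) * complex_of_real t powr (a - 1))) \<in> borel_measurable lborel"
    by measurable
  ultimately show ?thesis
    by (simp add: set_integrable_def integrable_completion)
qed

lemma set_integral_cpowr_exp:
  assumes a: "Re a > 0" and x: "x > 0"
  shows "(LBINT t:{0<..}. of_real (exp (- (x * t))) * complex_of_real t powr (a - 1)) = Gamma a * of_real x powr (- a)"
proof -
  have 1: "(LBINT t:{0<..}. of_real (exp (- (1 * t))) * complex_of_real t powr (a - 1)) = Gamma a"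
  proof -
    have "((\<lambda>t. of_real (exp (- (1 * t))) * complex_of_real t powr (a - 1)) has_integral Gamma a) {0<..}"
      using Gamma_integral_complex'[OF a] by (rule has_integral_eq[rotated]) (auto simp: exp_minus field_simps)
    then show ?thesis
      using set_borel_integral_eq_integral(2)[OF set_integrable_cpowr_exp[OF a, of 1]] by (simp add: integral_unique)
  qed
  have "Gamma a = x * (LBINT t:{0<..}. of_real (exp (- (x * t))) * complex_of_real (x * t) powr (a - 1))"
    using set_integral_scale[OF x, of "\<lambda>t. of_real (exp (- (1 * t))) * complex_of_real t powr (a - 1)"]
    unfolding 1 by (simp only: mult_1)
  also have "(LBINT t:{0<..}. of_real (exp (- (x * t))) * complex_of_real (x * t) powr (a - 1)) =
      (LBINT t:{0<..}. of_real x powr (a - 1) * (of_real (exp (- (x * t))) * complex_of_real t powr (a - 1)))"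
    using x by (intro set_lebesgue_integral_cong) (auto simp: powr_times_real)
  also have "\<dots> = of_real x powr (a - 1) * (LBINT t:{0<..}. of_real (exp (- (x * t))) * complex_of_real t powr (a - 1))"
    by simp
  finally have "Gamma a * of_real x powr (- a) = (x * of_real x powr (a - 1) * of_real x powr (- a)) * (LBINT t:{0<..}. of_real (exp (- (x * t))) * complex_of_real t powr (a - 1))"
    by (simp add: mult_ac)
  also have "x * of_real x powr (a - 1) * of_real x powr (- a) = (1::complex)"
    using x powr_add[of "complex_of_real x" 1 "a - 1"] powr_add[of "complex_of_real x" a "- a"] by simp
  finally show ?thesis by simp
qed

lemma set_integral_powr_exp:
  fixes r x :: real
  assumes "r > 0" "x > 0"
  shows "(LBINT t:{0<..}. t powr (r - 1) * exp (- (x * t))) = Gamma r * x powr (- r)"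
proof -
  have "complex_of_real (LBINT t:{0<..}. t powr (r - 1) * exp (- (x * t))) = (LBINT t:{0<..}. of_real (exp (- (x * t))) * complex_of_real t powr (of_real r - 1))"
    unfolding set_integral_complex_of_real[symmetric]
    by (intro set_lebesgue_integral_cong) (use powr_of_real[of _ "r - 1"] in auto)
  also have "\<dots> = Gamma (of_real r) * of_real x powr (- of_real r)"
    using assms by (intro set_integral_cpowr_exp) auto
  also have "\<dots> = of_real (Gamma r * x powr (- r))"
    using powr_of_real[of x "- r"] assms by (simp add: Gamma_complex_of_real)
  finally show ?thesis by (simp only: of_real_eq_iff)
qed

section \<open>Bounds and continuity in the parameters\<close>

lemma one_plus_powr_le_add:
  fixes t q :: real assumes "t > 0" "q \<le> 1"
  shows "(1 + t) powr q \<le> 1 + t powr q"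
proof -
  have "(1 + t) powr q = (1 + t) powr (q - 1) + t * (1 + t) powr (q - 1)"
    using assms powr_mult_base[of "1 + t" "q - 1"] by (simp add: ring_distribs)
  also have "\<dots> \<le> 1 powr (q - 1) + t * t powr (q - 1)"
    using assms by (intro add_mono mult_left_mono powr_mono2') auto
  also have "\<dots> = 1 + t powr q"
    using assms by (simp add: powr_diff)
  finally show ?thesis .
qed

lemma ratio_powr: "t > 0 \<Longrightarrow> (t / (1 + t)) powr c = t powr c * (1 + t) powr (- c)" for t c :: real
  by (simp add: powr_divide) (simp add: powr_minus divide_inverse)

text \<open>The bound does not depend on \<open>a\<close>: the powers with exponent Re a combine to
  (t/(1+t))^(Re a), whose base is below 1, so Re a may be lowered to r. What is left is at most
  t^(r-1) + t^(-3/4). For r = 1/4 the singularity at 0 is x^(-1/4), which is square integrable. The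
  margin up to Re b = 5/4 leaves room for \<open>b\<close> to approach 1.\<close>

lemma norm_tricomi_integral_le:
  assumes b: "Re b \<le> 5/4" and a: "r \<le> Re a" and r: "0 < r" "r \<le> 1/4" and x: "x > 0"
  shows "norm (tricomi_integral a b x) \<le> Gamma r * x powr (- r) + Gamma (1/4) * x powr (- (1/4))"
proof -
  have "norm (tricomi_integral a b x) \<le> (LBINT t:{0<..}. t powr (r - 1) * exp (- (x * t)) + t powr (1/4 - 1) * exp (- (x * t)))"
    unfolding tricomi_integral_def set_lebesgue_integral_def
  proof (rule Bochner_Integration.integral_norm_bound_integral)
    show "integrable lborel (\<lambda>t. indicator {0<..} t *\<^sub>R tricomi_integrand a b x t)"
      using set_integrable_tricomi[of a x b] a r x by (simp add: set_integrable_def)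
    have "set_integrable lborel {0<..} (\<lambda>t. t powr (r - 1) * exp (- (x * t)) + t powr (1/4 - 1) * exp (- (x * t)))"
      using r x by (intro set_integral_add set_integrable_powr_exp) auto
    then show "integrable lborel (\<lambda>t. indicator {0<..} t *\<^sub>R (t powr (r - 1) * exp (- (x * t)) + t powr (1/4 - 1) * exp (- (x * t))))"
      by (simp add: set_integrable_def)
    fix t :: real
    have "norm (tricomi_integrand a b x t) \<le> t powr (r - 1) * exp (- (x * t)) + t powr (1/4 - 1) * exp (- (x * t))" if t: "t > 0"
    proof -
      note q = ratio_powr[OF t]
      have "t powr (Re a - 1) * (1 + t) powr (Re b - Re a - 1) = (t powr Re a * t powr (-1)) * ((1 + t) powr (- Re a) * (1 + t) powr (Re b - 1))"
        by (simp only: powr_add[symmetric]) (simp add: algebra_simps)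
      also have "\<dots> = (t / (1 + t)) powr (Re a) * (t powr (-1) * (1 + t) powr (Re b - 1))"
        unfolding q by (simp only: mult_ac)
      also have "\<dots> \<le> (t / (1 + t)) powr r * (t powr (-1) * (1 + t) powr (1/4))"
      proof (rule mult_mono)
        show "(t / (1 + t)) powr Re a \<le> (t / (1 + t)) powr r"
          using t a r by (intro powr_mono') auto
        show "t powr (-1) * (1 + t) powr (Re b - 1) \<le> t powr (-1) * (1 + t) powr (1/4)"
          using t b by (intro mult_left_mono powr_mono) auto
      qed auto
      also have "\<dots> = (t powr r * t powr (-1)) * ((1 + t) powr (- r) * (1 + t) powr (1/4))"
        unfolding q by (simp only: mult_ac)
      also have "\<dots> = t powr (r - 1) * (1 + t) powr (1/4 - r)"
        by (simp only: powr_add[symmetric]) (simp add: algebra_simps)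
      also have "\<dots> \<le> t powr (r - 1) * (1 + t powr (1/4 - r))"
        using t r by (intro mult_left_mono one_plus_powr_le_add) auto
      also have "\<dots> = t powr (r - 1) + t powr (1/4 - 1)"
        using t by (simp add: ring_distribs flip: powr_add)
      finally have "t powr (Re a - 1) * (1 + t) powr (Re b - Re a - 1) \<le> t powr (r - 1) + t powr (1/4 - 1)" .
      from mult_right_mono[OF this, of "exp (- (x * t))"] t show ?thesis
        by (simp only: norm_tricomi_integrand ring_distribs mult_ac exp_ge_zero)
    qed
    then show "norm (indicator {0<..} t *\<^sub>R tricomi_integrand a b x t) \<le> indicator {0<..} t *\<^sub>R (t powr (r - 1) * exp (- (x * t)) + t powr (1/4 - 1) * exp (- (x * t)))"
      by (auto simp: indicator_def)
  qed
  also have "\<dots> = Gamma r * x powr (- r) + Gamma (1/4) * x powr (- (1/4))"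
    using r x set_integral_powr_exp[of r x] set_integral_powr_exp[of "1/4" x]
      set_integral_add(2)[OF set_integrable_powr_exp[of r x] set_integrable_powr_exp[of "1/4" x]] by simp
  finally show ?thesis .
qed

text \<open>Joint continuity in both parameters serves twice: in \<open>b\<close> for the extension
  of U to b = 1, and in \<open>a\<close> for reaching half-integral s.\<close>

lemma tendsto_tricomi_integral:
  assumes A: "A \<longlonglongrightarrow> a" and B: "B \<longlonglongrightarrow> b" and a: "Re a > 0" and x: "x > 0"
  shows "(\<lambda>n. tricomi_integral (A n) (B n) x) \<longlonglongrightarrow> tricomi_integral a b x"
proof -
  \<comment> \<open>Eventually p < Re (A n) < P and the exponent of 1 + t stays below Q. The power
    t^(p-1) then dominates for t <= 1 and t^(P-1) for t > 1; their sum gives the majorant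
    \<open>w\<close>.\<close>
  define p P Q where "p = Re a / 2" "P = 2 * Re a" "Q = \<bar>Re b - Re a - 1\<bar> + 1"
  define w where "w = (\<lambda>t. exp (- (x * t)) * t powr (p - 1) * (1 + t) powr Q + exp (- (x * t)) * t powr (P - 1) * (1 + t) powr Q)"
  have lim: "(\<lambda>n. Re (A n)) \<longlonglongrightarrow> Re a" "(\<lambda>n. Re (B n) - Re (A n) - 1) \<longlonglongrightarrow> Re b - Re a - 1"
    using A B by (auto intro!: tendsto_intros)
  have "\<forall>\<^sub>F n in sequentially. p < Re (A n) \<and> Re (A n) < P \<and> Re (B n) - Re (A n) - 1 < Q"
    using order_tendstoD(1)[OF lim(1), of p] order_tendstoD(2)[OF lim(1), of P] order_tendstoD(2)[OF lim(2), of Q] a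
    unfolding p_P_Q_def by (intro eventually_conj) auto
  then obtain N where N: "\<And>n. n \<ge> N \<Longrightarrow> p < Re (A n)" "\<And>n. n \<ge> N \<Longrightarrow> Re (A n) < P" "\<And>n. n \<ge> N \<Longrightarrow> Re (B n) - Re (A n) - 1 < Q"
    unfolding eventually_sequentially by blast
  have "(\<lambda>n. \<integral>t. indicator {0<..} t *\<^sub>R tricomi_integrand (A (n + N)) (B (n + N)) x t \<partial>lborel) \<longlonglongrightarrow> (\<integral>t. indicator {0<..} t *\<^sub>R tricomi_integrand a b x t \<partial>lborel)"
  proof (rule integral_dominated_convergence)
    show "integrable lborel (\<lambda>t. indicator {0<..} t *\<^sub>R w t)"
      using set_integral_add(1)[OF set_integrable_powr_powr_exp[of p x Q] set_integrable_powr_powr_exp[of P x Q]] a x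
      unfolding w_def by (simp add: set_integrable_def p_P_Q_def)
    show "AE t in lborel. (\<lambda>n. indicator {0<..} t *\<^sub>R tricomi_integrand (A (n + N)) (B (n + N)) x t) \<longlonglongrightarrow> indicator {0<..} t *\<^sub>R tricomi_integrand a b x t"
    proof (rule AE_I2)
      fix t :: real
      have "(\<lambda>n. tricomi_integrand (A (n + N)) (B (n + N)) x t) \<longlonglongrightarrow> tricomi_integrand a b x t" if "t > 0"
        unfolding tricomi_integrand_def using that
        by (intro tendsto_intros LIMSEQ_ignore_initial_segment A B tendsto_powr_complex)
           (auto simp: complex_nonpos_Reals_iff)
      then show "(\<lambda>n. indicator {0<..} t *\<^sub>R tricomi_integrand (A (n + N)) (B (n + N)) x t) \<longlonglongrightarrow> indicator {0<..} t *\<^sub>R tricomi_integrand a b x t"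
        by (cases "t > 0") auto
    qed
    show "AE t in lborel. norm (indicator {0<..} t *\<^sub>R tricomi_integrand (A (n + N)) (B (n + N)) x t) \<le> indicator {0<..} t *\<^sub>R w t" for n
    proof (rule AE_I2)
      fix t :: real
      have "norm (tricomi_integrand (A (n + N)) (B (n + N)) x t) \<le> w t" if t: "t > 0"
      proof -
        have "t powr (Re (A (n + N)) - 1) \<le> t powr (p - 1) + t powr (P - 1)"
        proof (cases "t \<le> 1")
          case True
          then have "t powr (Re (A (n + N)) - 1) \<le> t powr (p - 1)" using t N[of "n + N"] by (intro powr_mono') auto
          then show ?thesis by (simp add: add_increasing2)
        next
          case False
          then have "t powr (Re (A (n + N)) - 1) \<le> t powr (P - 1)" using t N[of "n + N"] by (intro powr_mono) auto
          then show ?thesis by (simp add: add_increasing)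
        qed
        moreover have "(1 + t) powr (Re (B (n + N)) - Re (A (n + N)) - 1) \<le> (1 + t) powr Q"
          using t N[of "n + N"] by (intro powr_mono) auto
        ultimately have "exp (- (x * t)) * t powr (Re (A (n + N)) - 1) * (1 + t) powr (Re (B (n + N)) - Re (A (n + N)) - 1)
            \<le> exp (- (x * t)) * (t powr (p - 1) + t powr (P - 1)) * (1 + t) powr Q"
          by (intro mult_mono mult_left_mono) auto
        then show ?thesis
          using t by (simp add: norm_tricomi_integrand w_def ring_distribs)
      qed
      then show "norm (indicator {0<..} t *\<^sub>R tricomi_integrand (A (n + N)) (B (n + N)) x t) \<le> indicator {0<..} t *\<^sub>R w t"
        by (auto simp: indicator_def)
    qed
  qed auto
  then show ?thesis
    unfolding tricomi_integral_def set_lebesgue_integral_def by (rule LIMSEQ_offset)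
qed

section \<open>Behaviour of the Euler integral at the origin\<close>

text \<open>The integrand is compared with two functions that have explicit antiderivatives,
  (t/(1+t))^A / A and -(1+t)^(-P) / P: the first controls t <= 1, the second t > 1.\<close>

lemma set_integrable_beta:
  fixes A P :: real
  assumes A: "A > 0" and P: "P > 0"
  shows "set_integrable lborel {0<..} (\<lambda>t. t powr (A - 1) * (1 + t) powr (- A - P))"
proof -
  have 1: "set_integrable lborel {0<..} (\<lambda>t. t powr (A - 1) * (1 + t) powr (- A - 1))"
  proof -
    \<comment> \<open>The endpoint 0 is kept in the form \<open>ereal c\<close>, which is the form
      of the limits at a finite endpoint below.\<close>
    have "set_integrable lborel (einterval (ereal c) \<infinity>) (\<lambda>t. t powr (A - 1) * (1 + t) powr (- A - 1))" if "c = 0" for c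
    proof (rule interval_integral_FTC_nonneg(1)[where F="\<lambda>t. (t / (1 + t)) powr A / A" and A=0 and B="1/A"])
      show "DERIV (\<lambda>t. (t / (1 + t)) powr A / A) t :> t powr (A - 1) * (1 + t) powr (- A - 1)" if "ereal c < ereal t" for t
      proof -
        have t: "t > 0" using that \<open>c = 0\<close> by simp
        have "DERIV (\<lambda>t. t / (1 + t)) t :> (1 * (1 + t) - t * 1) / ((1 + t) * (1 + t))"
          using t by (intro DERIV_divide) (auto intro!: derivative_eq_intros)
        from DERIV_cdivide[OF DERIV_fun_powr[OF this, of A], of A]
        have "DERIV (\<lambda>t. (t / (1 + t)) powr A / A) t :> (A * (t / (1 + t)) powr (A - 1) * ((1 * (1 + t) - t * 1) / ((1 + t) * (1 + t)))) / A"
          using t by simp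
        also have "(A * (t / (1 + t)) powr (A - 1) * ((1 * (1 + t) - t * 1) / ((1 + t) * (1 + t)))) / A = (t / (1 + t)) powr (A - 1) * (1 + t) powr (-2)"
          using A t by (simp add: powr_minus power2_eq_square divide_inverse powr_numeral)
        also have "(t / (1 + t)) powr (A - 1) = t powr (A - 1) * (1 + t) powr (- (A - 1))"
          by (rule ratio_powr[OF t])
        also have "t powr (A - 1) * (1 + t) powr (- (A - 1)) * (1 + t) powr (-2) = t powr (A - 1) * (1 + t) powr (- A - 1)"
          by (simp only: mult.assoc powr_add[symmetric]) (simp add: algebra_simps)
        finally show ?thesis .
      qed
      show "isCont (\<lambda>t. t powr (A - 1) * (1 + t) powr (- A - 1)) t" if "ereal c < ereal t" for t
        using that \<open>c = 0\<close> by (intro continuous_intros) auto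
      have "((\<lambda>t. (t / (1 + t)) powr A / A) \<longlongrightarrow> 0) (at_right 0)"
        using A by (real_asymp; simp add: inverse_eq_divide)
      then show "(((\<lambda>t. (t / (1 + t)) powr A / A) \<circ> real_of_ereal) \<longlongrightarrow> 0) (at_right (ereal c))"
        using \<open>c = 0\<close> by (simp only: ereal_tendsto_simps)
      have "((\<lambda>t. (t / (1 + t)) powr A / A) \<longlongrightarrow> 1 / A) at_top"
        using A by (real_asymp; simp add: inverse_eq_divide)
      then show "(((\<lambda>t. (t / (1 + t)) powr A / A) \<circ> real_of_ereal) \<longlongrightarrow> 1 / A) (at_left \<infinity>)"
        by (simp only: ereal_tendsto_simps)
    qed (auto simp: \<open>c = 0\<close>)
    from this[of 0] show ?thesis by (simp only: einterval_eq)
  qed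
  have 2: "set_integrable lborel {0<..} (\<lambda>t. (1 + t) powr (- 1 - P))"
  proof -
    have "set_integrable lborel (einterval (ereal c) \<infinity>) (\<lambda>t. (1 + t) powr (- 1 - P))" if "c = 0" for c
    proof (rule interval_integral_FTC_nonneg(1)[where F="\<lambda>t. - ((1 + t) powr (- P) / P)" and A="-1/P" and B=0])
      show "DERIV (\<lambda>t. - ((1 + t) powr (- P) / P)) t :> (1 + t) powr (- 1 - P)" if "ereal c < ereal t" for t
      proof -
        have t: "t > 0" using that \<open>c = 0\<close> by simp
        have "DERIV (\<lambda>t. - ((1 + t) powr (- P) / P)) t :> - ((- P * (1 + t) powr (- P - 1) * 1) / P)"
          using t by (auto intro!: derivative_eq_intros DERIV_powr[THEN DERIV_cong] simp: powr_diff)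
        moreover have "- ((- P * (1 + t) powr (- P - 1) * 1) / P) = (1 + t) powr (- 1 - P)"
          using P arg_cong[of "- P - 1" "- 1 - P" "\<lambda>e. (1 + t) powr e"] by simp
        ultimately show ?thesis by (rule DERIV_cong)
      qed
      show "isCont (\<lambda>t. (1 + t) powr (- 1 - P)) t" if "ereal c < ereal t" for t
        using that \<open>c = 0\<close> by (intro continuous_intros) auto
      have "((\<lambda>t. - ((1 + t) powr (- P) / P)) \<longlongrightarrow> -1/P) (at_right 0)"
        using P by (real_asymp; simp add: inverse_eq_divide)
      then show "(((\<lambda>t. - ((1 + t) powr (- P) / P)) \<circ> real_of_ereal) \<longlongrightarrow> -1/P) (at_right (ereal c))"
        using \<open>c = 0\<close> by (simp only: ereal_tendsto_simps)
      have "((\<lambda>t. - ((1 + t) powr (- P) / P)) \<longlongrightarrow> 0) at_top"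
        using P by (real_asymp; simp add: inverse_eq_divide)
      then show "(((\<lambda>t. - ((1 + t) powr (- P) / P)) \<circ> real_of_ereal) \<longlongrightarrow> 0) (at_left \<infinity>)"
        by (simp only: ereal_tendsto_simps)
    qed (auto simp: \<open>c = 0\<close>)
    from this[of 0] show ?thesis by (simp only: einterval_eq)
  qed
  \<comment> \<open>The first summand bounds (t/(1+t))^(A-1) for t > 1, the second bounds
    (1+t)^(1-P) for t <= 1; in both cases the base or its reciprocal lies between 1 and 2.\<close>
  define C where "C = 2 powr \<bar>A - 1\<bar> + 2 powr \<bar>P - 1\<bar>"
  show ?thesis
  proof (rule set_integrable_bound)
    show "set_integrable lborel {0<..} (\<lambda>t. C * (t powr (A - 1) * (1 + t) powr (- A - 1)) + C * (1 + t) powr (- 1 - P))"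
      by (intro set_integral_add set_integrable_mult_right 1 2)
    show "AE t in lborel. t \<in> {0<..} \<longrightarrow> norm (t powr (A - 1) * (1 + t) powr (- A - P)) \<le> norm (C * (t powr (A - 1) * (1 + t) powr (- A - 1)) + C * (1 + t) powr (- 1 - P))"
    proof (intro AE_I2 impI)
      fix t :: real assume "t \<in> {0<..}" then have t: "t > 0" by simp
      have C: "C \<ge> 0" by (simp add: C_def)
      have "t powr (A - 1) * (1 + t) powr (- A - P) \<le> C * (t powr (A - 1) * (1 + t) powr (- A - 1)) + C * (1 + t) powr (- 1 - P)"
      proof (cases "t \<le> 1")
        case True
        have "(1 + t) powr (1 - P) \<le> 2 powr \<bar>P - 1\<bar>"
          using t True by (intro order.trans[OF powr_mono[of "1 - P" "\<bar>P - 1\<bar>"] powr_mono2]) auto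
        also have "\<dots> \<le> C" by (simp add: C_def)
        finally have le: "(1 + t) powr (1 - P) \<le> C" .
        have "(1 + t) powr (- A - P) = (1 + t) powr (1 - P) * (1 + t) powr (- A - 1)"
          by (simp only: powr_add[symmetric]) (simp add: algebra_simps)
        also have "\<dots> \<le> C * (1 + t) powr (- A - 1)"
          by (rule mult_right_mono[OF le]) simp
        finally have "(1 + t) powr (- A - P) \<le> C * (1 + t) powr (- A - 1)" .
        from mult_left_mono[OF this, of "t powr (A - 1)"]
        have "t powr (A - 1) * (1 + t) powr (- A - P) \<le> C * (t powr (A - 1) * (1 + t) powr (- A - 1))"
          by (simp add: mult_ac)
        then show ?thesis using C by (simp add: add_increasing2)
      next
        case False
        have "t powr (A - 1) * (1 + t) powr (- A - P) = (t / (1 + t)) powr (A - 1) * (1 + t) powr (- 1 - P)"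
        proof -
          have "(t / (1 + t)) powr (A - 1) = t powr (A - 1) * (1 + t) powr (- (A - 1))"
            by (rule ratio_powr[OF t])
          then show ?thesis
            by (simp only: mult.assoc powr_add[symmetric]) (simp add: algebra_simps)
        qed
        also have "\<dots> \<le> C * (1 + t) powr (- 1 - P)"
        proof (rule mult_right_mono)
          have "(t / (1 + t)) powr (A - 1) = ((1 + t) / t) powr (1 - A)"
            using powr_minus_divide[of "t / (1 + t)" "1 - A"] t by (simp add: powr_divide)
          also have "\<dots> \<le> 2 powr \<bar>A - 1\<bar>"
            using t False by (intro order.trans[OF powr_mono[of "1 - A" "\<bar>A - 1\<bar>"] powr_mono2]) (auto simp: field_simps)
          also have "\<dots> \<le> C" by (simp add: C_def)
          finally show "(t / (1 + t)) powr (A - 1) \<le> C" .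
        qed simp
        finally show ?thesis using C by (simp add: add_increasing)
      qed
      then show "norm (t powr (A - 1) * (1 + t) powr (- A - P)) \<le> norm (C * (t powr (A - 1) * (1 + t) powr (- A - 1)) + C * (1 + t) powr (- 1 - P))"
        by (simp add: abs_mult)
    qed
  qed (auto simp: set_borel_measurable_def)
qed

text \<open>Fubini for \<open>t powr (a - 1) * u powr (a + p - 1) * exp (- u (1 + t))\<close>.\<close>
lemma set_integral_beta:
  assumes a: "Re a > 0" and p: "Re p > 0"
  shows "(LBINT t:{0<..}. complex_of_real t powr (a - 1) * complex_of_real (1 + t) powr (- a - p)) * Gamma (a + p) = Gamma a * Gamma p"
proof -
  define h where "h = (\<lambda>t u. indicator {0<..} t *\<^sub>R indicator {0<..} u *\<^sub>R (complex_of_real t powr (a - 1) * complex_of_real u powr (a + p - 1) * of_real (exp (- (u * (1 + t))))))"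
  have [measurable]: "case_prod h \<in> borel_measurable (lborel \<Otimes>\<^sub>M lborel)"
    unfolding h_def by measurable
  have 1: "(\<integral>u. h t u \<partial>lborel) = indicator {0<..} t *\<^sub>R (complex_of_real t powr (a - 1) * complex_of_real (1 + t) powr (- a - p)) * Gamma (a + p)" for t
  proof (cases "t > 0")
    case True
    have "(\<integral>u. h t u \<partial>lborel) = (LBINT u:{0<..}. complex_of_real t powr (a - 1) * (of_real (exp (- ((1 + t) * u))) * complex_of_real u powr (a + p - 1)))"
      unfolding set_lebesgue_integral_def h_def using True by (intro Bochner_Integration.integral_cong) (auto simp: mult_ac)
    also have "\<dots> = complex_of_real t powr (a - 1) * (Gamma (a + p) * of_real (1 + t) powr (- (a + p)))"
      unfolding set_integral_mult_right using True a p by (subst set_integral_cpowr_exp) auto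
    finally show ?thesis using True by (simp add: algebra_simps)
  qed (auto simp: h_def)
  have 2: "(\<integral>t. h t u \<partial>lborel) = indicator {0<..} u *\<^sub>R (Gamma a * (of_real (exp (- (1 * u))) * complex_of_real u powr (p - 1)))" for u
  proof (cases "u > 0")
    case True
    have "(\<integral>t. h t u \<partial>lborel) = (LBINT t:{0<..}. (complex_of_real u powr (a + p - 1) * of_real (exp (- u))) * (of_real (exp (- (u * t))) * complex_of_real t powr (a - 1)))"
      unfolding set_lebesgue_integral_def h_def using True
      by (intro Bochner_Integration.integral_cong) (auto simp: ring_distribs exp_add mult_ac exp_diff exp_minus divide_inverse)
    also have "\<dots> = (complex_of_real u powr (a + p - 1) * of_real (exp (- u))) * (Gamma a * of_real u powr (- a))"
      unfolding set_integral_mult_right using True a p by (subst set_integral_cpowr_exp) auto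
    also have "\<dots> = Gamma a * (of_real (exp (- (1 * u))) * (complex_of_real u powr (a + p - 1) * of_real u powr (- a)))"
      by (simp add: mult_ac)
    also have "complex_of_real u powr (a + p - 1) * of_real u powr (- a) = of_real u powr (p - 1)"
      by (simp only: powr_add[symmetric]) (simp add: algebra_simps)
    finally show ?thesis using True by simp
  qed (auto simp: h_def)
  have 3: "norm (h t u) = indicator {0<..} t *\<^sub>R indicator {0<..} u *\<^sub>R (t powr (Re a - 1) * (u powr (Re a + Re p - 1) * exp (- ((1 + t) * u))))" for t u
    by (auto simp: h_def indicator_def norm_mult norm_cpowr mult_ac)
  have 4: "(\<integral>u. norm (h t u) \<partial>lborel) = indicator {0<..} t *\<^sub>R (t powr (Re a - 1) * (1 + t) powr (- Re a - Re p)) * Gamma (Re a + Re p)" for t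
  proof (cases "t > 0")
    case True
    have "(\<integral>u. norm (h t u) \<partial>lborel) = (LBINT u:{0<..}. t powr (Re a - 1) * (u powr (Re a + Re p - 1) * exp (- ((1 + t) * u))))"
      unfolding set_lebesgue_integral_def 3 using True by simp
    also have "\<dots> = t powr (Re a - 1) * (Gamma (Re a + Re p) * (1 + t) powr (- (Re a + Re p)))"
      unfolding set_integral_mult_right using True a p by (subst set_integral_powr_exp) auto
    finally show ?thesis using True by (simp add: algebra_simps)
  qed (auto simp: h_def)
  have int: "integrable (lborel \<Otimes>\<^sub>M lborel) (case_prod h)"
  proof (rule lborel_pair.Fubini_integrable)
    have "integrable lborel (\<lambda>t. indicator {0<..} t *\<^sub>R (t powr (Re a - 1) * (1 + t) powr (- Re a - Re p)) * Gamma (Re a + Re p))"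
      using set_integrable_beta[OF a p] unfolding set_integrable_def by (rule integrable_mult_left)
    then show "integrable lborel (\<lambda>t. \<integral>u. norm (case_prod h (t, u)) \<partial>lborel)"
      by (simp only: 4 prod.case)
    show "AE t in lborel. integrable lborel (\<lambda>u. case_prod h (t, u))"
    proof (rule AE_I2)
      fix t :: real
      show "integrable lborel (\<lambda>u. case_prod h (t, u))"
      proof (cases "t > 0")
        case True
        have "set_integrable lborel {0<..} (\<lambda>u. complex_of_real t powr (a - 1) * (of_real (exp (- ((1 + t) * u))) * complex_of_real u powr (a + p - 1)))"
          using True a p by (intro set_integrable_mult_right set_integrable_cpowr_exp) auto
        moreover have "(\<lambda>u. case_prod h (t, u)) = (\<lambda>u. indicator {0<..} u *\<^sub>R (complex_of_real t powr (a - 1) * (of_real (exp (- ((1 + t) * u))) * complex_of_real u powr (a + p - 1))))"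
          using True by (auto simp: h_def mult_ac)
        ultimately show ?thesis unfolding set_integrable_def by simp
      qed (auto simp: h_def)
    qed
  qed measurable
  have "(\<integral>t. (\<integral>u. h t u \<partial>lborel) \<partial>lborel) = (\<integral>u. (\<integral>t. h t u \<partial>lborel) \<partial>lborel)"
    using lborel_pair.Fubini_integral[OF int] by simp
  moreover have "(\<integral>t. (\<integral>u. h t u \<partial>lborel) \<partial>lborel) = (LBINT t:{0<..}. complex_of_real t powr (a - 1) * complex_of_real (1 + t) powr (- a - p)) * Gamma (a + p)"
    unfolding 1 set_lebesgue_integral_def by (rule integral_mult_left_zero)
  moreover have "(\<integral>u. (\<integral>t. h t u \<partial>lborel) \<partial>lborel) = Gamma a * Gamma p"
    using set_integral_mult_right[of lborel "{0<..}" "Gamma a" "\<lambda>u. of_real (exp (- (1 * u))) * complex_of_real u powr (p - 1)"]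
      set_integral_cpowr_exp[OF p, of 1]
    unfolding 2 set_lebesgue_integral_def by simp
  ultimately show ?thesis by simp
qed

text \<open>The value at \<open>x = 0\<close> is a beta integral when \<open>0 < Re a\<close> and \<open>Re b < 1\<close>.\<close>
lemma tendsto_tricomi_integral_0:
  assumes a: "Re a > 0" and b: "Re b < 1"
  shows "(tricomi_integral a b \<longlongrightarrow> Gamma a * Gamma (1 - b) * rGamma (a - b + 1)) (at_right 0)"
proof -
  have int0: "norm (tricomi_integrand a b 0 t) = t powr (Re a - 1) * (1 + t) powr (- Re a - (1 - Re b))" if "t > 0" for t
    using that by (simp add: norm_tricomi_integrand algebra_simps)
  \<comment> \<open>At x = 0 the integrand still decays like t^(Re b - 2), which is integrable at
    infinity because Re b < 1; it also dominates all integrands with x > 0.\<close>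
  have "(tricomi_integral a b \<longlongrightarrow> tricomi_integral a b 0) (at_right 0)"
    unfolding tendsto_at_iff_sequentially comp_def
  proof (intro allI impI)
    fix X :: "nat \<Rightarrow> real" assume X: "\<forall>i. X i \<in> {0<..} - {0}" "X \<longlonglongrightarrow> 0"
    show "(\<lambda>i. tricomi_integral a b (X i)) \<longlonglongrightarrow> tricomi_integral a b 0"
      unfolding tricomi_integral_def set_lebesgue_integral_def
    proof (rule integral_dominated_convergence)
      show "integrable lborel (\<lambda>t. indicator {0<..} t *\<^sub>R (t powr (Re a - 1) * (1 + t) powr (- Re a - (1 - Re b))))"
        using set_integrable_beta[of "Re a" "1 - Re b"] a b unfolding set_integrable_def by simp
      show "AE t in lborel. (\<lambda>i. indicator {0<..} t *\<^sub>R tricomi_integrand a b (X i) t) \<longlonglongrightarrow> indicator {0<..} t *\<^sub>R tricomi_integrand a b 0 t"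
        unfolding tricomi_integrand_def by (intro AE_I2 tendsto_intros X)
      show "AE t in lborel. norm (indicator {0<..} t *\<^sub>R tricomi_integrand a b (X i) t) \<le> indicator {0<..} t *\<^sub>R (t powr (Re a - 1) * (1 + t) powr (- Re a - (1 - Re b)))" for i
      proof (rule AE_I2)
        fix t :: real
        have "norm (tricomi_integrand a b (X i) t) \<le> norm (tricomi_integrand a b 0 t)" if t: "t > 0"
        proof -
          have "exp (- (X i * t)) \<le> 1" using X(1) t by (auto simp: less_eq_real_def)
          then show ?thesis using t by (auto simp: norm_tricomi_integrand intro!: mult_right_mono mult_left_le_one_le)
        qed
        then show "norm (indicator {0<..} t *\<^sub>R tricomi_integrand a b (X i) t) \<le> indicator {0<..} t *\<^sub>R (t powr (Re a - 1) * (1 + t) powr (- Re a - (1 - Re b)))"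
          using int0[of t] by (auto simp: indicator_def)
      qed
    qed auto
  qed
  moreover have "tricomi_integral a b 0 = Gamma a * Gamma (1 - b) * rGamma (a - b + 1)"
  proof -
    have "tricomi_integral a b 0 * Gamma (a + (1 - b)) = Gamma a * Gamma (1 - b)"
      using set_integral_beta[of a "1 - b"] a b by (simp add: tricomi_integral_def tricomi_integrand_def algebra_simps)
    moreover have "Gamma (a + (1 - b)) \<noteq> 0"
    proof -
      have "Re (a + (1 - b)) > 0" using a b by simp
      then have "a + (1 - b) \<notin> \<int>\<^sub>\<le>\<^sub>0" using complex_nonpos_Reals_iff nonpos_Ints_subset_nonpos_Reals by fastforce
      then show ?thesis by (simp add: Gamma_eq_zero_iff)
    qed
    ultimately show ?thesis by (simp add: rGamma_inverse_Gamma field_simps)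
  qed
  ultimately show ?thesis by simp
qed

text \<open>Substitute \<open>t = u / x\<close>.\<close>
lemma tendsto_powr_tricomi_integral_0:
  assumes a: "Re a > 0" and b: "Re b > 1"
  shows "((\<lambda>x. of_real x powr (b - 1) * tricomi_integral a b x) \<longlongrightarrow> Gamma (b - 1)) (at_right 0)"
proof -
  define k where "k = (\<lambda>x u. of_real (exp (- (1 * u))) * of_real u powr (a - 1) * complex_of_real (x + u) powr (b - a - 1))"
  have eq: "of_real x powr (b - 1) * tricomi_integral a b x = (LBINT u:{0<..}. k x u)" if x: "x > 0" for x
  proof -
    have "(LBINT u:{0<..}. k x u) = x * (LBINT u:{0<..}. k x (x * u))"
      by (rule set_integral_scale[OF x])
    also have "(LBINT u:{0<..}. k x (x * u)) = (LBINT u:{0<..}. of_real x powr (b - 2) * tricomi_integrand a b x u)"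
    proof (intro set_lebesgue_integral_cong allI impI)
      fix u :: real assume "u \<in> {0<..}" then have u: "u > 0" by simp
      have "k x (x * u) = (of_real x powr (a - 1) * complex_of_real x powr (b - a - 1)) * tricomi_integrand a b x u"
      proof -
        have "complex_of_real (x + x * u) = of_real x * of_real (1 + u)" by (simp add: algebra_simps)
        then have "complex_of_real (x + x * u) powr (b - a - 1) = of_real x powr (b - a - 1) * of_real (1 + u) powr (b - a - 1)"
          using x u by (simp only:) (rule powr_times_real, auto)
        moreover have "complex_of_real (x * u) powr (a - 1) = of_real x powr (a - 1) * of_real u powr (a - 1)"
          using x u by (simp add: powr_times_real)
        ultimately show ?thesis unfolding k_def tricomi_integrand_def by (simp only: mult_1 mult_ac)
      qed
      also have "of_real x powr (a - 1) * complex_of_real x powr (b - a - 1) = of_real x powr (b - 2)"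
        by (simp only: powr_add[symmetric]) simp
      finally show "k x (x * u) = of_real x powr (b - 2) * tricomi_integrand a b x u" .
    qed auto
    also have "\<dots> = of_real x powr (b - 2) * tricomi_integral a b x"
      by (simp add: tricomi_integral_def)
    also have "x * (of_real x powr (b - 2) * tricomi_integral a b x) = of_real x powr (b - 1) * tricomi_integral a b x"
      using x powr_add[of "complex_of_real x" 1 "b - 2"] by simp
    finally show ?thesis by simp
  qed
  have "((\<lambda>x. LBINT u:{0<..}. k x u) \<longlongrightarrow> (LBINT u:{0<..}. k 0 u)) (at_right 0)"
    unfolding tendsto_at_iff_sequentially comp_def
  proof (intro allI impI)
    fix X :: "nat \<Rightarrow> real" assume X: "\<forall>i. X i \<in> {0<..} - {0}" "X \<longlonglongrightarrow> 0"
    then have Xpos: "X i > 0" for i by auto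
    obtain N where N: "\<And>n. n \<ge> N \<Longrightarrow> X n < 1"
      using order_tendstoD(2)[OF X(2), of 1] unfolding eventually_sequentially by auto
    \<comment> \<open>Covers both signs of the exponent Re b - Re a - 1 of x + u: if it is
      nonnegative, x + u is enlarged to 1 + u, otherwise it is lowered to u.\<close>
    define w where "w = (\<lambda>u. u powr (Re b - 1 - 1) * exp (- (1 * u)) + exp (- (1 * u)) * u powr (Re a - 1) * (1 + u) powr (Re b - Re a - 1))"
    have "(\<lambda>i. \<integral>u. indicator {0<..} u *\<^sub>R k (X (i + N)) u \<partial>lborel) \<longlonglongrightarrow> (\<integral>u. indicator {0<..} u *\<^sub>R k 0 u \<partial>lborel)"
    proof (rule integral_dominated_convergence)
      show "integrable lborel (\<lambda>u. indicator {0<..} u *\<^sub>R w u)"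
        using set_integral_add(1)[OF set_integrable_powr_exp[of "Re b - 1" 1] set_integrable_powr_powr_exp[of "Re a" 1 "Re b - Re a - 1"]] a b
        unfolding set_integrable_def w_def by simp
      show "AE u in lborel. (\<lambda>i. indicator {0<..} u *\<^sub>R k (X (i + N)) u) \<longlonglongrightarrow> indicator {0<..} u *\<^sub>R k 0 u"
      proof (rule AE_I2)
        fix u :: real
        have "(\<lambda>i. k (X (i + N)) u) \<longlonglongrightarrow> k 0 u" if "u > 0"
          unfolding k_def using that
          by (intro tendsto_intros tendsto_powr_complex LIMSEQ_ignore_initial_segment X(2)) (auto simp: complex_nonpos_Reals_iff)
        then show "(\<lambda>i. indicator {0<..} u *\<^sub>R k (X (i + N)) u) \<longlonglongrightarrow> indicator {0<..} u *\<^sub>R k 0 u"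
          by (cases "u > 0") auto
      qed
      show "AE u in lborel. norm (indicator {0<..} u *\<^sub>R k (X (i + N)) u) \<le> indicator {0<..} u *\<^sub>R w u" for i
      proof (rule AE_I2)
        fix u :: real
        have "norm (k (X (i + N)) u) \<le> w u" if u: "u > 0"
        proof -
          let ?x = "X (i + N)"
          have x: "?x > 0" "?x < 1" using Xpos N by auto
          have "norm (k ?x u) = exp (- (1 * u)) * u powr (Re a - 1) * (?x + u) powr (Re b - Re a - 1)"
            unfolding k_def using x u by (simp add: norm_mult norm_cpowr del: of_real_add)
          also have "\<dots> \<le> exp (- (1 * u)) * u powr (Re a - 1) * (u powr (Re b - Re a - 1) + (1 + u) powr (Re b - Re a - 1))"
          proof (intro mult_left_mono)
            show "(?x + u) powr (Re b - Re a - 1) \<le> u powr (Re b - Re a - 1) + (1 + u) powr (Re b - Re a - 1)"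
            proof (cases "Re b - Re a - 1 \<ge> 0")
              case True
              then have "(?x + u) powr (Re b - Re a - 1) \<le> (1 + u) powr (Re b - Re a - 1)" using x u by (intro powr_mono2) auto
              then show ?thesis by (simp add: add_increasing)
            next
              case False
              then have "(?x + u) powr (Re b - Re a - 1) \<le> u powr (Re b - Re a - 1)" using x u by (intro powr_mono2') auto
              then show ?thesis by (simp add: add_increasing2)
            qed
          qed auto
          also have "\<dots> = (u powr (Re a - 1) * u powr (Re b - Re a - 1)) * exp (- (1 * u)) + exp (- (1 * u)) * u powr (Re a - 1) * (1 + u) powr (Re b - Re a - 1)"
            by (simp only: ring_distribs mult_ac)
          also have "u powr (Re a - 1) * u powr (Re b - Re a - 1) = u powr (Re b - 1 - 1)"
            by (simp only: powr_add[symmetric]) simp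
          finally show ?thesis unfolding w_def .
        qed
        then show "norm (indicator {0<..} u *\<^sub>R k (X (i + N)) u) \<le> indicator {0<..} u *\<^sub>R w u"
          by (auto simp: indicator_def)
      qed
      show "(\<lambda>u. indicator {0<..} u *\<^sub>R k 0 u) \<in> borel_measurable lborel" unfolding k_def by measurable
      show "(\<lambda>u. indicator {0<..} u *\<^sub>R k (X (i + N)) u) \<in> borel_measurable lborel" for i
        unfolding k_def using measurable_compose[OF _ cpowr_measurable[of "b - a - 1"], of "\<lambda>u. X (i + N) + u" borel]
        by (intro borel_measurable_scaleR borel_measurable_times) (auto simp del: of_real_add)
    qed
    then show "(\<lambda>i. LBINT u:{0<..}. k (X i) u) \<longlonglongrightarrow> (LBINT u:{0<..}. k 0 u)"
      unfolding set_lebesgue_integral_def by (rule LIMSEQ_offset)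
  qed
  moreover have "(LBINT u:{0<..}. k 0 u) = Gamma (b - 1)"
  proof -
    have "(LBINT u:{0<..}. k 0 u) = (LBINT u:{0<..}. of_real (exp (- (1 * u))) * complex_of_real u powr (b - 1 - 1))"
    proof (intro set_lebesgue_integral_cong allI impI)
      fix u :: real
      have "complex_of_real u powr (a - 1) * of_real u powr (b - a - 1) = of_real u powr (b - 1 - 1)"
        by (simp only: powr_add[symmetric]) simp
      then show "k 0 u = of_real (exp (- (1 * u))) * complex_of_real u powr (b - 1 - 1)"
        unfolding k_def by (simp only: add_0 mult.assoc)
    qed auto
    also have "\<dots> = Gamma (b - 1)"
      using b by (subst set_integral_cpowr_exp) auto
    finally show ?thesis .
  qed
  ultimately have "((\<lambda>x. LBINT u:{0<..}. k x u) \<longlongrightarrow> Gamma (b - 1)) (at_right 0)" by simp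
  then show ?thesis
    by (rule Lim_transform_eventually) (use eq eventually_at_right_less[of "0::real"] in \<open>auto elim!: eventually_mono\<close>)
qed

section \<open>Confluent hypergeometric series\<close>

lemma hyp1F1_nth: "fps_nth (fps_hypergeo [a] [b] (1::complex)) n = pochhammer a n / (pochhammer b n * fact n)"
  by simp

text \<open>If a = -m the series terminates and quotients of coefficients are meaningless; otherwise
  the ratio test applies, the quotients (b + n)(n + 1)/(a + n) tending to infinity.\<close>

lemma fps_conv_radius_hyp1F1:
  assumes "b \<notin> \<int>\<^sub>\<le>\<^sub>0"
  shows "fps_conv_radius (fps_hypergeo [a] [b] (1::complex)) = \<infinity>"
proof (cases "a \<in> \<int>\<^sub>\<le>\<^sub>0")
  case True
  then obtain m where m: "a = - of_nat m" by (auto elim: nonpos_Ints_cases')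
  have "fps_nth (fps_hypergeo [a] [b] (1::complex)) n = 0" if "n > m" for n
    using that by (simp add: m pochhammer_of_nat_eq_0_iff)
  then have "\<forall>\<^sub>F n in sequentially. fps_nth (fps_hypergeo [a] [b] (1::complex)) n = 0"
    by (intro eventually_sequentiallyI[of "Suc m"]) auto
  then have "conv_radius (fps_nth (fps_hypergeo [a] [b] (1::complex))) = conv_radius (\<lambda>_. 0 :: complex)"
    by (intro conv_radius_cong') auto
  then show ?thesis
    by (simp add: fps_conv_radius_def)
next
  case False
  have nz: "pochhammer a n \<noteq> 0" "pochhammer b n \<noteq> 0" for n
    using False assms by (auto simp: pochhammer_eq_0_iff)
  have "(\<lambda>n. norm (pochhammer a n / (pochhammer b n * fact n)) / norm (pochhammer a (Suc n) / (pochhammer b (Suc n) * fact (Suc n)))) = (\<lambda>n. norm ((b + of_nat n) / (a + of_nat n)) * real (Suc n))"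
  proof
    fix n
    have "a + of_nat n \<noteq> 0" "b + of_nat n \<noteq> 0" using nz[of "Suc n"] by (auto simp: pochhammer_Suc)
    then show "norm (pochhammer a n / (pochhammer b n * fact n)) / norm (pochhammer a (Suc n) / (pochhammer b (Suc n) * fact (Suc n))) = norm ((b + of_nat n) / (a + of_nat n)) * real (Suc n)"
    proof -
      have "norm (P / (Q * F)) / norm (P * x / (Q * y * (of_nat (Suc n) * F))) = norm (y / x) * real (Suc n)"
        if "P \<noteq> 0" "Q \<noteq> 0" "F \<noteq> 0" "x \<noteq> 0" "y \<noteq> 0" for P Q F x y :: complex
        using that by (simp add: norm_divide norm_mult del: of_nat_Suc)
      from this[of "pochhammer a n" "pochhammer b n" "fact n" "a + of_nat n" "b + of_nat n"] nz[of n]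
        \<open>a + of_nat n \<noteq> 0\<close> \<open>b + of_nat n \<noteq> 0\<close> show ?thesis
        by (simp only: pochhammer_Suc fact_Suc fact_nonzero not_False_eq_True)
    qed
  qed
  moreover have "filterlim (\<lambda>n. norm ((b + of_nat n) / (a + of_nat n)) * real (Suc n)) at_top sequentially"
  proof (rule filterlim_tendsto_pos_mult_at_top)
    have "(\<lambda>n. (b / of_nat n + 1) / (a / of_nat n + 1)) \<longlonglongrightarrow> (0 + 1) / (0 + 1)"
      by (intro tendsto_intros tendsto_divide_0[OF tendsto_const] tendsto_of_nat) auto
    then have "(\<lambda>n. (b / of_nat n + 1) / (a / of_nat n + 1)) \<longlonglongrightarrow> 1" by simp
    then have "(\<lambda>n. (b + of_nat n) / (a + of_nat n)) \<longlonglongrightarrow> 1"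
    proof (rule Lim_transform_eventually)
      show "\<forall>\<^sub>F n in sequentially. (b / of_nat n + 1) / (a / of_nat n + 1) = (b + of_nat n) / (a + of_nat n)"
        using eventually_gt_at_top[of 0] proof eventually_elim
        case (elim n)
        then have "b / of_nat n + 1 = (b + of_nat n) / of_nat n" "a / of_nat n + 1 = (a + of_nat n) / of_nat n"
          by (simp_all add: add_divide_distrib)
        with elim show ?case by simp
      qed
    qed
    then show "(\<lambda>n. norm ((b + of_nat n) / (a + of_nat n))) \<longlonglongrightarrow> 1"
      using tendsto_norm by fastforce
    show "filterlim (\<lambda>n. real (Suc n)) at_top sequentially"
      using filterlim_real_sequentially filterlim_sequentially_Suc by blast
  qed auto
  ultimately have "(\<lambda>n. ereal (norm (pochhammer a n / (pochhammer b n * fact n)) / norm (pochhammer a (Suc n) / (pochhammer b (Suc n) * fact (Suc n))))) \<longlonglongrightarrow> \<infinity>"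
    by (simp add: tendsto_PInfty_eq_at_top del: fact_Suc)
  then show ?thesis
    unfolding fps_conv_radius_def
    by (intro conv_radius_ratio_limit_ereal) (auto simp: nz simp del: fact_Suc)
qed

lemma hyp1F1_sums:
  assumes "b \<notin> \<int>\<^sub>\<le>\<^sub>0"
  shows "(\<lambda>n. pochhammer a n / (pochhammer b n * fact n) * z ^ n) sums hyp1F1 a b z"
  using sums_eval_fps[of z "fps_hypergeo [a] [b] 1"] fps_conv_radius_hyp1F1[OF assms, of a]
  by (simp add: hyp1F1_def)

text \<open>Checked coefficient by coefficient: over the common denominator of the n-th coefficients
  it is a polynomial identity. It is the source of the recurrence of U in its first
  parameter.\<close>

lemma hyp1F1_contiguous:
  assumes b: "b \<notin> \<int>\<^sub>\<le>\<^sub>0"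
  shows "(b - a) * hyp1F1 (a - 1) b z + (2 * a - b + z) * hyp1F1 a b z - a * hyp1F1 (a + 1) b z = 0"
proof -
  let ?c = "\<lambda>a n. pochhammer a n / (pochhammer b n * fact n)"
  have nz: "pochhammer b n \<noteq> 0" for n using b by (auto simp: pochhammer_eq_0_iff)
  \<comment> \<open>The coefficients of z times the series, that is, the coefficients at
    \<open>a\<close> shifted by one place.\<close>
  define d where "d = (\<lambda>n. case n of 0 \<Rightarrow> 0 | Suc m \<Rightarrow> ?c a m)"
  have "(\<lambda>n. ?c a n * z ^ n * z) sums (hyp1F1 a b z * z)"
    by (intro sums_mult2 hyp1F1_sums b)
  then have "(\<lambda>n. d (Suc n) * z ^ Suc n) sums (hyp1F1 a b z * z)"
    by (simp add: d_def mult_ac)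
  then have "(\<lambda>n. d n * z ^ n) sums (hyp1F1 a b z * z)"
    by (subst (asm) sums_Suc_iff) (simp add: d_def)
  then have "(\<lambda>n. (b - a) * (?c (a - 1) n * z ^ n) + (2 * a - b) * (?c a n * z ^ n) + d n * z ^ n - a * (?c (a + 1) n * z ^ n))
    sums ((b - a) * hyp1F1 (a - 1) b z + (2 * a - b) * hyp1F1 a b z + hyp1F1 a b z * z - a * hyp1F1 (a + 1) b z)"
    by (intro sums_add sums_diff sums_mult hyp1F1_sums b)
  moreover have "(b - a) * (?c (a - 1) n * z ^ n) + (2 * a - b) * (?c a n * z ^ n) + d n * z ^ n - a * (?c (a + 1) n * z ^ n) = 0" for n
  proof (cases n)
    case (Suc m)
    define P Q where "P = pochhammer a m" and "Q = pochhammer b m * fact m"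
    have 1: "pochhammer (a - 1) (Suc m) = (a - 1) * P" by (simp add: pochhammer_rec P_def)
    have 2: "pochhammer a (Suc m) = P * (a + of_nat m)" by (simp add: pochhammer_Suc P_def)
    have 3: "a * pochhammer (a + 1) (Suc m) = P * (a + of_nat m) * (a + of_nat m + 1)"
      using pochhammer_rec[of a "Suc m"] by (simp add: pochhammer_Suc P_def algebra_simps)
    have 4: "pochhammer b (Suc m) * fact (Suc m) = Q * ((b + of_nat m) * of_nat (Suc m))"
      by (simp add: pochhammer_Suc Q_def)
    have Q: "Q \<noteq> 0" "(b + of_nat m) * of_nat (Suc m) \<noteq> 0" using nz[of m] nz[of "Suc m"] by (auto simp: Q_def pochhammer_Suc simp del: of_nat_Suc)
    have "(b - a) * ((a - 1) * P / (Q * ((b + of_nat m) * of_nat (Suc m)))) + (2 * a - b) * (P * (a + of_nat m) / (Q * ((b + of_nat m) * of_nat (Suc m))))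
       + P / Q - P * (a + of_nat m) * (a + of_nat m + 1) / (Q * ((b + of_nat m) * of_nat (Suc m))) = 0"
    proof -
      have "P / Q = P * ((b + of_nat m) * of_nat (Suc m)) / (Q * ((b + of_nat m) * of_nat (Suc m)))"
        using Q by simp
      moreover have "(b - a) * ((a - 1) * P) + (2 * a - b) * (P * (a + of_nat m)) + P * ((b + of_nat m) * of_nat (Suc m)) - P * (a + of_nat m) * (a + of_nat m + 1) = 0"
        by (simp add: algebra_simps)
      ultimately show ?thesis
        by (simp only: times_divide_eq_right add_divide_distrib[symmetric] diff_divide_distrib[symmetric]) simp
    qed
    moreover have "a * (?c (a + 1) n * z ^ n) = P * (a + of_nat m) * (a + of_nat m + 1) / (Q * ((b + of_nat m) * of_nat (Suc m))) * z ^ n"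
      using 3 unfolding Suc 4 by (simp only: times_divide_eq_right times_divide_eq_left mult.assoc[symmetric])
    ultimately show ?thesis
      unfolding Suc d_def 1 2 4
      by (simp only: nat.case P_def[symmetric] Q_def[symmetric] mult.assoc[symmetric] Suc distrib_right[symmetric] left_diff_distrib[symmetric]) simp
  qed (auto simp: d_def)
  ultimately have "(\<lambda>n. 0) sums ((b - a) * hyp1F1 (a - 1) b z + (2 * a - b) * hyp1F1 a b z + hyp1F1 a b z * z - a * hyp1F1 (a + 1) b z)"
    by simp
  then have "(b - a) * hyp1F1 (a - 1) b z + (2 * a - b) * hyp1F1 a b z + hyp1F1 a b z * z - a * hyp1F1 (a + 1) b z = 0"
    using sums_unique2 sums_zero by blast
  then show ?thesis by (simp add: algebra_simps)
qed

lemma fps_deriv_hyp1F1: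
  assumes b: "b \<notin> \<int>\<^sub>\<le>\<^sub>0"
  shows "fps_deriv (fps_hypergeo [a] [b] (1::complex)) = fps_const (a / b) * fps_hypergeo [a + 1] [b + 1] 1"
proof (rule fps_ext)
  fix n
  have b1: "b + 1 \<notin> \<int>\<^sub>\<le>\<^sub>0" using b by (meson plus_one_in_nonpos_Ints_imp)
  have "b \<noteq> 0" using b by auto
  moreover have "pochhammer (b + 1) n \<noteq> 0" using b1 by (auto simp: pochhammer_eq_0_iff)
  ultimately show "fps_nth (fps_deriv (fps_hypergeo [a] [b] 1)) n = fps_nth (fps_const (a / b) * fps_hypergeo [a + 1] [b + 1] 1) n"
  proof -
    have "N * (a * P / (b * Q * (N * F))) = a / b * (P / (Q * F))" if "N \<noteq> 0" for N P Q F :: complex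
      using that by simp
    from this[of "of_nat (Suc n)" "pochhammer (a + 1) n" "pochhammer (b + 1) n" "fact n"] show ?thesis
      unfolding fps_deriv_nth fps_mult_left_const_nth hyp1F1_nth pochhammer_rec Suc_eq_plus1[symmetric] fact_Suc
      by (simp only: of_nat_neq_0 not_False_eq_True)
  qed
qed

lemma hyp1F1_has_field_derivative:
  assumes b: "b \<notin> \<int>\<^sub>\<le>\<^sub>0"
  shows "(hyp1F1 a b has_field_derivative a / b * hyp1F1 (a + 1) (b + 1) z) (at z)"
proof -
  have b1: "b + 1 \<notin> \<int>\<^sub>\<le>\<^sub>0" using b by (meson plus_one_in_nonpos_Ints_imp)
  have "(eval_fps (fps_hypergeo [a] [b] 1) has_field_derivative eval_fps (fps_deriv (fps_hypergeo [a] [b] 1)) z) (at z)"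
    by (rule has_field_derivative_eval_fps) (simp add: fps_conv_radius_hyp1F1[OF b])
  moreover have "eval_fps (fps_const (a / b) * fps_hypergeo [a + 1] [b + 1] 1) z = a / b * hyp1F1 (a + 1) (b + 1) z"
    by (subst eval_fps_mult) (auto simp: fps_conv_radius_hyp1F1[OF b1] hyp1F1_def)
  ultimately show ?thesis by (simp add: hyp1F1_def[abs_def] fps_deriv_hyp1F1[OF b])
qed

lemma hyp1F1_0 [simp]: "hyp1F1 a b 0 = 1"
  by (simp add: hyp1F1_def eval_fps_at_0)

text \<open>Kummer's equation is equivalent to the coefficient recursion (n + b)(n + 1) c(n+1) = (n
  + a) c(n); derivatives are expressed through raised parameters.\<close>

lemma hyp1F1_ode:
  assumes b: "b \<notin> \<int>\<^sub>\<le>\<^sub>0"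
  shows "z * ((a + 1) / (b + 1) * (a / b) * hyp1F1 (a + 2) (b + 2) z) = (z - b) * (a / b * hyp1F1 (a + 1) (b + 1) z) + a * hyp1F1 a b z"
proof -
  have b1: "b + 1 \<notin> \<int>\<^sub>\<le>\<^sub>0" using b by (meson plus_one_in_nonpos_Ints_imp)
  have b2: "b + 2 \<notin> \<int>\<^sub>\<le>\<^sub>0" using b1 plus_one_in_nonpos_Ints_imp[of "b + 1"] by (auto simp: add.assoc)
  define H where "H = (\<lambda>a b. fps_hypergeo [a] [b] (1::complex))"
  have H: "eval_fps (H a b) z = hyp1F1 a b z" for a b by (simp add: H_def hyp1F1_def)
  have r [simp]: "fps_conv_radius (H a b) = \<infinity>" "fps_conv_radius (H (a + 1) (b + 1)) = \<infinity>" "fps_conv_radius (H (a + 2) (b + 2)) = \<infinity>"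
    by (simp_all add: H_def fps_conv_radius_hyp1F1 b b1 b2)
  have cr [simp]: "fps_conv_radius (fps_const c * f) = \<infinity>" "fps_conv_radius (fps_X * f) = \<infinity>"
    if "fps_conv_radius f = \<infinity>" for c :: complex and f
    using that fps_conv_radius_mult[of "fps_const c" f] fps_conv_radius_mult[of fps_X f] by auto
  have d1: "fps_deriv (H a b) = fps_const (a / b) * H (a + 1) (b + 1)"
    unfolding H_def by (rule fps_deriv_hyp1F1[OF b])
  have d2: "fps_deriv (fps_deriv (H a b)) = fps_const (a / b) * (fps_const ((a + 1) / (b + 1)) * H (a + 2) (b + 2))"
    unfolding d1 using fps_deriv_hyp1F1[OF b1, of "a + 1"] by (simp add: H_def add.assoc)
  have "fps_X * fps_deriv (fps_deriv (H a b)) = fps_X * fps_deriv (H a b) + (fps_const (- b) * fps_deriv (H a b) + fps_const a * H a b)"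
  proof (rule fps_ext)
    fix n
    have nz: "pochhammer b n \<noteq> 0" for n using b by (auto simp: pochhammer_eq_0_iff)
    have c: "(of_nat n + b) * (of_nat (Suc n) * fps_nth (H a b) (Suc n)) = (of_nat n + a) * fps_nth (H a b) n"
    proof -
      have "y * (N * (P * x / (Q * y * (N * F)))) = x * (P / (Q * F))" if "N \<noteq> 0" "y \<noteq> 0" for N P Q F x y :: complex
        using that by simp
      from this[of "of_nat (Suc n)" "b + of_nat n" "pochhammer a n" "a + of_nat n" "pochhammer b n" "fact n"] nz[of "Suc n"] show ?thesis
        unfolding H_def hyp1F1_nth pochhammer_Suc fact_Suc
        by (simp only: of_nat_neq_0 not_False_eq_True mult_eq_0_iff de_Morgan_disj add.commute)
    qed
    have "fps_nth (fps_X * fps_deriv (fps_deriv (H a b))) n = of_nat n * (of_nat (Suc n) * fps_nth (H a b) (Suc n))"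
      by (cases n) (simp_all add: mult_ac)
    moreover have "fps_nth (fps_X * fps_deriv (H a b)) n = of_nat n * fps_nth (H a b) n"
      by (cases n) simp_all
    ultimately show "fps_nth (fps_X * fps_deriv (fps_deriv (H a b))) n =
        fps_nth (fps_X * fps_deriv (H a b) + (fps_const (- b) * fps_deriv (H a b) + fps_const a * H a b)) n"
      using c by (simp add: algebra_simps)
  qed
  then have "eval_fps (fps_X * fps_deriv (fps_deriv (H a b))) z = eval_fps (fps_X * fps_deriv (H a b) + (fps_const (- b) * fps_deriv (H a b) + fps_const a * H a b)) z"
    by simp
  moreover have "fps_conv_radius (f + g) = \<infinity>" if "fps_conv_radius f = \<infinity>" "fps_conv_radius g = \<infinity>" for f g :: "complex fps"
    using fps_conv_radius_add[of f g] that by simp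
  ultimately have "z * (a / b * ((a + 1) / (b + 1) * hyp1F1 (a + 2) (b + 2) z)) =
      z * (a / b * hyp1F1 (a + 1) (b + 1) z) + (- b * (a / b * hyp1F1 (a + 1) (b + 1) z) + a * hyp1F1 a b z)"
    unfolding d2 unfolding d1 by (simp add: eval_fps_add eval_fps_mult H)
  moreover have "z * (q * p * X) = (z - b) * (p * Y) + a * W" if "z * (p * (q * X)) = z * (p * Y) + (- b * (p * Y) + a * W)" for p q X Y W
    using that by (simp add: algebra_simps)
  ultimately show ?thesis by blast
qed

section \<open>Kummer's equation and Wronskians\<close>

text \<open>For a solution \<open>u\<close> of Kummer's equation the pair \<open>(u, u')\<close> solves this first order system;
  the weighted Wronskian of two such pairs is constant.\<close>
definition kummer_pair :: "complex \<Rightarrow> complex \<Rightarrow> (real \<Rightarrow> complex) \<Rightarrow> (real \<Rightarrow> complex) \<Rightarrow> bool" where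
  "kummer_pair a b u v \<longleftrightarrow> (\<forall>x>0. (u has_vector_derivative v x) (at x) \<and>
     (v has_vector_derivative ((of_real x - b) * v x + a * u x) / of_real x) (at x))"

text \<open>By Abel's identity the plain Wronskian is a multiple of x^(-b) exp(x); the weight is the
  reciprocal of this factor.\<close>

definition kummer_wronskian :: "complex \<Rightarrow> (real \<Rightarrow> complex) \<Rightarrow> (real \<Rightarrow> complex) \<Rightarrow> (real \<Rightarrow> complex) \<Rightarrow> (real \<Rightarrow> complex) \<Rightarrow> real \<Rightarrow> complex" where
  "kummer_wronskian b u u' v v' x = of_real x powr b * of_real (exp (- x)) * (u x * v' x - u' x * v x)"

text \<open>The derivative vanishes on the half line, and the limit at 0 names the constant. Thus
  leading behaviour at 0 is all that has to be known about two solutions.\<close>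

lemma kummer_wronskian_const:
  assumes u: "kummer_pair a b u u'" and v: "kummer_pair a b v v'"
    and lim: "(kummer_wronskian b u u' v v' \<longlongrightarrow> L) (at_right 0)" and x: "x > 0"
  shows "kummer_wronskian b u u' v v' x = L"
proof -
  let ?W = "kummer_wronskian b u u' v v'"
  have "(?W has_vector_derivative 0) (at x)" if x: "x > 0" for x
  proof -
    have E: "((\<lambda>x. complex_of_real (exp (- x))) has_vector_derivative of_real (- exp (- x))) (at x)"
      by (intro has_vector_derivative_of_real) (auto intro!: derivative_eq_intros)
    have d: "(u has_vector_derivative u' x) (at x)" "(v has_vector_derivative v' x) (at x)"
      "(u' has_vector_derivative ((of_real x - b) * u' x + a * u x) / of_real x) (at x)"
      "(v' has_vector_derivative ((of_real x - b) * v' x + a * v x) / of_real x) (at x)"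
      using u v x by (auto simp: kummer_pair_def)
    have p: "complex_of_real x powr b = of_real x * of_real x powr (b - 1)"
      using x powr_add[of "complex_of_real x" 1 "b - 1"] by simp
    have gen: "X * P * E * (U * ((X - b) * V' + a * V) / X + U' * V' - (U' * V' + ((X - b) * U' + a * U) / X * V))
        + (X * P * - E + b * P * E) * (U * V' - U' * V) = 0" if "X \<noteq> 0" for X P E U V U' V' :: complex
      using that by (simp add: field_simps)
    from has_vector_derivative_mult[OF has_vector_derivative_mult[OF has_vector_derivative_cpowr[OF x, of b] E]
        has_vector_derivative_diff[OF has_vector_derivative_mult[OF d(1) d(4)] has_vector_derivative_mult[OF d(3) d(2)]]]
    have "(?W has_vector_derivative
       (of_real x powr b * of_real (exp (- x)) * (u x * (((of_real x - b) * v' x + a * v x) / of_real x) + u' x * v' x - (u' x * v' x + ((of_real x - b) * u' x + a * u x) / of_real x * v x))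
        + (of_real x powr b * of_real (- exp (- x)) + b * of_real x powr (b - 1) * of_real (exp (- x))) * (u x * v' x - u' x * v x))) (at x)"
      by (simp only: kummer_wronskian_def[abs_def])
    also have "(of_real x powr b * of_real (exp (- x)) * (u x * (((of_real x - b) * v' x + a * v x) / of_real x) + u' x * v' x - (u' x * v' x + ((of_real x - b) * u' x + a * u x) / of_real x * v x))
        + (of_real x powr b * of_real (- exp (- x)) + b * of_real x powr (b - 1) * of_real (exp (- x))) * (u x * v' x - u' x * v x)) = 0"
      using x unfolding p of_real_minus times_divide_eq_right by (intro gen) simp
    finally show ?thesis .
  qed
  then have "(?W has_derivative (\<lambda>h. 0)) (at y within {0<..})" if "y \<in> {0<..}" for y
    using that by (auto simp: has_vector_derivative_def intro: has_derivative_at_withinI)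
  then obtain c where c: "\<And>y. y > 0 \<Longrightarrow> ?W y = c"
    using has_derivative_zero_constant[of "{0<..}" ?W] by auto
  have "(?W \<longlongrightarrow> c) (at_right 0)"
    by (rule Lim_transform_eventually[OF tendsto_const]) (use c eventually_at_right_less[of "0::real"] in \<open>auto elim!: eventually_mono\<close>)
  then have "c = L"
    using lim by (intro tendsto_unique[OF _ _ lim]) auto
  with c x show ?thesis by simp
qed

lemma kummer_pair_tricomi:
  assumes "Re a > 0"
  shows "kummer_pair a b (tricomi_integral a b) (\<lambda>x. - tricomi_integral (a + 1) (b + 1) x)"
  unfolding kummer_pair_def
proof (intro allI impI conjI)
  fix x :: real assume x: "x > 0"
  show "(tricomi_integral a b has_vector_derivative - tricomi_integral (a + 1) (b + 1) x) (at x)"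
    by (rule has_vector_derivative_tricomi_integral[OF assms x])
  have "((\<lambda>x. - tricomi_integral (a + 1) (b + 1) x) has_vector_derivative - (- tricomi_integral (a + 1 + 1) (b + 1 + 1) x)) (at x)"
    using assms x by (intro has_vector_derivative_minus has_vector_derivative_tricomi_integral) auto
  also have "- (- tricomi_integral (a + 1 + 1) (b + 1 + 1) x) = ((of_real x - b) * - tricomi_integral (a + 1) (b + 1) x + a * tricomi_integral a b x) / of_real x"
    using tricomi_integral_ode[OF assms x, of b] x by (simp add: eq_divide_eq add.assoc algebra_simps)
  finally show "((\<lambda>x. - tricomi_integral (a + 1) (b + 1) x) has_vector_derivative ((of_real x - b) * - tricomi_integral (a + 1) (b + 1) x + a * tricomi_integral a b x) / of_real x) (at x)" .
qed

lemma hyp1F1_has_vector_derivative: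
  assumes "b \<notin> \<int>\<^sub>\<le>\<^sub>0"
  shows "((\<lambda>x. hyp1F1 a b (of_real x)) has_vector_derivative a / b * hyp1F1 (a + 1) (b + 1) (of_real x)) (at x)"
proof -
  have "(complex_of_real has_vector_derivative 1) (at x)"
    using has_vector_derivative_of_real[OF DERIV_ident] by simp
  from field_vector_diff_chain_at[OF this hyp1F1_has_field_derivative[OF assms]] show ?thesis
    by (simp add: o_def)
qed

lemma kummer_pair_hyp1F1:
  assumes b: "b \<notin> \<int>\<^sub>\<le>\<^sub>0"
  shows "kummer_pair a b (\<lambda>x. hyp1F1 a b (of_real x)) (\<lambda>x. a / b * hyp1F1 (a + 1) (b + 1) (of_real x))"
  unfolding kummer_pair_def
proof (intro allI impI conjI hyp1F1_has_vector_derivative b)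
  fix x :: real assume x: "x > 0"
  have b1: "b + 1 \<notin> \<int>\<^sub>\<le>\<^sub>0" using b by (meson plus_one_in_nonpos_Ints_imp)
  have "((\<lambda>x. a / b * hyp1F1 (a + 1) (b + 1) (of_real x)) has_vector_derivative a / b * ((a + 1) / (b + 1) * hyp1F1 (a + 1 + 1) (b + 1 + 1) (of_real x))) (at x)"
    by (intro has_vector_derivative_mult_right hyp1F1_has_vector_derivative b1)
  also have "a / b * ((a + 1) / (b + 1) * hyp1F1 (a + 1 + 1) (b + 1 + 1) (of_real x)) =
     ((of_real x - b) * (a / b * hyp1F1 (a + 1) (b + 1) (of_real x)) + a * hyp1F1 a b (of_real x)) / of_real x"
    unfolding hyp1F1_ode[OF b, of "of_real x" a, symmetric] using x by (simp add: add.assoc mult_ac)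
  finally show "((\<lambda>x. a / b * hyp1F1 (a + 1) (b + 1) (of_real x)) has_vector_derivative ((of_real x - b) * (a / b * hyp1F1 (a + 1) (b + 1) (of_real x)) + a * hyp1F1 a b (of_real x)) / of_real x) (at x)" .
qed

text \<open>Multiplication by x^(1-b) carries solutions for (a - b + 1, 2 - b) to solutions for (a,
  b). It supplies the second solution, with exponent 1 - b at the origin.\<close>

lemma kummer_pair_powr:
  assumes u: "kummer_pair (a - b + 1) (2 - b) u u'"
  shows "kummer_pair a b (\<lambda>x. of_real x powr (1 - b) * u x) (\<lambda>x. of_real x powr (- b) * ((1 - b) * u x + of_real x * u' x))"
  unfolding kummer_pair_def
proof (intro allI impI conjI)
  fix x :: real assume x: "x > 0"
  have d: "(u has_vector_derivative u' x) (at x)"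
    "(u' has_vector_derivative ((of_real x - (2 - b)) * u' x + (a - b + 1) * u x) / of_real x) (at x)"
    using u x by (auto simp: kummer_pair_def)
  have p1: "complex_of_real x powr (1 - b) = of_real x * of_real x powr (- b)"
    using x powr_add[of "complex_of_real x" 1 "- b"] by simp
  have p2: "complex_of_real x powr (- b) = of_real x * of_real x powr (- b - 1)"
    using x powr_add[of "complex_of_real x" 1 "- b - 1"] by simp
  have i: "(complex_of_real has_vector_derivative 1) (at x)"
    using has_vector_derivative_of_real[OF DERIV_ident] by simp
  from has_vector_derivative_mult[OF has_vector_derivative_cpowr[OF x, of "1 - b"] d(1)]
  have "((\<lambda>x. of_real x powr (1 - b) * u x) has_vector_derivative of_real x powr (1 - b) * u' x + (1 - b) * of_real x powr (1 - b - 1) * u x) (at x)" .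
  also have "of_real x powr (1 - b) * u' x + (1 - b) * of_real x powr (1 - b - 1) * u x = of_real x powr (- b) * ((1 - b) * u x + of_real x * u' x)"
    unfolding p1 by (simp add: algebra_simps)
  finally show "((\<lambda>x. of_real x powr (1 - b) * u x) has_vector_derivative of_real x powr (- b) * ((1 - b) * u x + of_real x * u' x)) (at x)" .
  let ?U = "((of_real x - (2 - b)) * u' x + (a - b + 1) * u x) / of_real x"
  from has_vector_derivative_mult[OF has_vector_derivative_cpowr[OF x, of "- b"]
      has_vector_derivative_add[OF has_vector_derivative_mult_right[OF d(1), of "1 - b"] has_vector_derivative_mult[OF i d(2)]]]
  have "((\<lambda>x. of_real x powr (- b) * ((1 - b) * u x + of_real x * u' x)) has_vector_derivative
      of_real x powr (- b) * ((1 - b) * u' x + (of_real x * ?U + 1 * u' x)) + - b * of_real x powr (- b - 1) * ((1 - b) * u x + of_real x * u' x)) (at x)" .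
  also have "of_real x powr (- b) * ((1 - b) * u' x + (of_real x * ?U + 1 * u' x)) + - b * of_real x powr (- b - 1) * ((1 - b) * u x + of_real x * u' x)
     = ((of_real x - b) * (of_real x powr (- b) * ((1 - b) * u x + of_real x * u' x)) + a * (of_real x powr (1 - b) * u x)) / of_real x"
  proof -
    have "X * P * ((1 - b) * U' + (((X - (2 - b)) * U' + (a - b + 1) * U) + 1 * U')) + - b * P * ((1 - b) * U + X * U')
     = (X - b) * (P * ((1 - b) * U + X * U')) + a * (X * P * U)" for X P U U' :: complex
      by (simp add: algebra_simps)
    from this[of "of_real x" "of_real x powr (- b - 1)" "u' x" "u x"]
    show ?thesis
      unfolding p1 using x by (simp add: p2 eq_divide_eq mult_ac) (simp add: algebra_simps)
  qed
  finally show "((\<lambda>x. of_real x powr (- b) * ((1 - b) * u x + of_real x * u' x)) has_vector_derivative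
     ((of_real x - b) * (of_real x powr (- b) * ((1 - b) * u x + of_real x * u' x)) + a * (of_real x powr (1 - b) * u x)) / of_real x) (at x)" .
qed

section \<open>Identification of the integral with the defining formula\<close>

lemma tendsto_hyp1F1_0:
  assumes "b \<notin> \<int>\<^sub>\<le>\<^sub>0"
  shows "((\<lambda>x. hyp1F1 a b (of_real x)) \<longlongrightarrow> 1) (at_right 0)"
proof -
  have "isCont (\<lambda>x. hyp1F1 a b (of_real x)) (0::real)"
    using hyp1F1_has_vector_derivative[OF assms] by (rule has_vector_derivative_continuous)
  then have "((\<lambda>x. hyp1F1 a b (of_real x)) \<longlongrightarrow> hyp1F1 a b (of_real 0)) (at (0::real))"
    by (simp add: isCont_def)
  then have "((\<lambda>x. hyp1F1 a b (of_real x)) \<longlongrightarrow> hyp1F1 a b (of_real 0)) (at_right (0::real))"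
    by (rule tendsto_within_subset) auto
  then show ?thesis by simp
qed

text \<open>The singularity of the integral is at worst x^(-1/4), which the factor x^(1/2) already
  beats. This removes boundary terms from the Wronskians at 0.\<close>

lemma tendsto_powr_mult_tricomi_integral_0:
  assumes a: "Re a > 0" and b: "Re b \<le> 5/4" and c: "Re c \<ge> 1/2"
  shows "((\<lambda>x. of_real x powr c * tricomi_integral a b x) \<longlongrightarrow> 0) (at_right 0)"
proof (rule Lim_null_comparison)
  define r where "r = min (Re a) (1/4)"
  have r: "0 < r" "r \<le> 1/4" "r \<le> Re a" using a by (auto simp: r_def)
  show "\<forall>\<^sub>F x in at_right 0. norm (of_real x powr c * tricomi_integral a b x) \<le> Gamma r * x powr (Re c - r) + Gamma (1/4) * x powr (Re c - 1/4)"
    using eventually_at_right_less[of "0::real"]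
  proof eventually_elim
    case (elim x)
    have "norm (of_real x powr c * tricomi_integral a b x) \<le> x powr Re c * (Gamma r * x powr (- r) + Gamma (1/4) * x powr (- (1/4)))"
      using elim norm_tricomi_integral_le[OF b r(3) r(1) r(2) elim] by (simp add: norm_mult norm_cpowr mult_left_mono)
    also have "\<dots> = Gamma r * (x powr Re c * x powr (- r)) + Gamma (1/4) * (x powr Re c * x powr (- (1/4)))"
      by (simp only: ring_distribs mult_ac)
    also have "\<dots> = Gamma r * x powr (Re c - r) + Gamma (1/4) * x powr (Re c - 1/4)"
      by (simp only: powr_add[symmetric]) simp
    finally show ?case .
  qed
  have p: "((\<lambda>x::real. x powr d) \<longlongrightarrow> 0) (at_right 0)" if "d > 0" for d
    using that by real_asymp
  have "((\<lambda>x. Gamma r * x powr (Re c - r) + Gamma (1/4) * x powr (Re c - 1/4)) \<longlongrightarrow> Gamma r * 0 + Gamma (1/4) * 0) (at_right 0)"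
    using r c by (intro tendsto_intros p) auto
  then show "((\<lambda>x. Gamma r * x powr (Re c - r) + Gamma (1/4) * x powr (Re c - 1/4)) \<longlongrightarrow> 0) (at_right 0)" by simp
qed

text \<open>The integral J and the series solutions M and N = x^(1-b) m solve one second order
  equation, so J W(M,N) = M W(J,N) - N W(J,M). The three constant Wronskians are read off at 0, and
  division by W(M,N) = 1 - b gives the coefficients of the defining formula. The strip around Re b =
  1 is chosen so that all boundary limits exist.\<close>

lemma tricomi_integral_eq_formula:
  assumes a: "Re a > 0" and b: "3/4 \<le> Re b" "Re b \<le> 5/4" "b \<notin> \<int>" and x: "x > 0"
  shows "tricomi_integral a b x = Gamma a * tricomi_U_formula a b (of_real x)"
proof -
  have nb: "b \<notin> \<int>\<^sub>\<le>\<^sub>0" "2 - b \<notin> \<int>\<^sub>\<le>\<^sub>0"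
  proof -
    show "b \<notin> \<int>\<^sub>\<le>\<^sub>0" using b by auto
    have "2 - b \<notin> \<int>" using b(3) Ints_diff[of 2 "2 - b"] by auto
    then show "2 - b \<notin> \<int>\<^sub>\<le>\<^sub>0" by auto
  qed
  have b1: "b \<noteq> 1" using b(3) by auto
  define J J' where "J = tricomi_integral a b" and "J' = (\<lambda>x. - tricomi_integral (a + 1) (b + 1) x)"
  define M M' where "M = (\<lambda>x::real. hyp1F1 a b (of_real x))" and "M' = (\<lambda>x::real. a / b * hyp1F1 (a + 1) (b + 1) (of_real x))"
  define m m' where "m = (\<lambda>x::real. hyp1F1 (a - b + 1) (2 - b) (of_real x))" and "m' = (\<lambda>x::real. (a - b + 1) / (2 - b) * hyp1F1 (a - b + 1 + 1) (2 - b + 1) (of_real x))"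
  define N N' where "N = (\<lambda>x::real. of_real x powr (1 - b) * m x)" and "N' = (\<lambda>x::real. of_real x powr (- b) * ((1 - b) * m x + of_real x * m' x))"
  have pJ: "kummer_pair a b J J'" unfolding J_def J'_def by (rule kummer_pair_tricomi[OF a])
  have pM: "kummer_pair a b M M'" unfolding M_def M'_def by (rule kummer_pair_hyp1F1[OF nb(1)])
  have pN: "kummer_pair a b N N'" unfolding N_def N'_def
    by (rule kummer_pair_powr) (unfold m_def m'_def, rule kummer_pair_hyp1F1[OF nb(2)])
  have lM: "(M \<longlongrightarrow> 1) (at_right 0)" unfolding M_def by (rule tendsto_hyp1F1_0[OF nb(1)])
  have lm: "(m \<longlongrightarrow> 1) (at_right 0)" unfolding m_def by (rule tendsto_hyp1F1_0[OF nb(2)])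
  have lM': "(M' \<longlongrightarrow> a / b * 1) (at_right 0)" unfolding M'_def
    by (intro tendsto_intros tendsto_hyp1F1_0) (use nb in \<open>meson plus_one_in_nonpos_Ints_imp\<close>)
  have lm': "(m' \<longlongrightarrow> (a - b + 1) / (2 - b) * 1) (at_right 0)" unfolding m'_def
    by (intro tendsto_intros tendsto_hyp1F1_0) (use nb in \<open>meson plus_one_in_nonpos_Ints_imp\<close>)
  have lx: "((\<lambda>x. complex_of_real x) \<longlongrightarrow> of_real 0) (at_right 0)"
    and le: "((\<lambda>x. complex_of_real (exp (- x))) \<longlongrightarrow> of_real (exp (- 0))) (at_right 0)"
    by (intro tendsto_intros)+
  have pw: "complex_of_real x powr b * of_real x powr (- b) = 1" "complex_of_real x powr b * of_real x powr (1 - b) = of_real x" if "x > 0" for x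
    using that by (simp_all flip: powr_add)
  note [simp] = tendsto_const
  have ev: "\<forall>\<^sub>F x::real in at_right 0. x > 0" by (rule eventually_at_right_less)
  have W1: "kummer_wronskian b M M' N N' x = 1 - b"
  proof (rule kummer_wronskian_const[OF pM pN _ x])
    have "((\<lambda>x. of_real (exp (- x)) * (M x * ((1 - b) * m x + of_real x * m' x) - of_real x * M' x * m x)) \<longlongrightarrow>
        of_real (exp (- 0)) * (1 * ((1 - b) * 1 + of_real 0 * ((a - b + 1) / (2 - b) * 1)) - of_real 0 * (a / b * 1) * 1)) (at_right 0)"
      by (intro tendsto_mult tendsto_add tendsto_diff lM lM' lm lm' lx le tendsto_const)
    then have "((\<lambda>x. of_real (exp (- x)) * (M x * ((1 - b) * m x + of_real x * m' x) - of_real x * M' x * m x)) \<longlongrightarrow> 1 - b) (at_right 0)" by simp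
    then show "(kummer_wronskian b M M' N N' \<longlongrightarrow> 1 - b) (at_right 0)"
    proof (rule Lim_transform_eventually)
      show "\<forall>\<^sub>F x in at_right 0. of_real (exp (- x)) * (M x * ((1 - b) * m x + of_real x * m' x) - of_real x * M' x * m x) = kummer_wronskian b M M' N N' x"
        using ev
      proof eventually_elim
        case (elim x)
        have "kummer_wronskian b M M' N N' x = of_real (exp (- x)) * (M x * (of_real x powr b * of_real x powr (- b)) * ((1 - b) * m x + of_real x * m' x) - (of_real x powr b * of_real x powr (1 - b)) * M' x * m x)"
          unfolding kummer_wronskian_def N_def N'_def by (simp only: right_diff_distrib mult_ac)
        then show ?case unfolding pw[OF elim] by simp
      qed
    qed
  qed
  have W2: "kummer_wronskian b J J' M M' x = Gamma b"
  proof (rule kummer_wronskian_const[OF pJ pM _ x])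
    \<comment> \<open>Only the term with x^b J' survives at 0: J' is minus the integral at the
      raised parameters, and there Re (b + 1) > 1, so x^b J' tends to -Gamma b.\<close>
    have 1: "((\<lambda>x. of_real x powr b * J x) \<longlongrightarrow> 0) (at_right 0)"
      unfolding J_def using a b by (intro tendsto_powr_mult_tricomi_integral_0) auto
    have 2: "((\<lambda>x. of_real x powr (b + 1 - 1) * tricomi_integral (a + 1) (b + 1) x) \<longlongrightarrow> Gamma (b + 1 - 1)) (at_right 0)"
      using a b by (intro tendsto_powr_tricomi_integral_0) auto
    have "((\<lambda>x. of_real (exp (- x)) * ((of_real x powr b * J x) * M' x + (of_real x powr (b + 1 - 1) * tricomi_integral (a + 1) (b + 1) x) * M x)) \<longlongrightarrow>
        of_real (exp (- 0)) * (0 * (a / b * 1) + Gamma (b + 1 - 1) * 1)) (at_right 0)"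
      by (intro tendsto_mult tendsto_add tendsto_diff lM lM' le 1 2)
    then have "((\<lambda>x. of_real (exp (- x)) * ((of_real x powr b * J x) * M' x + (of_real x powr (b + 1 - 1) * tricomi_integral (a + 1) (b + 1) x) * M x)) \<longlongrightarrow> Gamma b) (at_right 0)"
      by simp
    moreover have "of_real (exp (- x)) * ((of_real x powr b * J x) * M' x + (of_real x powr (b + 1 - 1) * tricomi_integral (a + 1) (b + 1) x) * M x) = kummer_wronskian b J J' M M' x" for x
      unfolding kummer_wronskian_def J'_def by (simp add: algebra_simps)
    ultimately show "(kummer_wronskian b J J' M M' \<longlongrightarrow> Gamma b) (at_right 0)" by simp
  qed
  \<comment> \<open>The value at 0 of (a - b + 1) times the integral at (a, b - 1); lowering
    \<open>b\<close> brings Re (b - 1) below 1, where this value is a beta integral.\<close>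
  define c where "c = (a - b + 1) * (Gamma a * Gamma (1 - (b - 1)) * rGamma (a - (b - 1) + 1))"
  have W3: "kummer_wronskian b J J' N N' x = c"
  proof (rule kummer_wronskian_const[OF pJ pN _ x])
    have 1: "((\<lambda>x. of_real x powr 1 * J x) \<longlongrightarrow> 0) (at_right 0)"
      unfolding J_def using a b by (intro tendsto_powr_mult_tricomi_integral_0) auto
    have 2: "(tricomi_integral a (b - 1) \<longlongrightarrow> Gamma a * Gamma (1 - (b - 1)) * rGamma (a - (b - 1) + 1)) (at_right 0)"
      using a b by (intro tendsto_tricomi_integral_0) auto
    have "((\<lambda>x. of_real (exp (- x)) * (((a - b + 1) * tricomi_integral a (b - 1) x) * m x + (of_real x powr 1 * J x) * m' x)) \<longlongrightarrow>
        of_real (exp (- 0)) * (((a - b + 1) * (Gamma a * Gamma (1 - (b - 1)) * rGamma (a - (b - 1) + 1))) * 1 + 0 * ((a - b + 1) / (2 - b) * 1))) (at_right 0)"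
      by (intro tendsto_mult tendsto_add tendsto_diff lm lm' le 1 2 tendsto_const)
    then have "((\<lambda>x. of_real (exp (- x)) * (((a - b + 1) * tricomi_integral a (b - 1) x) * m x + (of_real x powr 1 * J x) * m' x)) \<longlongrightarrow> c) (at_right 0)"
      by (simp add: c_def)
    then show "(kummer_wronskian b J J' N N' \<longlongrightarrow> c) (at_right 0)"
    proof (rule Lim_transform_eventually)
      show "\<forall>\<^sub>F x in at_right 0. of_real (exp (- x)) * (((a - b + 1) * tricomi_integral a (b - 1) x) * m x + (of_real x powr 1 * J x) * m' x) = kummer_wronskian b J J' N N' x"
        using ev
      proof eventually_elim
        case (elim x)
        have "kummer_wronskian b J J' N N' x = of_real (exp (- x)) * (J x * (of_real x powr b * of_real x powr (- b)) * ((1 - b) * m x + of_real x * m' x) - (of_real x powr b * of_real x powr (1 - b)) * J' x * m x)"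
          unfolding kummer_wronskian_def N_def N'_def by (simp only: right_diff_distrib mult_ac)
        also have "\<dots> = of_real (exp (- x)) * (((1 - b) * J x + of_real x * tricomi_integral (a + 1) (b + 1) x) * m x + (of_real x powr 1 * J x) * m' x)"
          unfolding pw[OF elim] J'_def using elim by (simp add: algebra_simps)
        \<comment> \<open>The two terms on the left may be singular separately; integration by parts
          and the addition relation combine them into one integral with a finite limit.\<close>
        also have "(1 - b) * J x + of_real x * tricomi_integral (a + 1) (b + 1) x = (a - b + 1) * tricomi_integral a (b - 1) x"
          using tricomi_integral_by_parts[OF a elim, of b] tricomi_integral_add[OF a elim, of "b - 1"]
          unfolding J_def by (simp add: algebra_simps)
        finally show ?case by simp
      qed
    qed
  qed
  define E where "E = complex_of_real x powr b * of_real (exp (- x))"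
  \<comment> \<open>Expansion of a 3 by 3 determinant whose first row is repeated.\<close>
  have "J x * kummer_wronskian b M M' N N' x = M x * kummer_wronskian b J J' N N' x - N x * kummer_wronskian b J J' M M' x"
    unfolding kummer_wronskian_def by (simp add: algebra_simps)
  then have "J x * (1 - b) = M x * c - N x * Gamma b" unfolding W1 W2 W3 .
  moreover have "c = (1 - b) * (Gamma a * Gamma (1 - b) * rGamma (a - b + 1))"
  proof -
    have "1 - b \<notin> \<int>" using b(3) Ints_diff[of 1 "1 - b"] by auto
    then have "1 - b \<notin> \<int>\<^sub>\<le>\<^sub>0" by auto
    then have "Gamma (1 - (b - 1)) = (1 - b) * Gamma (1 - b)"
      using Gamma_plus1[of "1 - b"] by (simp add: algebra_simps)
    moreover have "(a - b + 1) * rGamma (a - (b - 1) + 1) = rGamma (a - b + 1)"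
      using rGamma_plus1[of "a - b + 1"] by (simp add: algebra_simps)
    moreover have "q * (G * P * R) = (1 - b) * (G * P' * R')" if "P = (1 - b) * P'" "q * R = R'" for q G P P' R R' :: complex
      unfolding that(1) that(2)[symmetric] by (simp add: mult_ac)
    ultimately show ?thesis unfolding c_def by blast
  qed
  moreover have "Gamma b = - (1 - b) * Gamma (b - 1)"
  proof -
    have "b - 1 \<notin> \<int>" using b(3) Ints_add[of "b - 1" 1] by auto
    then have "b - 1 \<notin> \<int>\<^sub>\<le>\<^sub>0" by auto
    then show ?thesis using Gamma_plus1[of "b - 1"] by (simp add: algebra_simps)
  qed
  ultimately have "J x * (1 - b) = (M x * (Gamma a * Gamma (1 - b) * rGamma (a - b + 1)) + N x * Gamma (b - 1)) * (1 - b)"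
    by (simp add: algebra_simps)
  then have "J x = M x * (Gamma a * Gamma (1 - b) * rGamma (a - b + 1)) + N x * Gamma (b - 1)"
    using b1 by simp
  moreover have "Gamma a \<noteq> 0"
    using a complex_nonpos_Reals_iff nonpos_Ints_subset_nonpos_Reals by (fastforce simp: Gamma_eq_zero_iff)
  ultimately show ?thesis
    unfolding J_def M_def N_def m_def tricomi_U_formula_def
    by (simp add: rGamma_inverse_Gamma divide_inverse ring_distribs mult_ac)
qed

section \<open>Recurrence and Kummer transformation\<close>

text \<open>Each of the two series satisfies its own contiguous relation, at (a, b) and at (a - b +
  1, 2 - b), and the reciprocal Gamma factors convert both to the same coefficients. Being entire,
  these factors need no exceptions in \<open>a\<close>, so the recurrence crosses into Re a <= 0
  where the integral diverges.\<close>

lemma tricomi_U_formula_recurrence: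
  assumes b: "b \<notin> \<int>"
  shows "tricomi_U_formula (a - 1) b z + (b - 2 * a - z) * tricomi_U_formula a b z
     + a * (a - b + 1) * tricomi_U_formula (a + 1) b z = 0"
proof -
  have nb: "b \<notin> \<int>\<^sub>\<le>\<^sub>0" "2 - b \<notin> \<int>\<^sub>\<le>\<^sub>0"
  proof -
    show "b \<notin> \<int>\<^sub>\<le>\<^sub>0" using b by auto
    have "2 - b \<notin> \<int>" using b Ints_diff[of 2 "2 - b"] by auto
    then show "2 - b \<notin> \<int>\<^sub>\<le>\<^sub>0" by auto
  qed
  have r1: "rGamma (a - 1) = (a - 1) * rGamma a" "rGamma a = a * rGamma (a + 1)"
    using rGamma_plus1[of "a - 1"] rGamma_plus1[of a] by simp_all
  have r2: "rGamma (a - b) = (a - b) * rGamma (a - b + 1)" "rGamma (a - b + 1) = (a - b + 1) * rGamma (a - b + 2)"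
    using rGamma_plus1[of "a - b"] rGamma_plus1[of "a - b + 1"] by (simp_all add: add.assoc)
  define P Q where "P = Gamma (1 - b)" and "Q = Gamma (b - 1) * z powr (1 - b)"
  have f: "tricomi_U_formula a b z = P * rGamma (a - b + 1) * hyp1F1 a b z + Q * rGamma a * hyp1F1 (a - b + 1) (2 - b) z" for a
    by (simp add: tricomi_U_formula_def P_def Q_def rGamma_inverse_Gamma divide_inverse mult_ac)
  have e: "a - 1 - b + 1 = a - b" "a + 1 - b + 1 = a - b + 2" by simp_all
  have h1: "(b - a) * hyp1F1 (a - 1) b z + (2 * a - b + z) * hyp1F1 a b z - a * hyp1F1 (a + 1) b z = 0"
    by (rule hyp1F1_contiguous[OF nb(1)])
  have h2: "(1 - a) * hyp1F1 (a - b) (2 - b) z + (2 * a - b + z) * hyp1F1 (a - b + 1) (2 - b) z - (a - b + 1) * hyp1F1 (a - b + 2) (2 - b) z = 0"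
    using hyp1F1_contiguous[OF nb(2), of "a - b + 1" z] by (simp add: algebra_simps)
  \<comment> \<open>Every reciprocal Gamma value in the relation is a polynomial multiple of one of
    these two, which reduces the claim to algebra.\<close>
  define R S where "R = rGamma (a - b + 2)" and "S = rGamma (a + 1)"
  have "tricomi_U_formula (a - 1) b z + (b - 2 * a - z) * tricomi_U_formula a b z + a * (a - b + 1) * tricomi_U_formula (a + 1) b z
     = - (P * (a - b + 1) * R) * ((b - a) * hyp1F1 (a - 1) b z + (2 * a - b + z) * hyp1F1 a b z - a * hyp1F1 (a + 1) b z)
       - (Q * a * S) * ((1 - a) * hyp1F1 (a - b) (2 - b) z + (2 * a - b + z) * hyp1F1 (a - b + 1) (2 - b) z - (a - b + 1) * hyp1F1 (a - b + 2) (2 - b) z)"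
    unfolding f e r1(1) r2(1) unfolding r1(2) r2(2) R_def[symmetric] S_def[symmetric] by algebra
  then show ?thesis unfolding h1 h2 by simp
qed

text \<open>The substitution (a, b) -> (a - b + 1, 2 - b) is an involution that exchanges the two
  summands, up to the power of x.\<close>

lemma tricomi_U_formula_kummer:
  assumes x: "x > 0"
  shows "tricomi_U_formula a b (of_real x) = of_real x powr (1 - b) * tricomi_U_formula (a - b + 1) (2 - b) (of_real x)"
proof -
  have "complex_of_real x powr (1 - b) * of_real x powr (1 - (2 - b)) = 1"
    using x by (simp flip: powr_add)
  moreover have "1 - (2 - b) = b - 1" "2 - b - 1 = 1 - b" "a - b + 1 - (2 - b) + 1 = a" "2 - (2 - b) = b" by simp_all
  ultimately show ?thesis
    unfolding tricomi_U_formula_def by (simp add: ring_distribs mult_ac)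
qed

section \<open>The Tricomi function on the line \<open>Re b = 1\<close>\<close>

lemma Re_1_Ints: "Re b = 1 \<Longrightarrow> b \<in> \<int> \<longleftrightarrow> b = 1"
proof
  assume "Re b = 1" "b \<in> \<int>"
  then show "b = 1" by (auto elim!: Ints_cases)
qed simp

lemma eventually_at_1_not_Int: "\<forall>\<^sub>F b in at (1::complex). b \<notin> \<int> \<and> 3/4 \<le> Re b \<and> Re b \<le> 5/4"
  unfolding eventually_at
proof (intro exI[of _ "1/4"] conjI ballI impI)
  fix b :: complex assume b: "b \<noteq> 1 \<and> dist b 1 < 1/4"
  have "\<bar>Re b - 1\<bar> < 1/4"
    using b abs_Re_le_cmod[of "b - 1"] by (simp add: dist_norm)
  then show "3/4 \<le> Re b" "Re b \<le> 5/4" unfolding abs_less_iff by auto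
  show "b \<notin> \<int>"
  proof
    assume "b \<in> \<int>"
    then obtain n where n: "b = of_int n" by (auto elim: Ints_cases)
    have "\<bar>real_of_int n - 1\<bar> < 1/4" using \<open>\<bar>Re b - 1\<bar> < 1/4\<close> n by simp
    then have "n = 1" by linarith
    then show False using n b by simp
  qed
qed simp

text \<open>Existence of the limit at b = 1 cannot be read off the two summands, whose Gamma factors
  have poles there. For Re a > 0 it follows from continuity of the integral; the recurrence around a
  + 1 then carries it one unit to the left per induction step.\<close>

lemma tricomi_U_formula_tendsto:
  assumes a: "Re a > - real N" and x: "x > 0"
  shows "((\<lambda>b. tricomi_U_formula a b (of_real x)) \<longlongrightarrow> tricomi_U a 1 (of_real x)) (at 1) \<and>
    (Re a > 0 \<longrightarrow> tricomi_U a 1 (of_real x) = rGamma a * tricomi_integral a 1 x)"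
  using a
proof (induction N arbitrary: a rule: less_induct)
  case (less N)
  have U: "tricomi_U a 1 (of_real x) = L" if "((\<lambda>b. tricomi_U_formula a b (of_real x)) \<longlongrightarrow> L) (at 1)" for L
    using that by (simp add: tricomi_U_def tendsto_Lim)
  show ?case
  proof (cases "Re a > 0")
    case True
    have "((\<lambda>b. rGamma a * tricomi_integral a b x) \<longlongrightarrow> rGamma a * tricomi_integral a 1 x) (at 1)"
      unfolding tendsto_at_iff_sequentially comp_def
      by (intro allI impI tendsto_mult tendsto_const tendsto_tricomi_integral True x) auto
    then have "((\<lambda>b. tricomi_U_formula a b (of_real x)) \<longlongrightarrow> rGamma a * tricomi_integral a 1 x) (at 1)"
    proof (rule Lim_transform_eventually)
      have nz: "Gamma a \<noteq> 0"
        using True complex_nonpos_Reals_iff nonpos_Ints_subset_nonpos_Reals by (fastforce simp: Gamma_eq_zero_iff)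
      show "\<forall>\<^sub>F b in at 1. rGamma a * tricomi_integral a b x = tricomi_U_formula a b (of_real x)"
        using eventually_at_1_not_Int
        by eventually_elim (simp add: nz tricomi_integral_eq_formula[OF True _ _ _ x] rGamma_inverse_Gamma)
    qed
    with U show ?thesis by simp
  next
    case False
    \<comment> \<open>Re a <= 0 excludes N = 0, and both a + 1 and a + 2 satisfy the hypothesis for
      M.\<close>
    then obtain M where M: "N = Suc M" using less.prems by (cases N) auto
    define L where "L = (\<lambda>a. tricomi_U a 1 (of_real x))"
    have IH: "((\<lambda>b. tricomi_U_formula (a + 1) b (of_real x)) \<longlongrightarrow> L (a + 1)) (at 1)"
       "((\<lambda>b. tricomi_U_formula (a + 2) b (of_real x)) \<longlongrightarrow> L (a + 2)) (at 1)"
      unfolding L_def using less.IH[of M "a + 1"] less.IH[of M "a + 2"] less.prems M by auto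
    have "((\<lambda>b. - ((b - 2 * (a + 1) - of_real x) * tricomi_U_formula (a + 1) b (of_real x) + (a + 1) * (a + 1 - b + 1) * tricomi_U_formula (a + 2) b (of_real x)))
       \<longlongrightarrow> - ((1 - 2 * (a + 1) - of_real x) * L (a + 1) + (a + 1) * (a + 1 - 1 + 1) * L (a + 2))) (at 1)"
      by (intro tendsto_intros IH)
    then have "((\<lambda>b. tricomi_U_formula a b (of_real x)) \<longlongrightarrow> - ((1 - 2 * (a + 1) - of_real x) * L (a + 1) + (a + 1) * (a + 1 - 1 + 1) * L (a + 2))) (at 1)"
    proof (rule Lim_transform_eventually)
      show "\<forall>\<^sub>F b in at 1. - ((b - 2 * (a + 1) - of_real x) * tricomi_U_formula (a + 1) b (of_real x) + (a + 1) * (a + 1 - b + 1) * tricomi_U_formula (a + 2) b (of_real x)) = tricomi_U_formula a b (of_real x)"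
        using eventually_at_1_not_Int
      proof eventually_elim
        case (elim b)
        have "tricomi_U_formula a b (of_real x) + ((b - 2 * (a + 1) - of_real x) * tricomi_U_formula (a + 1) b (of_real x) + (a + 1) * (a + 1 - b + 1) * tricomi_U_formula (a + 2) b (of_real x)) = 0"
          using tricomi_U_formula_recurrence[of b "a + 1" "of_real x"] elim by (simp add: add.assoc)
        then show ?case by (metis add_eq_0_iff2)
      qed
    qed
    with U False show ?thesis by metis
  qed
qed

lemma tricomi_U_tendsto:
  assumes x: "x > 0"
  shows "((\<lambda>b. tricomi_U_formula a b (of_real x)) \<longlongrightarrow> tricomi_U a 1 (of_real x)) (at 1)"
proof -
  obtain N where "- Re a < real N" using reals_Archimedean2 by blast
  then show ?thesis using tricomi_U_formula_tendsto[of N a x] x by auto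
qed

lemma tricomi_U_eq_integral:
  assumes a: "Re a > 0" and b: "Re b = 1" and x: "x > 0"
  shows "tricomi_U a b (of_real x) = rGamma a * tricomi_integral a b x"
proof (cases "b = 1")
  case True
  then show ?thesis using tricomi_U_formula_tendsto[of 0 a x] a x by simp
next
  case False
  then have "b \<notin> \<int>" using Re_1_Ints[OF b] by simp
  moreover have "Gamma a \<noteq> 0"
    using a complex_nonpos_Reals_iff nonpos_Ints_subset_nonpos_Reals by (fastforce simp: Gamma_eq_zero_iff)
  ultimately show ?thesis
    using b by (simp add: tricomi_integral_eq_formula[OF a _ _ _ x] tricomi_U_def rGamma_inverse_Gamma)
qed

lemma tricomi_U_recurrence:
  assumes b: "Re b = 1" and x: "x > 0"
  shows "tricomi_U (a - 1) b (of_real x) + (b - 2 * a - of_real x) * tricomi_U a b (of_real x)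
     + a * (a - b + 1) * tricomi_U (a + 1) b (of_real x) = 0"
proof (cases "b = 1")
  case True
  have "((\<lambda>b. tricomi_U_formula (a - 1) b (of_real x) + (b - 2 * a - of_real x) * tricomi_U_formula a b (of_real x)
     + a * (a - b + 1) * tricomi_U_formula (a + 1) b (of_real x)) \<longlongrightarrow> tricomi_U (a - 1) 1 (of_real x) + (1 - 2 * a - of_real x) * tricomi_U a 1 (of_real x)
     + a * (a - 1 + 1) * tricomi_U (a + 1) 1 (of_real x)) (at 1)"
    by (intro tendsto_intros tricomi_U_tendsto x)
  moreover have "((\<lambda>b. tricomi_U_formula (a - 1) b (of_real x) + (b - 2 * a - of_real x) * tricomi_U_formula a b (of_real x)
     + a * (a - b + 1) * tricomi_U_formula (a + 1) b (of_real x)) \<longlongrightarrow> 0) (at 1)"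
    by (rule Lim_transform_eventually[OF tendsto_const])
       (use eventually_at_1_not_Int in \<open>auto elim!: eventually_mono simp: tricomi_U_formula_recurrence\<close>)
  ultimately have "tricomi_U (a - 1) 1 (of_real x) + (1 - 2 * a - of_real x) * tricomi_U a 1 (of_real x)
     + a * (a - 1 + 1) * tricomi_U (a + 1) 1 (of_real x) = 0"
    by (rule tendsto_unique[rotated]) simp
  then show ?thesis by (simp only: True)
next
  case False
  then have "b \<notin> \<int>" using Re_1_Ints[OF b] by simp
  then show ?thesis by (simp add: tricomi_U_def tricomi_U_formula_recurrence)
qed

lemma tricomi_U_kummer:
  assumes b: "Re b = 1" and x: "x > 0"
  shows "tricomi_U a b (of_real x) = of_real x powr (1 - b) * tricomi_U (a - b + 1) (2 - b) (of_real x)"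
proof (cases "b = 1")
  case True
  then show ?thesis using x by simp
next
  case False
  then have "b \<notin> \<int>" using Re_1_Ints[OF b] by simp
  moreover have "2 - b \<notin> \<int>" using Re_1_Ints[of "2 - b"] b False by auto
  ultimately show ?thesis
    unfolding tricomi_U_def by (simp only: if_False) (rule tricomi_U_formula_kummer[OF x])
qed

lemma tricomi_U_step:
  assumes "Re b = 1" "x > 0"
  shows "tricomi_U a b (of_real x) = - ((b - 2 * (a + 1) - of_real x) * tricomi_U (a + 1) b (of_real x)
     + (a + 1) * (a - b + 2) * tricomi_U (a + 2) b (of_real x))"
proof -
  have "tricomi_U a b (of_real x) + ((b - 2 * (a + 1) - of_real x) * tricomi_U (a + 1) b (of_real x)
     + (a + 1) * (a - b + 2) * tricomi_U (a + 2) b (of_real x)) = 0"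
    using tricomi_U_recurrence[OF assms, of "a + 1"] by (simp add: algebra_simps)
  then show ?thesis by (metis add_eq_0_iff2)
qed

section \<open>Uniform bounds and continuity in the first parameter\<close>

text \<open>For Re a >= 1/4 the integral gives the power x^(-1/4) uniformly in \<open>a\<close>.
  Each use of the recurrence moves one unit to the left and has a coefficient linear in x, so it
  costs one factor 1 + x and leaves the singularity at 0 unchanged.\<close>

lemma tricomi_U_bound:
  assumes b: "Re b = 1"
  shows "\<exists>C\<ge>0. \<forall>a x. Re a \<ge> 1/4 - real N \<longrightarrow> norm a \<le> R \<longrightarrow> x > 0 \<longrightarrow>
    norm (tricomi_U a b (of_real x)) \<le> C * (1 + x) ^ N * x powr (-1/4)"
proof (induction N arbitrary: R)
  case 0
  have "compact (rGamma ` cball (0::complex) R)"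
    by (intro compact_continuous_image continuous_intros) auto
  then obtain G where G: "G > 0" "\<And>a::complex. norm a \<le> R \<Longrightarrow> norm (rGamma a) \<le> G"
    by (auto dest!: compact_imp_bounded simp: bounded_pos)
  show ?case
  proof (intro exI[of _ "G * (2 * Gamma (1/4))"] conjI allI impI)
    show "0 \<le> G * (2 * Gamma (1/4))" using G by (intro mult_nonneg_nonneg Gamma_real_nonneg) auto
    fix a :: complex and x :: real assume a: "1/4 - real 0 \<le> Re a" "norm a \<le> R" and x: "x > 0"
    have "norm (tricomi_integral a b x) \<le> 2 * Gamma (1/4) * x powr (-1/4)"
      using norm_tricomi_integral_le[of b "1/4" a x] a b x by simp
    then have "norm (rGamma a) * norm (tricomi_integral a b x) \<le> G * (2 * Gamma (1/4) * x powr (-1/4))"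
      using G a by (intro mult_mono) auto
    then show "norm (tricomi_U a b (of_real x)) \<le> G * (2 * Gamma (1/4)) * (1 + x) ^ 0 * x powr (-1/4)"
      using a b x by (simp add: tricomi_U_eq_integral norm_mult mult_ac)
  qed
next
  case (Suc N)
  \<comment> \<open>The recurrence refers to a + 1 and a + 2, hence to a disc larger by 2.\<close>
  from Suc[of "R + 2"] obtain C where C: "C \<ge> 0"
    "\<And>a x. Re a \<ge> 1/4 - real N \<Longrightarrow> norm a \<le> R + 2 \<Longrightarrow> x > 0 \<Longrightarrow> norm (tricomi_U a b (of_real x)) \<le> C * (1 + x) ^ N * x powr (-1/4)"
    by blast
  \<comment> \<open>The sum of bounds for the two coefficients of the recurrence, without their x;
    the extra 1 lets D (1 + x) absorb the missing x. Absolute values of R cover every real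
    R.\<close>
  define D where "D = norm b + 2 * (\<bar>R\<bar> + 1) + 1 + (\<bar>R\<bar> + 1) * (\<bar>R\<bar> + norm b + 2)"
  show ?case
  proof (intro exI[of _ "D * C"] conjI allI impI)
    show "0 \<le> D * C" using C by (auto simp: D_def)
    fix a :: complex and x :: real assume a: "1/4 - real (Suc N) \<le> Re a" "norm a \<le> R" and x: "x > 0"
    let ?B = "C * (1 + x) ^ N * x powr (-1/4)"
    have B: "?B \<ge> 0" using C x by simp
    have n1: "norm (a + 1) \<le> R + 1" "norm (a + 2) \<le> R + 2"
      using norm_triangle_ineq[of a 1] norm_triangle_ineq[of a 2] a by auto
    have u1: "norm (tricomi_U (a + 1) b (of_real x)) \<le> ?B" and u2: "norm (tricomi_U (a + 2) b (of_real x)) \<le> ?B"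
      using C(2)[of "a + 1" x] C(2)[of "a + 2" x] a n1 x by auto
    have n2: "norm (2 * (a + 1)) = 2 * norm (a + 1)" "norm (complex_of_real x) = x"
      unfolding norm_mult using x by simp_all
    have k1: "norm (b - 2 * (a + 1) - of_real x) \<le> norm b + 2 * (\<bar>R\<bar> + 1) + x"
    proof -
      have "norm (b - 2 * (a + 1) - of_real x) \<le> norm (b - 2 * (a + 1)) + norm (complex_of_real x)"
        by (rule norm_triangle_ineq4)
      also have "\<dots> \<le> (norm b + norm (2 * (a + 1))) + x"
        unfolding n2(2) by (intro add_right_mono norm_triangle_ineq4)
      also have "\<dots> \<le> (norm b + 2 * (\<bar>R\<bar> + 1)) + x"
        unfolding n2(1) using n1(1) by (intro add_right_mono add_left_mono) auto
      finally show ?thesis .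
    qed
    have k2: "norm (a - b + 2) \<le> \<bar>R\<bar> + norm b + 2"
      using norm_triangle_ineq[of "a - b" 2] norm_triangle_ineq4[of a b] a by simp
    have "norm (tricomi_U a b (of_real x)) \<le> norm ((b - 2 * (a + 1) - of_real x) * tricomi_U (a + 1) b (of_real x))
        + norm ((a + 1) * (a - b + 2) * tricomi_U (a + 2) b (of_real x))"
      unfolding tricomi_U_step[OF b x, of a] norm_minus_cancel by (rule norm_triangle_ineq)
    also have "\<dots> \<le> (norm b + 2 * (\<bar>R\<bar> + 1) + x) * ?B + ((\<bar>R\<bar> + 1) * (\<bar>R\<bar> + norm b + 2)) * ?B"
      unfolding norm_mult using k1 k2 u1 u2 n1 x B by (intro add_mono mult_mono) auto
    also have "\<dots> = (norm b + 2 * (\<bar>R\<bar> + 1) + x + (\<bar>R\<bar> + 1) * (\<bar>R\<bar> + norm b + 2)) * ?B"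
      by (simp only: ring_distribs)
    also have "\<dots> \<le> (D * (1 + x)) * ?B"
    proof (rule mult_right_mono[OF _ B])
      have "D \<ge> 1" by (simp add: D_def)
      then have "D * x \<ge> x" using x by simp
      then show "norm b + 2 * (\<bar>R\<bar> + 1) + x + (\<bar>R\<bar> + 1) * (\<bar>R\<bar> + norm b + 2) \<le> D * (1 + x)"
        unfolding D_def by (simp only: ring_distribs)
    qed
    also have "\<dots> = D * C * (1 + x) ^ Suc N * x powr (-1/4)" by (simp add: mult_ac)
    finally show "norm (tricomi_U a b (of_real x)) \<le> D * C * (1 + x) ^ Suc N * x powr (-1/4)" .
  qed
qed

lemma tendsto_rGamma_complex:
  fixes a :: complex
  assumes "(f \<longlongrightarrow> a) F"
  shows "((\<lambda>x. rGamma (f x)) \<longlongrightarrow> rGamma a) F"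
proof -
  have "continuous_on UNIV (rGamma :: complex \<Rightarrow> complex)" by (intro continuous_intros)
  then have "isCont rGamma a" by (simp add: continuous_on_eq_continuous_at)
  then show ?thesis using assms by (rule isCont_tendsto_compose)
qed

text \<open>Continuity comes from the integral for Re a > 0 and is carried to the left by the
  recurrence.\<close>

lemma tendsto_tricomi_U:
  assumes b: "Re b = 1" and x: "x > 0" and A: "A \<longlonglongrightarrow> a"
  shows "(\<lambda>n. tricomi_U (A n) b (of_real x)) \<longlonglongrightarrow> tricomi_U a b (of_real x)"
proof -
  have "(\<lambda>n. tricomi_U (A n) b (of_real x)) \<longlonglongrightarrow> tricomi_U a b (of_real x)" if "Re a > - real N" "A \<longlonglongrightarrow> a" for N A a
    using that
  proof (induction N arbitrary: a A)
    case 0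
    have "\<forall>\<^sub>F n in sequentially. Re (A n) > 0"
      using order_tendstoD(1)[OF tendsto_Re[OF 0(2)], of 0] 0(1) by simp
    then have "\<forall>\<^sub>F n in sequentially. rGamma (A n) * tricomi_integral (A n) b x = tricomi_U (A n) b (of_real x)"
      by eventually_elim (simp add: tricomi_U_eq_integral b x)
    moreover have "(\<lambda>n. rGamma (A n) * tricomi_integral (A n) b x) \<longlonglongrightarrow> rGamma a * tricomi_integral a b x"
      using 0 x by (intro tendsto_mult tendsto_rGamma_complex tendsto_tricomi_integral) auto
    ultimately have "(\<lambda>n. tricomi_U (A n) b (of_real x)) \<longlonglongrightarrow> rGamma a * tricomi_integral a b x"
      by (rule Lim_transform_eventually[rotated])
    then show ?case using 0 by (simp add: tricomi_U_eq_integral b x)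
  next
    case (Suc N)
    have "(\<lambda>n. - ((b - 2 * (A n + 1) - of_real x) * tricomi_U (A n + 1) b (of_real x) + (A n + 1) * (A n - b + 2) * tricomi_U (A n + 2) b (of_real x)))
      \<longlonglongrightarrow> - ((b - 2 * (a + 1) - of_real x) * tricomi_U (a + 1) b (of_real x) + (a + 1) * (a - b + 2) * tricomi_U (a + 2) b (of_real x))"
      using Suc.prems by (intro tendsto_intros Suc.IH) auto
    then show ?case by (simp only: tricomi_U_step[OF b x, symmetric])
  qed
  moreover obtain N where "- Re a < real N" using reals_Archimedean2 by blast
  ultimately show ?thesis using A by (metis minus_less_iff)
qed

lemma continuous_on_tricomi_U:
  assumes b: "Re b = 1"
  shows "continuous_on {0<..} (\<lambda>x. tricomi_U a b (of_real x))"
proof -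
  have "continuous_on {0<..} (\<lambda>x. tricomi_U a b (of_real x))" if "Re a > - real N" for N a
    using that
  proof (induction N arbitrary: a)
    case 0
    then have "continuous_on {0<..} (\<lambda>x. rGamma a * tricomi_integral a b x)"
      by (intro continuous_intros continuous_at_imp_continuous_on)
         (auto intro!: has_vector_derivative_continuous[OF has_vector_derivative_tricomi_integral])
    then show ?case
      by (rule continuous_on_cong[THEN iffD1, rotated -1]) (use 0 in \<open>auto simp: tricomi_U_eq_integral b\<close>)
  next
    case (Suc N)
    have "continuous_on {0<..} (\<lambda>x. - ((b - 2 * (a + 1) - of_real x) * tricomi_U (a + 1) b (of_real x) + (a + 1) * (a - b + 2) * tricomi_U (a + 2) b (of_real x)))"
      using Suc.prems by (intro continuous_intros Suc.IH) auto
    then show ?case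
      by (rule continuous_on_cong[THEN iffD1, rotated -1]) (auto simp: tricomi_U_step[OF b, of _ a])
  qed
  moreover obtain N where "- Re a < real N" using reals_Archimedean2 by blast
  ultimately show ?thesis by (metis minus_less_iff)
qed

text \<open>The normalisation \<open>1 / \<Gamma> \<alpha>\<close> makes the Fourier transform of \<open>laguerre_fun\<close> exactly
  \<open>(1/2 + i t) powr (- \<alpha>) * (1/2 - i t) powr (- \<beta>)\<close>.\<close>
definition laguerre_half :: "complex \<Rightarrow> complex \<Rightarrow> real \<Rightarrow> complex" where
  "laguerre_half \<alpha> \<beta> x = of_real (exp (- x / 2)) * of_real x powr (\<alpha> + \<beta> - 1) * tricomi_U \<beta> (\<alpha> + \<beta>) (of_real x) * rGamma \<alpha>"

text \<open>Reflection x -> -x exchanges \<alpha> and \<beta>, as it does for a correlation of two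
  functions.\<close>

definition laguerre_fun :: "real \<Rightarrow> real \<Rightarrow> real \<Rightarrow> complex" where
  "laguerre_fun \<rho> s x =
     (if x > 0 then laguerre_half (Complex (1/2 - s) \<rho>) (Complex (1/2 + s) \<rho>) x
      else if x < 0 then laguerre_half (Complex (1/2 + s) \<rho>) (Complex (1/2 - s) \<rho>) (- x) else 0)"

section \<open>Laguerre functions: decay, continuity and recurrence\<close>

lemma laguerre_fun_minus: "laguerre_fun \<rho> (- s) (- x) = laguerre_fun \<rho> s x"
  by (simp add: laguerre_fun_def)

lemma Complex_half_add:
  "Complex (1/2 - s) \<rho> + Complex (1/2 + s) \<rho> = Complex 1 (2 * \<rho>)"
  "Complex (1/2 + s) \<rho> + Complex (1/2 - s) \<rho> = Complex 1 (2 * \<rho>)"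
  by (simp_all add: complex_eq_iff)

text \<open>The inequality 1 + y <= exp y at y = x/(4N), raised to the power N. The rate 1/4 spends
  half of the decay exp(-x/2) of \<open>laguerre_half\<close>.\<close>

lemma one_plus_power_le_exp:
  assumes "x \<ge> 0"
  shows "(1 + x) ^ N \<le> (4 * real N + 1) ^ N * exp (x / 4)"
proof (cases "N = 0")
  case False
  have "1 + x \<le> (4 * real N + 1) * (1 + x / (4 * real N))"
    using assms False by (simp add: field_simps)
  also have "\<dots> \<le> (4 * real N + 1) * exp (x / (4 * real N))"
    by (intro mult_left_mono exp_ge_add_one_self) auto
  finally have "(1 + x) ^ N \<le> ((4 * real N + 1) * exp (x / (4 * real N))) ^ N"
    using assms by (intro power_mono) auto
  also have "\<dots> = (4 * real N + 1) ^ N * exp (x / 4)"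
    using False by (simp add: power_mult_distrib exp_of_nat_mult[symmetric])
  finally show ?thesis .
qed (use assms in simp)

text \<open>One majorant serves all s in a bounded range. It is square integrable at 0, the factor 1
  + |x| also makes x times the function integrable, as differentiating the transform requires, and
  the uniformity in s permits limits in s.\<close>

lemma laguerre_fun_bound:
  "\<exists>C\<ge>0. \<forall>s x. \<bar>s\<bar> \<le> R \<longrightarrow> (1 + \<bar>x\<bar>) * norm (laguerre_fun \<rho> s x) \<le> C * (\<bar>x\<bar> powr (-1/4) * exp (- (\<bar>x\<bar> / 4)))"
proof -
  define b where "b = Complex 1 (2 * \<rho>)"
  \<comment> \<open>A common bound for |\<alpha>| and |\<beta>|, whose real parts are 1/2 - s and
    1/2 + s and whose imaginary part is \<rho>.\<close>
  define R' where "R' = 1/2 + R + \<bar>\<rho>\<bar>"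
  \<comment> \<open>Then 1/2 - |s| exceeds 1/4 - N, so both half lines fall under the bound for
    U.\<close>
  obtain N where N: "R < real N" using reals_Archimedean2 by blast
  from tricomi_U_bound[of b N R'] obtain C where C: "C \<ge> 0"
    "\<And>a x. Re a \<ge> 1/4 - real N \<Longrightarrow> norm a \<le> R' \<Longrightarrow> x > 0 \<Longrightarrow> norm (tricomi_U a b (of_real x)) \<le> C * (1 + x) ^ N * x powr (-1/4)"
    by (auto simp: b_def)
  have "compact (rGamma ` cball (0::complex) R')"
    by (intro compact_continuous_image continuous_intros) auto
  then obtain G where G: "G > 0" "\<And>a::complex. norm a \<le> R' \<Longrightarrow> norm (rGamma a) \<le> G"
    by (auto dest!: compact_imp_bounded simp: bounded_pos)
  define D where "D = C * G * (4 * real (Suc N) + 1) ^ Suc N"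
  have half: "(1 + x) * norm (laguerre_half \<alpha> \<beta> x) \<le> D * (x powr (-1/4) * exp (- (x / 4)))"
    if "\<alpha> + \<beta> = b" "norm \<alpha> \<le> R'" "norm \<beta> \<le> R'" "Re \<beta> \<ge> 1/4 - real N" "x > 0" for \<alpha> \<beta> x
  proof -
    have "norm (laguerre_half \<alpha> \<beta> x) = exp (- x / 2) * norm (tricomi_U \<beta> b (of_real x)) * norm (rGamma \<alpha>)"
      unfolding laguerre_half_def that(1) using that(5) by (simp add: norm_mult norm_cpowr b_def)
    also have "\<dots> \<le> exp (- x / 2) * (C * (1 + x) ^ N * x powr (-1/4)) * G"
      using that C G by (intro mult_mono mult_nonneg_nonneg) auto
    finally have "(1 + x) * norm (laguerre_half \<alpha> \<beta> x) \<le> (1 + x) * (exp (- x / 2) * (C * (1 + x) ^ N * x powr (-1/4)) * G)"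
      using that by (intro mult_left_mono) auto
    also have "\<dots> = C * G * x powr (-1/4) * exp (- x / 2) * (1 + x) ^ Suc N"
      by (simp add: mult_ac)
    also have "\<dots> \<le> C * G * x powr (-1/4) * exp (- x / 2) * ((4 * real (Suc N) + 1) ^ Suc N * exp (x / 4))"
      using that C G by (intro mult_left_mono one_plus_power_le_exp) auto
    also have "\<dots> = D * (x powr (-1/4) * (exp (- x / 2) * exp (x / 4)))"
      by (simp only: D_def mult_ac)
    also have "exp (- x / 2) * exp (x / 4) = exp (- (x / 4))"
      by (simp flip: exp_add)
    finally show ?thesis .
  qed
  have par: "norm (Complex (1/2 - s) \<rho>) \<le> R'" "norm (Complex (1/2 + s) \<rho>) \<le> R'"
    "Re (Complex (1/2 - s) \<rho>) \<ge> 1/4 - real N" "Re (Complex (1/2 + s) \<rho>) \<ge> 1/4 - real N" if "\<bar>s\<bar> \<le> R" for s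
    using cmod_le[of "Complex (1/2 - s) \<rho>"] cmod_le[of "Complex (1/2 + s) \<rho>"] that N by (auto simp: R'_def)
  show ?thesis
  proof (intro exI[of _ D] conjI allI impI)
    show "0 \<le> D" using C G by (simp add: D_def)
    fix s x :: real assume s: "\<bar>s\<bar> \<le> R"
    show "(1 + \<bar>x\<bar>) * norm (laguerre_fun \<rho> s x) \<le> D * (\<bar>x\<bar> powr (-1/4) * exp (- (\<bar>x\<bar> / 4)))"
      using half[OF _ par(1)[OF s] par(2)[OF s] par(4)[OF s], of x] half[OF _ par(2)[OF s] par(1)[OF s] par(3)[OF s], of "- x"]
      unfolding laguerre_fun_def Complex_half_add b_def by (cases x "0::real" rule: linorder_cases) auto
  qed
qed

lemma laguerre_fun_tendsto:
  assumes "S \<longlonglongrightarrow> s"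
  shows "(\<lambda>n. laguerre_fun \<rho> (S n) x) \<longlonglongrightarrow> laguerre_fun \<rho> s x"
proof -
  have c: "(\<lambda>n. Complex (1/2 - S n) \<rho>) \<longlonglongrightarrow> Complex (1/2 - s) \<rho>" "(\<lambda>n. Complex (1/2 + S n) \<rho>) \<longlonglongrightarrow> Complex (1/2 + s) \<rho>"
    using assms by (auto intro!: tendsto_intros)
  have u: "(\<lambda>n. tricomi_U (A n) (Complex 1 (2 * \<rho>)) (of_real y)) \<longlonglongrightarrow> tricomi_U a (Complex 1 (2 * \<rho>)) (of_real y)" if "A \<longlonglongrightarrow> a" "y > 0" for A a y
    using that by (intro tendsto_tricomi_U) auto
  consider "x > 0" | "x < 0" | "x = 0" by linarith
  then show ?thesis
  proof cases
    case 1
    then show ?thesis unfolding laguerre_fun_def laguerre_half_def Complex_half_add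
      by (simp only: if_True) (intro tendsto_mult tendsto_const u c tendsto_rGamma_complex)
  next
    case 2
    then show ?thesis unfolding laguerre_fun_def laguerre_half_def Complex_half_add
      by (simp add: not_less_iff_gr_or_eq del: of_real_minus of_real_exp of_real_divide) (intro tendsto_mult tendsto_const u c tendsto_rGamma_complex, auto)
  qed (simp add: laguerre_fun_def)
qed

lemma isCont_laguerre_fun: "x \<noteq> 0 \<Longrightarrow> isCont (laguerre_fun \<rho> s) x"
proof -
  have half: "isCont (laguerre_half \<alpha> \<beta>) x" if "x > 0" "Re (\<alpha> + \<beta>) = 1" for \<alpha> \<beta> x
  proof -
    have "isCont (\<lambda>x. tricomi_U \<beta> (\<alpha> + \<beta>) (of_real x)) x"
      using continuous_on_tricomi_U[OF that(2)] that(1) by (auto simp: continuous_on_eq_continuous_at)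
    moreover have "isCont (\<lambda>x. complex_of_real x powr (\<alpha> + \<beta> - 1)) x"
      using has_vector_derivative_cpowr[OF that(1)] by (rule has_vector_derivative_continuous)
    moreover have "isCont (\<lambda>x. complex_of_real (exp (- x / 2))) x"
      by (intro continuous_intros) auto
    ultimately show ?thesis
      unfolding laguerre_half_def[abs_def] by (intro continuous_mult continuous_const)
  qed
  assume "x \<noteq> 0"
  then consider "x > 0" | "x < 0" by linarith
  then show ?thesis
  proof cases
    case 1
    have "isCont (laguerre_half (Complex (1/2 - s) \<rho>) (Complex (1/2 + s) \<rho>)) x"
      using 1 by (intro half) (simp_all add: Complex_half_add)
    then show ?thesis
      by (rule isCont_cong[THEN iffD1, rotated])
         (use eventually_nhds_in_open[of "{0<..}" x] 1 in \<open>auto elim!: eventually_mono simp: laguerre_fun_def\<close>)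
  next
    case 2
    have m: "isCont (\<lambda>x::real. - x) x" by (intro continuous_intros)
    have "isCont (laguerre_half (Complex (1/2 + s) \<rho>) (Complex (1/2 - s) \<rho>)) (- x)"
      using 2 by (intro half) (simp_all add: Complex_half_add)
    then have "isCont (\<lambda>x. laguerre_half (Complex (1/2 + s) \<rho>) (Complex (1/2 - s) \<rho>) (- x)) x"
      by (rule isCont_o2[OF m])
    then show ?thesis
      by (rule isCont_cong[THEN iffD1, rotated])
         (use eventually_nhds_in_open[of "{..<0}" x] 2 in \<open>auto elim!: eventually_mono simp: laguerre_fun_def\<close>)
  qed
qed

text \<open>Raising one of \<alpha>, \<beta> and lowering the other keeps their sum, so the
  exponential, the power of x and the second parameter of U are common to all terms, and the
  recurrence of U at a = \<beta> remains. It is grouped to match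
  \<open>laguerre_hat_deriv\<close>.\<close>

lemma laguerre_half_recurrence:
  assumes ab: "Re (\<alpha> + \<beta>) = 1" and x: "x > 0"
  shows "of_real x * laguerre_half \<alpha> \<beta> x = \<alpha> * (laguerre_half (\<alpha> + 1) (\<beta> - 1) x + laguerre_half \<alpha> \<beta> x)
     - \<beta> * (laguerre_half \<alpha> \<beta> x + laguerre_half (\<alpha> - 1) (\<beta> + 1) x)"
proof -
  let ?b = "\<alpha> + \<beta>"
  have e: "\<alpha> + 1 + (\<beta> - 1) = ?b" "\<alpha> - 1 + (\<beta> + 1) = ?b" by simp_all
  define E where "E = of_real (exp (- x / 2)) * complex_of_real x powr (?b - 1)"
  have g1: "rGamma \<alpha> = \<alpha> * rGamma (\<alpha> + 1)"
    by (simp only: rGamma_plus1)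
  have g2: "rGamma (\<alpha> - 1) = (\<alpha> - 1) * rGamma \<alpha>"
    using rGamma_plus1[of "\<alpha> - 1"] by simp
  define U where "U = (\<lambda>a. tricomi_U a ?b (of_real x))"
  have r: "U (\<beta> - 1) = - ((?b - 2 * \<beta> - of_real x) * U \<beta> + \<beta> * (\<beta> - ?b + 1) * U (\<beta> + 1))"
    using tricomi_U_recurrence[OF ab x, of \<beta>] unfolding eq_neg_iff_add_eq_0 U_def by (simp only: add.assoc)
  have h: "laguerre_half (\<alpha> + 1) (\<beta> - 1) x = E * U (\<beta> - 1) * rGamma (\<alpha> + 1)" "laguerre_half \<alpha> \<beta> x = E * U \<beta> * rGamma \<alpha>"
    "laguerre_half (\<alpha> - 1) (\<beta> + 1) x = E * U (\<beta> + 1) * rGamma (\<alpha> - 1)"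
    unfolding laguerre_half_def e E_def U_def by simp_all
  define S where "S = rGamma (\<alpha> + 1)"
  show ?thesis
    unfolding h g2 unfolding g1 r S_def[symmetric] by algebra
qed

text \<open>On the negative half line \<alpha> and \<beta> change places and so do s - 1 and s + 1;
  both changes together reverse the sign of the right side, in step with the sign of x. Hence one
  formula covers the whole line.\<close>

lemma laguerre_fun_recurrence:
  "of_real x * laguerre_fun \<rho> s x = Complex (1/2 - s) \<rho> * (laguerre_fun \<rho> (s - 1) x + laguerre_fun \<rho> s x)
     - Complex (1/2 + s) \<rho> * (laguerre_fun \<rho> s x + laguerre_fun \<rho> (s + 1) x)"
proof -
  have e: "Complex (1/2 - (s - 1)) \<rho> = Complex (1/2 - s) \<rho> + 1" "Complex (1/2 + (s - 1)) \<rho> = Complex (1/2 + s) \<rho> - 1"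
    "Complex (1/2 - (s + 1)) \<rho> = Complex (1/2 - s) \<rho> - 1" "Complex (1/2 + (s + 1)) \<rho> = Complex (1/2 + s) \<rho> + 1"
    by (simp_all add: complex_eq_iff)
  consider "x > 0" | "x < 0" | "x = 0" by linarith
  then show ?thesis
  proof cases
    case 1
    then show ?thesis
      using laguerre_half_recurrence[of "Complex (1/2 - s) \<rho>" "Complex (1/2 + s) \<rho>" x]
      unfolding laguerre_fun_def e by simp
  next
    case 2
    have "of_real (- x) * A = P * (B + A) - Q * (A + D) \<Longrightarrow> of_real x * A = Q * (D + A) - P * (A + B)" for A B D P Q :: complex
      by (simp add: algebra_simps)
    from this[OF laguerre_half_recurrence[of "Complex (1/2 + s) \<rho>" "Complex (1/2 - s) \<rho>" "- x"]] 2
    show ?thesis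
      unfolding laguerre_fun_def e by simp
  qed (simp add: laguerre_fun_def)
qed

section \<open>Fourier transforms of the Laguerre functions\<close>

text \<open>Unnormalised, with exponent -i t x: multiplication by x becomes i times differentiation
  in t, and Plancherel's formula carries the factor 2 pi.\<close>

definition fourier :: "(real \<Rightarrow> complex) \<Rightarrow> real \<Rightarrow> complex" where
  "fourier F t = (\<integral>x. cis (- (t * x)) * F x \<partial>lborel)"

lemma cis_borel_measurable [measurable]: "cis \<in> borel_measurable borel"
  by (intro borel_measurable_continuous_onI continuous_intros)

lemma integrable_cis_mult [intro]:
  assumes "integrable lborel F"
  shows "integrable lborel (\<lambda>x. cis (- (t * x)) * F x)"
proof (rule Bochner_Integration.integrable_bound[OF assms])
  show "(\<lambda>x. cis (- (t * x)) * F x) \<in> borel_measurable lborel"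
    using assms by (intro borel_measurable_times) auto
qed (auto simp: norm_mult)

lemma fourier_add:
  assumes "integrable lborel F" "integrable lborel G"
  shows "fourier (\<lambda>x. F x + G x) t = fourier F t + fourier G t"
  unfolding fourier_def using assms by (simp add: ring_distribs integrable_cis_mult)

lemma fourier_diff:
  assumes "integrable lborel F" "integrable lborel G"
  shows "fourier (\<lambda>x. F x - G x) t = fourier F t - fourier G t"
  unfolding fourier_def using assms by (simp add: ring_distribs integrable_cis_mult)

lemma fourier_mult: "fourier (\<lambda>x. c * F x) t = c * fourier F t"
proof -
  have "(\<lambda>x. cis (- (t * x)) * (c * F x)) = (\<lambda>x. c * (cis (- (t * x)) * F x))" by (simp add: mult_ac)
  then show ?thesis unfolding fourier_def by simp
qed

lemma fourier_sum:
  assumes "\<And>i. i \<in> I \<Longrightarrow> integrable lborel (F i)"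
  shows "fourier (\<lambda>x. \<Sum>i\<in>I. F i x) t = (\<Sum>i\<in>I. fourier (F i) t)"
  unfolding fourier_def sum_distrib_left using assms
  by (intro Bochner_Integration.integral_sum integrable_cis_mult) auto

lemma fourier_minus: "fourier (\<lambda>x. F (- x)) t = fourier F (- t)"
proof -
  have "fourier F (- t) = \<bar>-1\<bar> *\<^sub>R (\<integral>x. cis (- (- t * (0 + -1 * x))) * F (0 + -1 * x) \<partial>lborel)"
    unfolding fourier_def by (intro lborel_integral_real_affine) auto
  then show ?thesis by (simp add: fourier_def)
qed

lemma has_vector_derivative_cis: "((\<lambda>t. cis (- (t * x))) has_vector_derivative - \<i> * of_real x * cis (- (t * x))) (at t)"
proof -
  have i: "(complex_of_real has_vector_derivative 1) (at t)"
    using has_vector_derivative_of_real[OF DERIV_ident] by simp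
  have "((\<lambda>z. exp (- \<i> * of_real x * z)) has_field_derivative exp (- \<i> * of_real x * of_real t) * (- \<i> * of_real x * 1)) (at (of_real t))"
    by (auto intro!: derivative_eq_intros)
  from field_vector_diff_chain_at[OF i this] show ?thesis
    by (simp add: o_def cis_conv_exp mult_ac)
qed

lemma has_vector_derivative_fourier:
  assumes F: "integrable lborel F" and xF: "integrable lborel (\<lambda>x. of_real x * F x)"
  shows "(fourier F has_vector_derivative - \<i> * fourier (\<lambda>x. of_real x * F x) t) (at t)"
proof -
  have "((\<lambda>t. \<integral>x. cis (- (t * x)) * F x \<partial>lborel) has_vector_derivative (\<integral>x. (- \<i> * of_real x * cis (- (t * x))) * F x \<partial>lborel)) (at t)"
  proof (rule has_vector_derivative_integral_dominated)
    show "t \<in> {t - 1<..<t + 1}" by simp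
    show "integrable lborel (\<lambda>x. norm (of_real x * F x))" by (rule integrable_norm[OF xF])
    show "(\<lambda>x. (- \<i> * of_real x * cis (- (t * x))) * F x) \<in> borel_measurable lborel"
      using F by (intro borel_measurable_times) auto
    fix u x :: real
    show "integrable lborel (\<lambda>x. cis (- (u * x)) * F x)" using F by (rule integrable_cis_mult)
    show "((\<lambda>t. cis (- (t * x)) * F x) has_vector_derivative (- \<i> * of_real x * cis (- (u * x))) * F x) (at u)"
      by (intro has_vector_derivative_mult_left has_vector_derivative_cis)
    show "norm ((- \<i> * of_real x * cis (- (u * x))) * F x) \<le> norm (of_real x * F x)"
      by (simp add: norm_mult)
  qed
  moreover have "(\<integral>x. (- \<i> * of_real x * cis (- (t * x))) * F x \<partial>lborel) = - \<i> * fourier (\<lambda>x. of_real x * F x) t"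
  proof -
    have "(\<lambda>x. (- \<i> * of_real x * cis (- (t * x))) * F x) = (\<lambda>x. - \<i> * (cis (- (t * x)) * (of_real x * F x)))"
      by (simp add: mult_ac)
    then show ?thesis unfolding fourier_def by (simp only: integral_mult_right_zero)
  qed
  ultimately show ?thesis by (simp add: fourier_def[abs_def])
qed

text \<open>Fubini after the shift x -> x - y. The correlation is the convolution of f with the
  reflection of g, whence the argument -t. It is applied to two gamma kernels and, for Plancherel,
  to F and the conjugate of G.\<close>

lemma
  assumes f: "integrable lborel (f :: real \<Rightarrow> complex)" and g: "integrable lborel (g :: real \<Rightarrow> complex)"
  shows integrable_correlation: "integrable lborel (\<lambda>x. \<integral>y. f (x + y) * g y \<partial>lborel)"
    and fourier_correlation: "fourier (\<lambda>x. \<integral>y. f (x + y) * g y \<partial>lborel) t = fourier f t * fourier g (- t)"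
proof -
  have [measurable]: "f \<in> borel_measurable borel" "g \<in> borel_measurable borel"
    using f g by auto
  have shift: "integrable lborel (\<lambda>x. h (x + y)) \<and> (\<integral>x. h (x + y) \<partial>lborel) = (\<integral>x. h x \<partial>lborel)"
    if "integrable lborel h" for h :: "real \<Rightarrow> 'b::{banach,second_countable_topology}" and y
    using lborel_integrable_real_affine[OF that, of 1 y] lborel_integral_real_affine[of 1 h y] by (simp add: add.commute)
  have I: "integrable (lborel \<Otimes>\<^sub>M lborel) (\<lambda>(y, x). f (x + y) * g y)"
  proof (rule lborel_pair.Fubini_integrable)
    have "(\<integral>x. norm (f (x + y) * g y) \<partial>lborel) = (\<integral>x. norm (f x) \<partial>lborel) * norm (g y)" for y
      using shift[OF integrable_norm[OF f], of y] by (simp add: norm_mult)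
    then show "integrable lborel (\<lambda>y. \<integral>x. norm (case (y, x) of (y, x) \<Rightarrow> f (x + y) * g y) \<partial>lborel)"
      using integrable_norm[OF g] by simp
    show "AE y in lborel. integrable lborel (\<lambda>x. case (y, x) of (y, x) \<Rightarrow> f (x + y) * g y)"
      using shift[OF f] by (auto intro!: AE_I2 integrable_mult_left)
  qed measurable
  have I2: "integrable (lborel \<Otimes>\<^sub>M lborel) (\<lambda>(x, y). f (x + y) * g y)"
    using lborel_pair.integrable_product_swap[OF I] by (simp add: case_prod_beta)
  from lborel_pair.integrable_fst'[OF I2] show "integrable lborel (\<lambda>x. \<integral>y. f (x + y) * g y \<partial>lborel)" by simp
  have J: "integrable (lborel \<Otimes>\<^sub>M lborel) (\<lambda>(y, x). cis (- (t * x)) * (f (x + y) * g y))"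
    by (rule Bochner_Integration.integrable_bound[OF I]) (auto simp: norm_mult case_prod_beta, measurable)
  have "fourier (\<lambda>x. \<integral>y. f (x + y) * g y \<partial>lborel) t = (\<integral>x. (\<integral>y. cis (- (t * x)) * (f (x + y) * g y) \<partial>lborel) \<partial>lborel)"
    unfolding fourier_def by simp
  also have "\<dots> = (\<integral>y. (\<integral>x. cis (- (t * x)) * (f (x + y) * g y) \<partial>lborel) \<partial>lborel)"
    using lborel_pair.Fubini_integral[OF J] by simp
  also have "\<dots> = (\<integral>y. fourier f t * (cis (- (- t * y)) * g y) \<partial>lborel)"
  proof (rule Bochner_Integration.integral_cong[OF refl])
    fix y
    have "(\<integral>x. cis (- (t * x)) * (f (x + y) * g y) \<partial>lborel) = (\<integral>x. (cis (- (t * (x + y))) * f (x + y)) * (cis (t * y) * g y) \<partial>lborel)"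
    proof (intro Bochner_Integration.integral_cong refl)
      fix x
      have "cis (- (t * x)) = cis (- (t * (x + y))) * cis (t * y)" by (simp add: cis_mult algebra_simps)
      then show "cis (- (t * x)) * (f (x + y) * g y) = (cis (- (t * (x + y))) * f (x + y)) * (cis (t * y) * g y)"
        by (simp only: mult_ac)
    qed
    also have "\<dots> = (\<integral>x. cis (- (t * (x + y))) * f (x + y) \<partial>lborel) * (cis (t * y) * g y)"
      by simp
    also have "(\<integral>x. cis (- (t * (x + y))) * f (x + y) \<partial>lborel) = fourier f t"
      using shift[OF integrable_cis_mult[OF f, of t], of y] by (simp add: fourier_def)
    finally show "(\<integral>x. cis (- (t * x)) * (f (x + y) * g y) \<partial>lborel) = fourier f t * (cis (- (- t * y)) * g y)" by simp
  qed
  also have "\<dots> = fourier f t * fourier g (- t)" by (simp add: fourier_def)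
  finally show "fourier (\<lambda>x. \<integral>y. f (x + y) * g y \<partial>lborel) t = fourier f t * fourier g (- t)" .
qed

section \<open>Gamma kernels and their correlations\<close>

text \<open>The gamma density of complex shape \<alpha> and rate 1/2, without its factor
  (1/2)^\<alpha>. In a correlation at x > 0 the rate 1/2 leaves exp(-x/2) outside and exp(-y) inside
  the integral, as Euler's integral demands.\<close>

definition gamma_kernel :: "complex \<Rightarrow> real \<Rightarrow> complex" where
  "gamma_kernel \<alpha> u = indicator {0<..} u *\<^sub>R (of_real (exp (- (1/2 * u))) * of_real u powr (\<alpha> - 1) * rGamma \<alpha>)"

lemma integrable_gamma_kernel: "Re \<alpha> > 0 \<Longrightarrow> integrable lborel (gamma_kernel \<alpha>)"
proof -
  assume "Re \<alpha> > 0"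
  then have "set_integrable lborel {0<..} (\<lambda>u. of_real (exp (- (1/2 * u))) * complex_of_real u powr (\<alpha> - 1) * rGamma \<alpha>)"
    by (intro set_integrable_mult_left set_integrable_cpowr_exp) auto
  then show ?thesis by (simp add: set_integrable_def gamma_kernel_def[abs_def])
qed

lemma of_real_mult_gamma_kernel: "of_real u * gamma_kernel \<alpha> u = \<alpha> * gamma_kernel (\<alpha> + 1) u"
proof (cases "u > 0")
  case True
  have "of_real u * complex_of_real u powr (\<alpha> - 1) = of_real u powr (\<alpha> + 1 - 1)"
    using True powr_add[of "complex_of_real u" 1 "\<alpha> - 1"] by simp
  moreover have "rGamma \<alpha> = \<alpha> * rGamma (\<alpha> + 1)" by (simp add: rGamma_plus1)
  moreover have "u' * (E * P * R) = \<alpha> * (E * P' * R')" if "u' * P = P'" "R = \<alpha> * R'" for u' E P R P' R' :: complex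
    unfolding that(2) that(1)[symmetric] by (simp add: mult_ac)
  ultimately have "of_real u * (of_real (exp (- (1/2 * u))) * complex_of_real u powr (\<alpha> - 1) * rGamma \<alpha>) = \<alpha> * (of_real (exp (- (1/2 * u))) * of_real u powr (\<alpha> + 1 - 1) * rGamma (\<alpha> + 1))"
    by blast
  moreover have ind: "indicator {0<..} u = (1::real)" using True by simp
  ultimately show ?thesis unfolding gamma_kernel_def ind scaleR_one by simp
qed (simp add: gamma_kernel_def)

text \<open>Integrate the derivative of exp(-z u) u^\<alpha> / Gamma(\<alpha> + 1) with z = 1/2 + i
  t; the boundary values vanish since Re \<alpha> > 0 and Re z > 0.\<close>

lemma fourier_gamma_kernel_succ:
  assumes a: "Re \<alpha> > 0"
  shows "(1/2 + \<i> * of_real t) * fourier (gamma_kernel (\<alpha> + 1)) t = fourier (gamma_kernel \<alpha>) t"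
proof -
  define z where "z = 1/2 + \<i> * of_real t"
  have e: "cis (- (t * u)) * (indicator {0<..} u *\<^sub>R (of_real (exp (- (1/2 * u))) * P * R)) = indicator {0<..} u *\<^sub>R (exp (- z * of_real u) * P * R)" for u P R
  proof -
    have "cis (- (t * u)) * of_real (exp (- (1/2 * u))) = exp (- z * of_real u)"
      by (simp add: z_def cis_conv_exp exp_add[symmetric] algebra_simps flip: exp_of_real)
         (rule arg_cong[where f=exp], simp)
    then show ?thesis by (simp flip: mult.assoc)
  qed
  have fk: "fourier (gamma_kernel c) t = (LBINT u:{0<..}. exp (- z * of_real u) * of_real u powr (c - 1) * rGamma c)" for c
    unfolding fourier_def set_lebesgue_integral_def gamma_kernel_def e ..
  have int: "set_integrable lborel {0<..} (\<lambda>u. exp (- z * of_real u) * of_real u powr (c - 1) * rGamma c)" if "Re c > 0" for c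
  proof -
    have "integrable lborel (\<lambda>u. cis (- (t * u)) * gamma_kernel c u)"
      by (intro integrable_cis_mult integrable_gamma_kernel that)
    moreover have "(\<lambda>u. cis (- (t * u)) * gamma_kernel c u) = (\<lambda>u. indicator {0<..} u *\<^sub>R (exp (- z * of_real u) * of_real u powr (c - 1) * rGamma c))"
      unfolding gamma_kernel_def e ..
    ultimately show ?thesis unfolding set_integrable_def by simp
  qed
  have rg: "rGamma \<alpha> = \<alpha> * rGamma (\<alpha> + 1)" by (simp add: rGamma_plus1)
  define G where "G = (\<lambda>u. exp (- z * complex_of_real u) * of_real u powr \<alpha> * rGamma (\<alpha> + 1))"
  have nG: "norm (G u) = exp (- (u / 2)) * u powr Re \<alpha> * norm (rGamma (\<alpha> + 1))" if "u > 0" for u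
    using that by (simp add: G_def norm_mult norm_cpowr z_def)
  have "(LBINT u:{0<..}. exp (- z * of_real u) * of_real u powr (\<alpha> - 1) * rGamma \<alpha> - z * (exp (- z * of_real u) * of_real u powr (\<alpha> + 1 - 1) * rGamma (\<alpha> + 1))) = 0 - 0"
  proof (rule set_integral_FTC_Ioi[where F=G])
    fix u :: real assume u: "u > 0"
    have i: "(complex_of_real has_vector_derivative 1) (at u)"
      using has_vector_derivative_of_real[OF DERIV_ident] by simp
    have "((\<lambda>w. exp (- z * w)) has_field_derivative exp (- z * of_real u) * (- z * 1)) (at (of_real u))"
      by (auto intro!: derivative_eq_intros)
    from field_vector_diff_chain_at[OF i this]
    have E: "((\<lambda>u. exp (- z * complex_of_real u)) has_vector_derivative - z * exp (- z * of_real u)) (at u)"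
      by (simp add: o_def mult_ac)
    from has_vector_derivative_mult_left[OF has_vector_derivative_mult[OF E has_vector_derivative_cpowr[OF u, of \<alpha>]], of "rGamma (\<alpha> + 1)"]
    have "(G has_vector_derivative (exp (- z * of_real u) * (\<alpha> * of_real u powr (\<alpha> - 1)) + - z * exp (- z * of_real u) * of_real u powr \<alpha>) * rGamma (\<alpha> + 1)) (at u)"
      by (simp only: G_def)
    also have "(exp (- z * of_real u) * (\<alpha> * of_real u powr (\<alpha> - 1)) + - z * exp (- z * of_real u) * of_real u powr \<alpha>) * rGamma (\<alpha> + 1)
      = exp (- z * of_real u) * of_real u powr (\<alpha> - 1) * rGamma \<alpha> - z * (exp (- z * of_real u) * of_real u powr (\<alpha> + 1 - 1) * rGamma (\<alpha> + 1))"
      unfolding rg by (simp add: algebra_simps)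
    finally show "(G has_vector_derivative exp (- z * of_real u) * of_real u powr (\<alpha> - 1) * rGamma \<alpha> - z * (exp (- z * of_real u) * of_real u powr (\<alpha> + 1 - 1) * rGamma (\<alpha> + 1))) (at u)" .
    have p: "isCont (\<lambda>u. complex_of_real u powr c) u" for c
      using has_vector_derivative_cpowr[OF u] by (rule has_vector_derivative_continuous)
    have e: "isCont (\<lambda>u. exp (- z * complex_of_real u)) u"
      using E by (rule has_vector_derivative_continuous)
    show "isCont (\<lambda>u. exp (- z * of_real u) * of_real u powr (\<alpha> - 1) * rGamma \<alpha> - z * (exp (- z * of_real u) * of_real u powr (\<alpha> + 1 - 1) * rGamma (\<alpha> + 1))) u"
      by (intro continuous_diff continuous_mult continuous_const p e)
  next
    show "set_integrable lborel {0<..} (\<lambda>u. exp (- z * of_real u) * of_real u powr (\<alpha> - 1) * rGamma \<alpha> - z * (exp (- z * of_real u) * of_real u powr (\<alpha> + 1 - 1) * rGamma (\<alpha> + 1)))"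
      using a by (intro set_integral_diff set_integrable_mult_right int) auto
    show "(G \<longlongrightarrow> 0) (at_right 0)"
    proof (rule Lim_null_comparison)
      show "\<forall>\<^sub>F u in at_right 0. norm (G u) \<le> exp (- (u / 2)) * u powr Re \<alpha> * norm (rGamma (\<alpha> + 1))"
        by (rule eventually_at_right_less[THEN eventually_mono]) (simp add: nG)
      have "((\<lambda>u. exp (- (u / 2)) * u powr Re \<alpha>) \<longlongrightarrow> 0) (at_right 0)" using a by real_asymp
      then show "((\<lambda>u. exp (- (u / 2)) * u powr Re \<alpha> * norm (rGamma (\<alpha> + 1))) \<longlongrightarrow> 0) (at_right 0)"
        by (rule tendsto_mult_left_zero)
    qed
    show "(G \<longlongrightarrow> 0) at_top"
    proof (rule Lim_null_comparison)
      show "\<forall>\<^sub>F u in at_top. norm (G u) \<le> exp (- (u / 2)) * u powr Re \<alpha> * norm (rGamma (\<alpha> + 1))"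
        by (rule eventually_gt_at_top[of 0, THEN eventually_mono]) (simp add: nG)
      have "((\<lambda>u. exp (- (u / 2)) * u powr Re \<alpha>) \<longlongrightarrow> 0) at_top" using a by real_asymp
      then show "((\<lambda>u. exp (- (u / 2)) * u powr Re \<alpha> * norm (rGamma (\<alpha> + 1))) \<longlongrightarrow> 0) at_top"
        by (rule tendsto_mult_left_zero)
    qed
  qed
  moreover have "(LBINT u:{0<..}. exp (- z * of_real u) * of_real u powr (\<alpha> - 1) * rGamma \<alpha> - z * (exp (- z * of_real u) * of_real u powr (\<alpha> + 1 - 1) * rGamma (\<alpha> + 1)))
     = fourier (gamma_kernel \<alpha>) t - z * fourier (gamma_kernel (\<alpha> + 1)) t"
    unfolding fk using a int[of \<alpha>] int[of "\<alpha> + 1"]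
    by (subst set_integral_diff(2)) (auto intro!: set_integrable_mult_right)
  ultimately show ?thesis by (simp add: z_def)
qed

text \<open>Both \<open>fourier (gamma_kernel \<alpha>)\<close> and \<open>(1/2 + i t) powr (- \<alpha>)\<close> solve the same first order equation in \<open>t\<close>.\<close>
lemma fourier_gamma_kernel:
  assumes a: "Re \<alpha> > 0"
  shows "fourier (gamma_kernel \<alpha>) t = (1/2 + \<i> * of_real t) powr (- \<alpha>)"
proof -
  let ?z = "\<lambda>t. 1/2 + \<i> * complex_of_real t"
  define H where "H = (\<lambda>t. fourier (gamma_kernel \<alpha>) t * ?z t powr \<alpha>)"
  have zn: "?z t \<notin> \<real>\<^sub>\<le>\<^sub>0" "?z t \<noteq> 0" for t
    by (auto simp: complex_nonpos_Reals_iff complex_eq_iff)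
  have "(H has_vector_derivative 0) (at t)" for t
  proof -
    have d1: "(fourier (gamma_kernel \<alpha>) has_vector_derivative - \<i> * (\<alpha> * fourier (gamma_kernel (\<alpha> + 1)) t)) (at t)"
      using has_vector_derivative_fourier[OF integrable_gamma_kernel[OF a]] integrable_gamma_kernel[of "\<alpha> + 1"] a
      unfolding of_real_mult_gamma_kernel by (simp add: fourier_mult)
    have i: "(?z has_vector_derivative \<i>) (at t)"
    proof -
      have "(complex_of_real has_vector_derivative 1) (at t)"
        using has_vector_derivative_of_real[OF DERIV_ident] by simp
      then have "(?z has_vector_derivative 0 + \<i> * 1) (at t)"
        by (intro has_vector_derivative_add has_vector_derivative_const has_vector_derivative_mult_right)
      then show ?thesis by simp
    qed
    from field_vector_diff_chain_at[OF i has_field_derivative_powr[OF zn(1)]]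
    have d2: "((\<lambda>t. ?z t powr \<alpha>) has_vector_derivative \<i> * (\<alpha> * ?z t powr (\<alpha> - 1))) (at t)"
      by (simp add: o_def)
    have "(H has_vector_derivative fourier (gamma_kernel \<alpha>) t * (\<i> * (\<alpha> * ?z t powr (\<alpha> - 1))) + - \<i> * (\<alpha> * fourier (gamma_kernel (\<alpha> + 1)) t) * ?z t powr \<alpha>) (at t)"
      unfolding H_def by (rule has_vector_derivative_mult[OF d1 d2])
    also have "fourier (gamma_kernel \<alpha>) t * (\<i> * (\<alpha> * ?z t powr (\<alpha> - 1))) + - \<i> * (\<alpha> * fourier (gamma_kernel (\<alpha> + 1)) t) * ?z t powr \<alpha> = 0"
    proof -
      have p: "?z t powr \<alpha> = ?z t * ?z t powr (\<alpha> - 1)"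
        using zn[of t] powr_add[of "?z t" 1 "\<alpha> - 1"] by simp
      show ?thesis
        unfolding p fourier_gamma_kernel_succ[OF a, symmetric] by (simp add: mult_ac)
    qed
    finally show ?thesis .
  qed
  then have "(H has_derivative (\<lambda>h. 0)) (at y within UNIV)" for y
    by (simp add: has_vector_derivative_def)
  then obtain c where c: "\<And>y. H y = c"
    using has_derivative_zero_constant[of UNIV H] by auto
  have "H 0 = 1"
  proof -
    have "fourier (gamma_kernel \<alpha>) 0 = (LBINT u:{0<..}. of_real (exp (- (1/2 * u))) * of_real u powr (\<alpha> - 1) * rGamma \<alpha>)"
      unfolding fourier_def gamma_kernel_def set_lebesgue_integral_def by simp
    also have "\<dots> = Gamma \<alpha> * of_real (1/2) powr (- \<alpha>) * rGamma \<alpha>"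
      using set_integral_cpowr_exp[OF a, of "1/2"] by (simp only: set_integral_mult_left)
    finally have "H 0 = Gamma \<alpha> * rGamma \<alpha> * ((1/2) powr (- \<alpha>) * (1/2) powr \<alpha>)"
      by (simp add: H_def mult_ac)
    also have "(1/2) powr (- \<alpha>) * (1/2) powr \<alpha> = (1 :: complex)" by (simp flip: powr_add)
    also have "Gamma \<alpha> * rGamma \<alpha> = 1"
    proof -
      have "Gamma \<alpha> \<noteq> 0"
        using a complex_nonpos_Reals_iff nonpos_Ints_subset_nonpos_Reals by (fastforce simp: Gamma_eq_zero_iff)
      then show ?thesis by (simp add: rGamma_inverse_Gamma)
    qed
    finally show ?thesis by simp
  qed
  with c have "H t = 1" by metis
  then show ?thesis
    using zn[of t] by (simp add: H_def powr_minus field_simps)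
qed

definition gamma_correlation :: "complex \<Rightarrow> complex \<Rightarrow> real \<Rightarrow> complex" where
  "gamma_correlation \<alpha> \<beta> x = (\<integral>y. gamma_kernel \<alpha> (x + y) * gamma_kernel \<beta> y \<partial>lborel)"

lemma gamma_correlation_minus: "gamma_correlation \<alpha> \<beta> (- x) = gamma_correlation \<beta> \<alpha> x"
  using lborel_integral_real_affine[of 1 "\<lambda>y. gamma_kernel \<alpha> (- x + y) * gamma_kernel \<beta> y" x]
  by (simp add: gamma_correlation_def mult.commute)

text \<open>The substitution y = x v extracts x^(\<alpha> + \<beta> - 1) and leaves Euler's integral
  with first parameter \<beta>, the exponent of 1 + v being \<alpha> - 1.\<close>

lemma gamma_correlation_pos:
  assumes x: "x > 0"
  shows "gamma_correlation \<alpha> \<beta> x = of_real (exp (- x / 2)) * of_real x powr (\<alpha> + \<beta> - 1) * tricomi_integral \<beta> (\<alpha> + \<beta>) x * rGamma \<alpha> * rGamma \<beta>"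
proof -
  let ?h = "\<lambda>y. gamma_kernel \<alpha> (x + y) * (of_real (exp (- (1/2 * y))) * of_real y powr (\<beta> - 1) * rGamma \<beta>)"
  have "gamma_correlation \<alpha> \<beta> x = (LBINT y:{0<..}. ?h y)"
    unfolding gamma_correlation_def set_lebesgue_integral_def gamma_kernel_def[of \<beta>] by (simp add: mult_ac)
  also have "\<dots> = x * (LBINT v:{0<..}. ?h (x * v))"
    by (rule set_integral_scale[OF x])
  also have "(LBINT v:{0<..}. ?h (x * v)) = (LBINT v:{0<..}. (of_real (exp (- x / 2)) * of_real x powr (\<alpha> + \<beta> - 2) * rGamma \<alpha> * rGamma \<beta>) * tricomi_integrand \<beta> (\<alpha> + \<beta>) x v)"
  proof (intro set_lebesgue_integral_cong allI impI)
    fix v :: real assume "v \<in> {0<..}" then have v: "v > 0" by simp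
    have ind: "indicator {0<..} (x + x * v) = (1::real)" using x v by (simp add: add_pos_pos)
    have 1: "complex_of_real (x + x * v) powr (\<alpha> - 1) = of_real x powr (\<alpha> - 1) * of_real (1 + v) powr (\<alpha> - 1)"
    proof -
      have "complex_of_real (x + x * v) = of_real x * of_real (1 + v)" by (simp add: algebra_simps)
      then show ?thesis using x v by (simp only:) (rule powr_times_real, auto)
    qed
    have 2: "complex_of_real (x * v) powr (\<beta> - 1) = of_real x powr (\<beta> - 1) * of_real v powr (\<beta> - 1)"
      using x v by (simp add: powr_times_real)
    have 3: "complex_of_real (exp (- (1/2 * (x + x * v)))) * of_real (exp (- (1/2 * (x * v)))) = of_real (exp (- x / 2)) * of_real (exp (- (x * v)))"
      by (simp only: of_real_mult[symmetric] exp_add[symmetric]) (simp add: algebra_simps)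
    have 4: "complex_of_real x powr (\<alpha> - 1) * of_real x powr (\<beta> - 1) = of_real x powr (\<alpha> + \<beta> - 2)"
      by (simp only: powr_add[symmetric]) (simp add: algebra_simps)
    have 5: "\<alpha> + \<beta> - \<beta> - 1 = \<alpha> - 1" by simp
    have gen: "(E1 * (X1 * V1) * R) * (E2 * (X2 * V2) * S) = (E3 * X * R * S) * (E4 * V2 * V1)"
      if "E1 * E2 = E3 * E4" "X1 * X2 = X" for E1 E2 E3 E4 X1 X2 X V1 V2 R S :: complex
      unfolding that(2)[symmetric] using arg_cong[OF that(1), of "\<lambda>E. E * (X1 * X2 * R * S * V1 * V2)"] by (simp add: mult_ac)
    show "?h (x * v) = (of_real (exp (- x / 2)) * of_real x powr (\<alpha> + \<beta> - 2) * rGamma \<alpha> * rGamma \<beta>) * tricomi_integrand \<beta> (\<alpha> + \<beta>) x v"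
      unfolding gamma_kernel_def ind scaleR_one tricomi_integrand_def 1 2 5 by (rule gen[OF 3 4])
  qed auto
  also have "\<dots> = (of_real (exp (- x / 2)) * of_real x powr (\<alpha> + \<beta> - 2) * rGamma \<alpha> * rGamma \<beta>) * tricomi_integral \<beta> (\<alpha> + \<beta>) x"
    by (simp add: tricomi_integral_def)
  finally have "gamma_correlation \<alpha> \<beta> x = of_real (exp (- x / 2)) * (of_real x * of_real x powr (\<alpha> + \<beta> - 2)) * tricomi_integral \<beta> (\<alpha> + \<beta>) x * rGamma \<alpha> * rGamma \<beta>"
    by (simp add: mult_ac)
  also have "of_real x * of_real x powr (\<alpha> + \<beta> - 2) = complex_of_real x powr (\<alpha> + \<beta> - 1)"
    using x powr_add[of "complex_of_real x" 1 "\<alpha> + \<beta> - 2"] by simp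
  finally show ?thesis .
qed

lemma laguerre_half_eq_correlation:
  assumes "Re \<beta> > 0" "Re (\<alpha> + \<beta>) = 1" "x > 0"
  shows "laguerre_half \<alpha> \<beta> x = gamma_correlation \<alpha> \<beta> x"
  using assms by (simp add: gamma_correlation_pos laguerre_half_def tricomi_U_eq_integral mult_ac)

text \<open>At the parameters \<alpha> - 1, \<beta> + 1 the first kernel is not integrable when 0 <
  Re \<alpha> < 1, so the function is written as a difference of two correlations with integrable
  kernels. On the transform side this is A = 1 - B for A = 1/2 + i t and B = 1/2 - i t.\<close>

lemma laguerre_half_shift_right:
  assumes b: "Re \<beta> > 0" and ab: "Re (\<alpha> + \<beta>) = 1" and x: "x > 0"
  shows "laguerre_half (\<alpha> - 1) (\<beta> + 1) x = gamma_correlation \<alpha> (\<beta> + 1) x - gamma_correlation \<alpha> \<beta> x"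
proof -
  define E where "E = of_real (exp (- x / 2)) * complex_of_real x powr (\<alpha> + \<beta> - 1)"
  define K where "K = tricomi_integral"
  have p: "complex_of_real x powr (\<alpha> + (\<beta> + 1) - 1) = of_real x * complex_of_real x powr (\<alpha> + \<beta> - 1)"
    using x powr_add[of "complex_of_real x" 1 "\<alpha> + \<beta> - 1"] by (simp add: add.assoc)
  have e: "\<alpha> - 1 + (\<beta> + 1) = \<alpha> + \<beta>" by simp
  have 1: "laguerre_half (\<alpha> - 1) (\<beta> + 1) x = E * (rGamma (\<beta> + 1) * K (\<beta> + 1) (\<alpha> + \<beta>) x) * ((\<alpha> - 1) * rGamma \<alpha>)"
    using b ab x rGamma_plus1[of "\<alpha> - 1"] unfolding laguerre_half_def e E_def K_def by (simp add: tricomi_U_eq_integral)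
  have 2: "gamma_correlation \<alpha> (\<beta> + 1) x = E * of_real x * K (\<beta> + 1) (\<alpha> + \<beta> + 1) x * rGamma \<alpha> * rGamma (\<beta> + 1)"
    unfolding gamma_correlation_pos[OF x] p E_def K_def by (simp add: mult_ac add.assoc)
  have 3: "gamma_correlation \<alpha> \<beta> x = E * K \<beta> (\<alpha> + \<beta>) x * rGamma \<alpha> * (\<beta> * rGamma (\<beta> + 1))"
    unfolding gamma_correlation_pos[OF x] E_def K_def rGamma_plus1 by (simp add: mult_ac)
  have "of_real x * K (\<beta> + 1) (\<alpha> + \<beta> + 1) x = \<beta> * K \<beta> (\<alpha> + \<beta>) x + (\<alpha> + \<beta> - \<beta> - 1) * K (\<beta> + 1) (\<alpha> + \<beta>) x"
    using tricomi_integral_by_parts[OF b x, of "\<alpha> + \<beta>"] unfolding K_def .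
  then show ?thesis unfolding 1 2 3 by algebra
qed

text \<open>The same decomposition seen from the negative half line.\<close>

lemma laguerre_half_shift_left:
  assumes a: "Re \<alpha> > 0" and ab: "Re (\<beta> + \<alpha>) = 1" and x: "x > 0"
  shows "laguerre_half (\<beta> + 1) (\<alpha> - 1) x = gamma_correlation (\<beta> + 1) \<alpha> x - gamma_correlation \<beta> \<alpha> x"
proof -
  define E where "E = of_real (exp (- x / 2)) * complex_of_real x powr (\<beta> + \<alpha> - 1)"
  define K where "K = tricomi_integral"
  let ?b = "\<beta> + \<alpha>"
  have p: "complex_of_real x powr (\<beta> + 1 + \<alpha> - 1) = of_real x * complex_of_real x powr (\<beta> + \<alpha> - 1)"
    using x powr_add[of "complex_of_real x" 1 "\<beta> + \<alpha> - 1"] by (simp add: algebra_simps)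
  have e: "\<beta> + 1 + (\<alpha> - 1) = ?b" "\<beta> + 1 + \<alpha> = ?b + 1" by simp_all
  \<comment> \<open>The parameter \<alpha> - 1 can have negative real part, out of reach of the
    integral; the recurrence replaces it by \<alpha> and \<alpha> + 1.\<close>
  have u: "tricomi_U (\<alpha> - 1) ?b (of_real x) = - ((?b - 2 * \<alpha> - of_real x) * (rGamma \<alpha> * K \<alpha> ?b x) + (\<alpha> - ?b + 1) * (rGamma \<alpha> * K (\<alpha> + 1) ?b x))"
  proof -
    have "\<alpha> * rGamma (\<alpha> + 1) = rGamma \<alpha>" by (rule rGamma_plus1)
    moreover have "tricomi_U \<alpha> ?b (of_real x) = rGamma \<alpha> * K \<alpha> ?b x" "tricomi_U (\<alpha> + 1) ?b (of_real x) = rGamma (\<alpha> + 1) * K (\<alpha> + 1) ?b x"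
      using a ab x unfolding K_def by (auto intro!: tricomi_U_eq_integral)
    moreover have "U0 = - (c * (g * k) + d * (g * k1))" if "a * r = g" "U1 = g * k" "U2 = r * k1" "U0 + c * U1 + a * d * U2 = 0"
      for U0 U1 U2 a c d g k k1 r :: complex
      using that(4) unfolding that(2,3) that(1)[symmetric] eq_neg_iff_add_eq_0 by (simp add: algebra_simps)
    ultimately show ?thesis using tricomi_U_recurrence[OF ab x, of \<alpha>] by blast
  qed
  have 1: "laguerre_half (\<beta> + 1) (\<alpha> - 1) x = E * tricomi_U (\<alpha> - 1) ?b (of_real x) * rGamma (\<beta> + 1)"
    unfolding laguerre_half_def e E_def by simp
  have 2: "gamma_correlation (\<beta> + 1) \<alpha> x = E * of_real x * K \<alpha> (?b + 1) x * rGamma (\<beta> + 1) * rGamma \<alpha>"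
    unfolding gamma_correlation_pos[OF x] p unfolding e E_def K_def by (simp add: mult_ac)
  have 3: "gamma_correlation \<beta> \<alpha> x = E * K \<alpha> ?b x * (\<beta> * rGamma (\<beta> + 1)) * rGamma \<alpha>"
    unfolding gamma_correlation_pos[OF x] E_def K_def rGamma_plus1 by (simp add: mult_ac)
  have 4: "of_real x * K (\<alpha> + 1) (?b + 1) x = \<alpha> * K \<alpha> ?b x + (?b - \<alpha> - 1) * K (\<alpha> + 1) ?b x"
    using tricomi_integral_by_parts[OF a x, of ?b] unfolding K_def .
  have 5: "K \<alpha> (?b + 1) x = K \<alpha> ?b x + K (\<alpha> + 1) (?b + 1) x"
    using tricomi_integral_add[OF a x, of ?b] unfolding K_def .
  show ?thesis unfolding 1 2 3 u 5 using 4 by algebra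
qed

section \<open>Integrability of the Laguerre functions\<close>

lemma integrable_abs:
  fixes g :: "real \<Rightarrow> real"
  assumes "set_integrable lborel {0<..} g"
  shows "integrable lborel (\<lambda>x. indicator (- {0}) x *\<^sub>R g \<bar>x\<bar>)"
proof -
  have 1: "integrable lborel (\<lambda>x. indicator {0<..} x *\<^sub>R g x)"
    using assms by (simp add: set_integrable_def)
  from lborel_integrable_real_affine[OF 1, of "-1" 0]
  have "integrable lborel (\<lambda>x. indicator {0<..} (- x) *\<^sub>R g (- x))" by simp
  from Bochner_Integration.integrable_add[OF 1 this] show ?thesis
    by (rule Bochner_Integration.integrable_cong[THEN iffD1, OF refl, rotated]) (auto simp: indicator_def)
qed

lemma integrable_abs_powr_exp:
  assumes "p > 0" "c > 0"
  shows "integrable lborel (\<lambda>x::real. \<bar>x\<bar> powr (p - 1) * exp (- (c * \<bar>x\<bar>)))"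
  using integrable_abs[OF set_integrable_powr_exp[OF assms]]
  by (rule Bochner_Integration.integrable_cong[THEN iffD1, OF refl, rotated]) (auto simp: indicator_def)

lemma borel_measurable_isCont_except_0:
  assumes "\<And>x. x \<noteq> 0 \<Longrightarrow> isCont f x"
  shows "(f :: real \<Rightarrow> complex) \<in> borel_measurable borel"
proof -
  have c: "continuous_on (- {0}) f"
    using assms by (intro continuous_at_imp_continuous_on) auto
  have "(\<lambda>x. if x \<in> - {0} then f x else f 0) \<in> borel_measurable borel"
    by (rule borel_measurable_continuous_on_if[OF _ c]) (auto intro: continuous_on_const)
  also have "(\<lambda>x. if x \<in> - {0} then f x else f 0) = f" by auto
  finally show ?thesis .
qed

lemma laguerre_fun_measurable [measurable]: "laguerre_fun \<rho> s \<in> borel_measurable borel"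
  by (rule borel_measurable_isCont_except_0) (rule isCont_laguerre_fun)

lemma
  shows integrable_laguerre_fun: "integrable lborel (laguerre_fun \<rho> s)"
    and integrable_mult_laguerre_fun: "integrable lborel (\<lambda>x. of_real x * laguerre_fun \<rho> s x)"
    and integrable_laguerre_fun_sq: "integrable lborel (\<lambda>x. (norm (laguerre_fun \<rho> s x))\<^sup>2)"
proof -
  obtain C where C: "C \<ge> 0" "\<And>x. (1 + \<bar>x\<bar>) * norm (laguerre_fun \<rho> s x) \<le> C * (\<bar>x\<bar> powr (-1/4) * exp (- (\<bar>x\<bar> / 4)))"
    using laguerre_fun_bound[of "\<bar>s\<bar>" \<rho>] by blast
  have w: "integrable lborel (\<lambda>x::real. C * (\<bar>x\<bar> powr (-1/4) * exp (- (\<bar>x\<bar> / 4))))"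
    using integrable_abs_powr_exp[of "3/4" "1/4"] by simp
  have b1: "norm (laguerre_fun \<rho> s x) \<le> C * (\<bar>x\<bar> powr (-1/4) * exp (- (\<bar>x\<bar> / 4)))"
    and b2: "\<bar>x\<bar> * norm (laguerre_fun \<rho> s x) \<le> C * (\<bar>x\<bar> powr (-1/4) * exp (- (\<bar>x\<bar> / 4)))" for x
    using C(2)[of x] mult_nonneg_nonneg[OF abs_ge_zero[of x] norm_ge_zero[of "laguerre_fun \<rho> s x"]] norm_ge_zero[of "laguerre_fun \<rho> s x"]
    by (simp_all only: ring_distribs mult_1)
  show "integrable lborel (laguerre_fun \<rho> s)"
    by (rule Bochner_Integration.integrable_bound[OF w]) (auto intro!: AE_I2 order.trans[OF b1])
  show "integrable lborel (\<lambda>x. of_real x * laguerre_fun \<rho> s x)"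
    by (rule Bochner_Integration.integrable_bound[OF w]) (auto intro!: AE_I2 order.trans[OF b2] simp: norm_mult)
  \<comment> \<open>The square of the majorant behaves like |x|^(-1/2) at 0.\<close>
  have w2: "integrable lborel (\<lambda>x::real. C\<^sup>2 * (\<bar>x\<bar> powr (1/2 - 1) * exp (- (1/2 * \<bar>x\<bar>))))"
    by (intro integrable_mult_right integrable_abs_powr_exp) auto
  show "integrable lborel (\<lambda>x. (norm (laguerre_fun \<rho> s x))\<^sup>2)"
  proof (rule Bochner_Integration.integrable_bound[OF w2])
    show "AE x in lborel. norm ((norm (laguerre_fun \<rho> s x))\<^sup>2) \<le> norm (C\<^sup>2 * (\<bar>x\<bar> powr (1/2 - 1) * exp (- (1/2 * \<bar>x\<bar>))))"
    proof (rule AE_I2)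
      fix x :: real
      have "(norm (laguerre_fun \<rho> s x))\<^sup>2 \<le> (C * (\<bar>x\<bar> powr (-1/4) * exp (- (\<bar>x\<bar> / 4))))\<^sup>2"
        by (intro power_mono b1) auto
      also have "\<dots> = C\<^sup>2 * ((\<bar>x\<bar> powr (-1/4) * \<bar>x\<bar> powr (-1/4)) * (exp (- (\<bar>x\<bar> / 4)) * exp (- (\<bar>x\<bar> / 4))))"
        by (simp only: power2_eq_square mult_ac)
      also have "\<bar>x\<bar> powr (-1/4) * \<bar>x\<bar> powr (-1/4) = \<bar>x\<bar> powr (1/2 - 1)"
        by (simp only: powr_add[symmetric]) simp
      also have "exp (- (\<bar>x\<bar> / 4)) * exp (- (\<bar>x\<bar> / 4)) = exp (- (1/2 * \<bar>x\<bar>))"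
        by (simp only: exp_add[symmetric]) simp
      finally show "norm ((norm (laguerre_fun \<rho> s x))\<^sup>2) \<le> norm (C\<^sup>2 * (\<bar>x\<bar> powr (1/2 - 1) * exp (- (1/2 * \<bar>x\<bar>))))"
        by simp
    qed
  qed auto
qed

section \<open>The transforms and their continuation in s\<close>

definition laguerre_hat :: "real \<Rightarrow> real \<Rightarrow> real \<Rightarrow> complex" where
  "laguerre_hat \<rho> s t = (1/2 + \<i> * of_real t) powr (- Complex (1/2 - s) \<rho>) * (1/2 - \<i> * of_real t) powr (- Complex (1/2 + s) \<rho>)"

lemma laguerre_hat_minus: "laguerre_hat \<rho> (- s) (- t) = laguerre_hat \<rho> s t"
  by (simp add: laguerre_hat_def)

lemma half_plus_imag:
  "1/2 + \<i> * complex_of_real t \<notin> \<real>\<^sub>\<le>\<^sub>0" "1/2 + \<i> * complex_of_real t \<noteq> 0"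
  "1/2 - \<i> * complex_of_real t \<notin> \<real>\<^sub>\<le>\<^sub>0" "1/2 - \<i> * complex_of_real t \<noteq> 0"
  by (auto simp: complex_nonpos_Reals_iff complex_eq_iff)

text \<open>Both exponents change by an integer at a fixed base, so the principal powers change by
  exact factors of the base and no branch correction arises.\<close>

lemma laguerre_hat_shift:
  "(1/2 - \<i> * of_real t) * laguerre_hat \<rho> (s + 1) t = (1/2 + \<i> * of_real t) * laguerre_hat \<rho> s t"
proof -
  define A B where "A = 1/2 + \<i> * complex_of_real t" and "B = 1/2 - \<i> * complex_of_real t"
  have nz: "A \<noteq> 0" "B \<noteq> 0" unfolding A_def B_def by (rule half_plus_imag)+
  have "- Complex (1/2 - (s + 1)) \<rho> = 1 + - Complex (1/2 - s) \<rho>" "- Complex (1/2 + s) \<rho> = 1 + - Complex (1/2 + (s + 1)) \<rho>"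
    by (simp_all add: complex_eq_iff)
  then have "A powr (- Complex (1/2 - (s + 1)) \<rho>) = A * A powr (- Complex (1/2 - s) \<rho>)"
    "B powr (- Complex (1/2 + s) \<rho>) = B * B powr (- Complex (1/2 + (s + 1)) \<rho>)"
    using nz by (simp_all only: powr_add powr_to_1)
  then show ?thesis
    unfolding laguerre_hat_def A_def[symmetric] B_def[symmetric] by (simp add: mult_ac)
qed

text \<open>Because the bases A and B add up to 1, the sum of two neighbouring transforms collapses
  to a single product with one exponent lowered; such products are what differentiation yields. The
  result is the Fourier image of \<open>laguerre_fun_recurrence\<close>.\<close>

lemma laguerre_hat_deriv:
  "(laguerre_hat \<rho> s has_vector_derivative
     - \<i> * (Complex (1/2 - s) \<rho> * (laguerre_hat \<rho> (s - 1) t + laguerre_hat \<rho> s t)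
     - Complex (1/2 + s) \<rho> * (laguerre_hat \<rho> s t + laguerre_hat \<rho> (s + 1) t))) (at t)"
proof -
  define A B where "A = (\<lambda>t. 1/2 + \<i> * complex_of_real t)" and "B = (\<lambda>t. 1/2 - \<i> * complex_of_real t)"
  define \<alpha> \<beta> where "\<alpha> = Complex (1/2 - s) \<rho>" and "\<beta> = Complex (1/2 + s) \<rho>"
  have nn: "A t \<notin> \<real>\<^sub>\<le>\<^sub>0" "B t \<notin> \<real>\<^sub>\<le>\<^sub>0" and nz: "A t \<noteq> 0" "B t \<noteq> 0" unfolding A_def B_def by (rule half_plus_imag)+
  have i: "(complex_of_real has_vector_derivative 1) (at t)"
    using has_vector_derivative_of_real[OF DERIV_ident] by simp
  have "(A has_vector_derivative 0 + \<i> * 1) (at t)" "(B has_vector_derivative 0 - \<i> * 1) (at t)"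
    unfolding A_def B_def
    by (intro has_vector_derivative_add has_vector_derivative_diff has_vector_derivative_const has_vector_derivative_mult_right i)+
  from field_vector_diff_chain_at[OF this(1) has_field_derivative_powr[OF nn(1), of "- \<alpha>"]]
    field_vector_diff_chain_at[OF this(2) has_field_derivative_powr[OF nn(2), of "- \<beta>"]]
  have d: "((\<lambda>t. A t powr - \<alpha>) has_vector_derivative \<i> * (- \<alpha> * A t powr (- \<alpha> - 1))) (at t)"
     "((\<lambda>t. B t powr - \<beta>) has_vector_derivative - \<i> * (- \<beta> * B t powr (- \<beta> - 1))) (at t)"
    by (simp_all add: o_def)
  have h: "laguerre_hat \<rho> s = (\<lambda>t. A t powr - \<alpha> * B t powr - \<beta>)"
    by (simp add: fun_eq_iff laguerre_hat_def A_def B_def \<alpha>_def \<beta>_def)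
  have pA: "A t powr - \<alpha> = A t * A t powr (- \<alpha> - 1)" and pB: "B t powr - \<beta> = B t * B t powr (- \<beta> - 1)"
    using nz powr_add[of "A t" 1 "- \<alpha> - 1"] powr_add[of "B t" 1 "- \<beta> - 1"] by simp_all
  have s1: "B t * laguerre_hat \<rho> s t = A t * laguerre_hat \<rho> (s - 1) t"
    using laguerre_hat_shift[of t \<rho> "s - 1"] by (simp add: A_def B_def)
  have s2: "B t * laguerre_hat \<rho> (s + 1) t = A t * laguerre_hat \<rho> s t"
    using laguerre_hat_shift[of t \<rho> s] by (simp add: A_def B_def)
  have AB: "A t + B t = 1" by (simp add: A_def B_def)
  have m1: "laguerre_hat \<rho> (s - 1) t + laguerre_hat \<rho> s t = A t powr (- \<alpha> - 1) * B t powr - \<beta>"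
  proof -
    have "A t * (laguerre_hat \<rho> (s - 1) t + laguerre_hat \<rho> s t) = (A t + B t) * laguerre_hat \<rho> s t"
      unfolding ring_distribs s1 by simp
    then have "A t * (laguerre_hat \<rho> (s - 1) t + laguerre_hat \<rho> s t) = A t * (A t powr (- \<alpha> - 1) * B t powr - \<beta>)"
      unfolding AB mult_1 unfolding h pA by (simp add: mult_ac)
    then show ?thesis using nz by simp
  qed
  have m2: "laguerre_hat \<rho> s t + laguerre_hat \<rho> (s + 1) t = A t powr - \<alpha> * B t powr (- \<beta> - 1)"
  proof -
    have "B t * (laguerre_hat \<rho> s t + laguerre_hat \<rho> (s + 1) t) = (A t + B t) * laguerre_hat \<rho> s t"
      unfolding ring_distribs s2 by simp
    then have "B t * (laguerre_hat \<rho> s t + laguerre_hat \<rho> (s + 1) t) = B t * (A t powr - \<alpha> * B t powr (- \<beta> - 1))"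
      unfolding AB mult_1 unfolding h pB by (simp add: mult_ac)
    then show ?thesis using nz by simp
  qed
  have "(laguerre_hat \<rho> s has_vector_derivative A t powr - \<alpha> * (- \<i> * (- \<beta> * B t powr (- \<beta> - 1))) + \<i> * (- \<alpha> * A t powr (- \<alpha> - 1)) * B t powr - \<beta>) (at t)"
    unfolding h by (rule has_vector_derivative_mult[OF d])
  also have "A t powr - \<alpha> * (- \<i> * (- \<beta> * B t powr (- \<beta> - 1))) + \<i> * (- \<alpha> * A t powr (- \<alpha> - 1)) * B t powr - \<beta>
    = - \<i> * (\<alpha> * (A t powr (- \<alpha> - 1) * B t powr - \<beta>) - \<beta> * (A t powr - \<alpha> * B t powr (- \<beta> - 1)))"
    by (simp add: algebra_simps)
  finally show ?thesis unfolding m1 m2 \<alpha>_def[symmetric] \<beta>_def[symmetric] .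
qed

lemma fourier_cong_except_0:
  assumes "\<And>x. x \<noteq> 0 \<Longrightarrow> F x = G x" and [measurable]: "F \<in> borel_measurable borel" "G \<in> borel_measurable borel"
  shows "fourier F t = fourier G t"
  unfolding fourier_def
proof (rule integral_cong_AE)
  show "AE x in lborel. cis (- (t * x)) * F x = cis (- (t * x)) * G x"
    using AE_lborel_singleton[of 0] by eventually_elim (simp add: assms(1))
qed measurable

text \<open>A three term recurrence needs two neighbouring starting values. Only s lies in the
  strip, so s + 1 is obtained from the two shift identities.\<close>

lemma fourier_laguerre_fun_base:
  assumes s: "\<bar>s\<bar> < 1/2"
  shows "fourier (laguerre_fun \<rho> s) t = laguerre_hat \<rho> s t"
    and "fourier (laguerre_fun \<rho> (s + 1)) t = laguerre_hat \<rho> (s + 1) t"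
proof -
  define \<alpha> \<beta> where "\<alpha> = Complex (1/2 - s) \<rho>" and "\<beta> = Complex (1/2 + s) \<rho>"
  have ab: "Re \<alpha> > 0" "Re \<beta> > 0" "Re (\<alpha> + \<beta>) = 1" "Re (\<beta> + \<alpha>) = 1" using s by (auto simp: \<alpha>_def \<beta>_def)
  have e: "Complex (1/2 - (s + 1)) \<rho> = \<alpha> - 1" "Complex (1/2 + (s + 1)) \<rho> = \<beta> + 1"
    by (simp_all add: complex_eq_iff \<alpha>_def \<beta>_def)
  have int: "integrable lborel (gamma_correlation \<alpha> \<beta>)" "integrable lborel (gamma_correlation \<alpha> (\<beta> + 1))"
    unfolding gamma_correlation_def[abs_def] using ab by (intro integrable_correlation integrable_gamma_kernel; simp)+
  note [measurable] = borel_measurable_integrable[OF int(1), simplified] borel_measurable_integrable[OF int(2), simplified]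
  have f: "fourier (gamma_correlation \<alpha> \<gamma>) t = (1/2 + \<i> * of_real t) powr (- \<alpha>) * (1/2 - \<i> * of_real t) powr (- \<gamma>)" if "Re \<gamma> > 0" for \<gamma>
    using fourier_correlation[OF integrable_gamma_kernel[OF ab(1)] integrable_gamma_kernel[OF that], of t]
    by (simp add: gamma_correlation_def[abs_def] fourier_gamma_kernel ab(1) that)
  have m: "gamma_correlation \<alpha> \<gamma> x = gamma_correlation \<gamma> \<alpha> (- x)" for \<gamma> x
    using gamma_correlation_minus[of \<alpha> \<gamma> "- x"] by simp
  have "fourier (laguerre_fun \<rho> s) t = fourier (gamma_correlation \<alpha> \<beta>) t"
  proof (rule fourier_cong_except_0)
    fix x :: real assume "x \<noteq> 0"
    then show "laguerre_fun \<rho> s x = gamma_correlation \<alpha> \<beta> x"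
      unfolding laguerre_fun_def \<alpha>_def[symmetric] \<beta>_def[symmetric]
      using laguerre_half_eq_correlation[of \<beta> \<alpha> x] laguerre_half_eq_correlation[of \<alpha> \<beta> "- x"] ab m[of \<beta> x] by auto
  qed measurable
  then show "fourier (laguerre_fun \<rho> s) t = laguerre_hat \<rho> s t"
    using f[OF ab(2)] by (simp add: laguerre_hat_def \<alpha>_def \<beta>_def)
  have "fourier (laguerre_fun \<rho> (s + 1)) t = fourier (\<lambda>x. gamma_correlation \<alpha> (\<beta> + 1) x - gamma_correlation \<alpha> \<beta> x) t"
  proof (rule fourier_cong_except_0)
    fix x :: real assume "x \<noteq> 0"
    then show "laguerre_fun \<rho> (s + 1) x = gamma_correlation \<alpha> (\<beta> + 1) x - gamma_correlation \<alpha> \<beta> x"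
      unfolding laguerre_fun_def e
      using laguerre_half_shift_right[of \<beta> \<alpha> x] laguerre_half_shift_left[of \<alpha> \<beta> "- x"] ab m[of \<beta> x] m[of "\<beta> + 1" x]
      by (auto simp: add.commute)
  qed measurable
  also have "\<dots> = fourier (gamma_correlation \<alpha> (\<beta> + 1)) t - fourier (gamma_correlation \<alpha> \<beta>) t"
    using int by (intro fourier_diff)
  also have "\<dots> = laguerre_hat \<rho> (s + 1) t"
  proof -
    define A B where "A = 1/2 + \<i> * complex_of_real t" and "B = 1/2 - \<i> * complex_of_real t"
    have nz: "A \<noteq> 0" "B \<noteq> 0" unfolding A_def B_def by (rule half_plus_imag)+
    have "A powr (- (\<alpha> - 1)) = A * A powr (- \<alpha>)"
      using nz powr_add[of A 1 "- \<alpha>"] by simp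
    moreover have "B powr (- \<beta>) = B * B powr (- (\<beta> + 1))"
      using nz powr_add[of B 1 "- (\<beta> + 1)"] by simp
    moreover have "B = 1 - A" by (simp add: A_def B_def)
    moreover have "P * Q1 - P * Q = P1 * Q1" if "P1 = A * P" "Q = B * Q1" "B = 1 - A" for P Q P1 Q1
      unfolding that by (simp add: algebra_simps)
    moreover have "fourier (gamma_correlation \<alpha> (\<beta> + 1)) t = A powr (- \<alpha>) * B powr (- (\<beta> + 1))"
      "fourier (gamma_correlation \<alpha> \<beta>) t = A powr (- \<alpha>) * B powr (- \<beta>)"
      using f[of "\<beta> + 1"] f[of \<beta>] ab unfolding A_def B_def by auto
    ultimately show ?thesis
      unfolding laguerre_hat_def e A_def[symmetric] B_def[symmetric] by metis
  qed
  finally show "fourier (laguerre_fun \<rho> (s + 1)) t = laguerre_hat \<rho> (s + 1) t" .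
qed

text \<open>The transform of x times \<open>laguerre_fun\<close> is known twice, by differentiating
  the transform and by the recurrence. Comparison determines the value at s + 1, whose coefficient
  \<beta> has real part 1/2 + s > 0.\<close>

lemma fourier_laguerre_fun_step:
  assumes s: "s > -1/2" and f: "\<And>t. fourier (laguerre_fun \<rho> s) t = laguerre_hat \<rho> s t"
    and f1: "\<And>t. fourier (laguerre_fun \<rho> (s - 1)) t = laguerre_hat \<rho> (s - 1) t"
  shows "fourier (laguerre_fun \<rho> (s + 1)) t = laguerre_hat \<rho> (s + 1) t"
proof -
  define \<alpha> \<beta> where "\<alpha> = Complex (1/2 - s) \<rho>" and "\<beta> = Complex (1/2 + s) \<rho>"
  have b: "\<beta> \<noteq> 0" using s by (auto simp: \<beta>_def complex_eq_iff)
  note I = integrable_laguerre_fun integrable_mult_right Bochner_Integration.integrable_add Bochner_Integration.integrable_diff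
  have "(laguerre_hat \<rho> s has_vector_derivative - \<i> * fourier (\<lambda>x. of_real x * laguerre_fun \<rho> s x) t) (at t)"
  proof -
    have "fourier (laguerre_fun \<rho> s) = laguerre_hat \<rho> s" using f by (simp add: fun_eq_iff)
    with has_vector_derivative_fourier[OF integrable_laguerre_fun integrable_mult_laguerre_fun, of \<rho> s t] show ?thesis by metis
  qed
  from vector_derivative_unique_at[OF this laguerre_hat_deriv]
  have "fourier (\<lambda>x. of_real x * laguerre_fun \<rho> s x) t = \<alpha> * (laguerre_hat \<rho> (s - 1) t + laguerre_hat \<rho> s t) - \<beta> * (laguerre_hat \<rho> s t + laguerre_hat \<rho> (s + 1) t)"
    by (simp add: \<alpha>_def \<beta>_def)
  moreover have "fourier (\<lambda>x. of_real x * laguerre_fun \<rho> s x) t = \<alpha> * (fourier (laguerre_fun \<rho> (s - 1)) t + fourier (laguerre_fun \<rho> s) t) - \<beta> * (fourier (laguerre_fun \<rho> s) t + fourier (laguerre_fun \<rho> (s + 1)) t)"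
    unfolding laguerre_fun_recurrence \<alpha>_def[symmetric] \<beta>_def[symmetric]
    by (simp add: fourier_diff fourier_mult fourier_add I)
  ultimately have "\<beta> * fourier (laguerre_fun \<rho> (s + 1)) t = \<beta> * laguerre_hat \<rho> (s + 1) t"
    unfolding f f1 by (simp add: ring_distribs)
  then show ?thesis using b by simp
qed

lemma fourier_laguerre_fun_nonneg:
  assumes s: "\<bar>s\<bar> < 1/2"
  shows "fourier (laguerre_fun \<rho> (s + real n)) t = laguerre_hat \<rho> (s + real n) t"
proof -
  have "(\<forall>t. fourier (laguerre_fun \<rho> (s + real n)) t = laguerre_hat \<rho> (s + real n) t) \<and>
        (\<forall>t. fourier (laguerre_fun \<rho> (s + real n + 1)) t = laguerre_hat \<rho> (s + real n + 1) t)"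
  proof (induction n)
    case 0
    then show ?case using fourier_laguerre_fun_base[OF s] by simp
  next
    case (Suc n)
    have e: "s + real (Suc n) = s + real n + 1" by simp
    have "fourier (laguerre_fun \<rho> (s + real n + 1 + 1)) t = laguerre_hat \<rho> (s + real n + 1 + 1) t" for t
    proof (rule fourier_laguerre_fun_step)
      show "s + real n + 1 > -1/2" using s by linarith
      show "fourier (laguerre_fun \<rho> (s + real n + 1)) t = laguerre_hat \<rho> (s + real n + 1) t" for t
        using Suc by blast
      show "fourier (laguerre_fun \<rho> (s + real n + 1 - 1)) t = laguerre_hat \<rho> (s + real n + 1 - 1) t" for t
        using Suc by (simp only: add_diff_cancel_right')
    qed
    then show ?case unfolding e using Suc by blast
  qed
  then show ?thesis by blast
qed

text \<open>Reflection reduces shifts to the left to shifts to the right.\<close>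

lemma fourier_laguerre_fun_minus:
  "fourier (laguerre_fun \<rho> s) t = fourier (laguerre_fun \<rho> (- s)) (- t)"
proof -
  have "laguerre_fun \<rho> s = (\<lambda>x. laguerre_fun \<rho> (- s) (- x))" by (simp add: laguerre_fun_minus)
  then show ?thesis using fourier_minus[of "laguerre_fun \<rho> (- s)" t] by simp
qed

text \<open>For half-integral \<open>s\<close> no representative lies in the open strip; the identity follows by continuity in \<open>s\<close>.\<close>
theorem fourier_laguerre_fun: "fourier (laguerre_fun \<rho> s) t = laguerre_hat \<rho> s t"
proof -
  have generic: "fourier (laguerre_fun \<rho> s) t = laguerre_hat \<rho> s t" if "s - 1/2 \<notin> \<int>" for s
  proof -
    \<comment> \<open>The nearest integer to s; the distance is strictly below 1/2 because s is not
      half-integral.\<close>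
    define k where "k = \<lfloor>s + 1/2\<rfloor>"
    have k: "of_int k \<le> s + 1/2" "s + 1/2 < of_int k + 1" unfolding k_def by linarith+
    have "s + 1/2 \<noteq> of_int k"
    proof
      assume "s + 1/2 = of_int k"
      then have "s - 1/2 = of_int (k - 1)" by simp
      with that show False by (metis Ints_of_int)
    qed
    with k have r: "\<bar>s - of_int k\<bar> < 1/2" by linarith
    show ?thesis
    proof (cases "k \<ge> 0")
      case True
      then show ?thesis using fourier_laguerre_fun_nonneg[OF r, of \<rho> "nat k" t] by simp
    next
      case False
      have "\<bar>- (s - of_int k)\<bar> < 1/2" using r by (simp only: abs_minus_cancel)
      from fourier_laguerre_fun_nonneg[OF this, of \<rho> "nat (- k)" "- t"] False show ?thesis
        unfolding fourier_laguerre_fun_minus[of \<rho> s] by (simp add: laguerre_hat_minus[symmetric, of \<rho> s t])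
    qed
  qed
  show ?thesis
  proof (cases "s - 1/2 \<in> \<int>")
    case True
    then obtain k where k: "s - 1/2 = of_int k" by (auto elim: Ints_cases)
    \<comment> \<open>The offset n + 2 keeps every increment strictly between 0 and 1, so no S n is
      half-integral.\<close>
    define S where "S = (\<lambda>n. s + 1 / real (n + 2))"
    have lim: "S \<longlonglongrightarrow> s" unfolding S_def by real_asymp
    have S: "S n - 1/2 \<notin> \<int>" for n
    proof
      assume "S n - 1/2 \<in> \<int>"
      then obtain m where "S n - 1/2 = of_int m" by (auto elim: Ints_cases)
      then have "1 / real (n + 2) = of_int (m - k)" using k by (simp add: S_def)
      moreover have "0 < 1 / real (n + 2)" "1 / real (n + 2) < 1" by auto
      ultimately have "0 < m - k" "m - k < 1" by (metis of_int_0_less_iff, metis of_int_less_1_iff)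
      then show False by simp
    qed
    obtain C where C: "C \<ge> 0" "\<And>s' x. \<bar>s'\<bar> \<le> \<bar>s\<bar> + 1 \<Longrightarrow> (1 + \<bar>x\<bar>) * norm (laguerre_fun \<rho> s' x) \<le> C * (\<bar>x\<bar> powr (-1/4) * exp (- (\<bar>x\<bar> / 4)))"
      using laguerre_fun_bound[of "\<bar>s\<bar> + 1" \<rho>] by blast
    have "(\<lambda>n. fourier (laguerre_fun \<rho> (S n)) t) \<longlonglongrightarrow> fourier (laguerre_fun \<rho> s) t"
      unfolding fourier_def
    proof (rule integral_dominated_convergence)
      show "integrable lborel (\<lambda>x::real. C * (\<bar>x\<bar> powr (-1/4) * exp (- (\<bar>x\<bar> / 4))))"
        using integrable_abs_powr_exp[of "3/4" "1/4"] by simp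
      show "AE x in lborel. norm (cis (- (t * x)) * laguerre_fun \<rho> (S n) x) \<le> C * (\<bar>x\<bar> powr (-1/4) * exp (- (\<bar>x\<bar> / 4)))" for n
      proof (rule AE_I2)
        fix x
        have "1 / real (n + 2) \<le> 1" by simp
        moreover have "0 \<le> 1 / real (n + 2)" by simp
        ultimately have "\<bar>S n\<bar> \<le> \<bar>s\<bar> + 1" unfolding S_def by linarith
        from C(2)[OF this, of x]
        have "(1 + \<bar>x\<bar>) * norm (laguerre_fun \<rho> (S n) x) \<le> C * (\<bar>x\<bar> powr (-1/4) * exp (- (\<bar>x\<bar> / 4)))" .
        moreover have "norm (laguerre_fun \<rho> (S n) x) \<le> (1 + \<bar>x\<bar>) * norm (laguerre_fun \<rho> (S n) x)"
          by (simp add: ring_distribs)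
        ultimately show "norm (cis (- (t * x)) * laguerre_fun \<rho> (S n) x) \<le> C * (\<bar>x\<bar> powr (-1/4) * exp (- (\<bar>x\<bar> / 4)))"
          by (simp only: norm_mult norm_cis mult_1)
      qed
      show "AE x in lborel. (\<lambda>n. cis (- (t * x)) * laguerre_fun \<rho> (S n) x) \<longlonglongrightarrow> cis (- (t * x)) * laguerre_fun \<rho> s x"
        by (intro AE_I2 tendsto_intros laguerre_fun_tendsto lim)
    qed measurable
    moreover have "(\<lambda>n. laguerre_hat \<rho> (S n) t) \<longlonglongrightarrow> laguerre_hat \<rho> s t"
      unfolding laguerre_hat_def using lim half_plus_imag[of t]
      by (intro tendsto_mult tendsto_powr_complex tendsto_const tendsto_minus tendsto_Complex tendsto_diff tendsto_add) auto
    ultimately show ?thesis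
      unfolding generic[OF S] by (rule LIMSEQ_unique)
  qed (rule generic)
qed

section \<open>Plancherel's formula\<close>

lemma lborel_shift:
  fixes h :: "real \<Rightarrow> 'b::{banach,second_countable_topology}"
  assumes "integrable lborel h"
  shows "integrable lborel (\<lambda>x. h (u + x))" "(\<integral>x. h (u + x) \<partial>lborel) = (\<integral>x. h x \<partial>lborel)"
  using lborel_integrable_real_affine[OF assms, of 1 u] lborel_integral_real_affine[of 1 h u] by simp_all

lemma norm_mult_le_sq: "norm (a * b) \<le> (norm a)\<^sup>2 + (norm b)\<^sup>2" for a b :: complex
proof -
  have "0 \<le> (norm a - norm b)\<^sup>2" "0 \<le> norm a * norm b" by simp_all
  then show ?thesis unfolding power2_diff norm_mult by linarith
qed

lemma integrable_mult_sq:
  fixes f g :: "'a \<Rightarrow> complex"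
  assumes [measurable]: "f \<in> borel_measurable M" "g \<in> borel_measurable M"
    and "integrable M (\<lambda>x. (norm (f x))\<^sup>2)" "integrable M (\<lambda>x. (norm (g x))\<^sup>2)"
  shows "integrable M (\<lambda>x. f x * g x)"
proof (rule Bochner_Integration.integrable_bound)
  show "integrable M (\<lambda>x. (norm (f x))\<^sup>2 + (norm (g x))\<^sup>2)" using assms by simp
  show "AE x in M. norm (f x * g x) \<le> norm ((norm (f x))\<^sup>2 + (norm (g x))\<^sup>2)"
    using norm_mult_le_sq by (auto intro!: AE_I2)
qed measurable

lemma norm_parallelogram: "(norm (a - b))\<^sup>2 + (norm (a + b))\<^sup>2 = 2 * (norm a)\<^sup>2 + 2 * (norm b)\<^sup>2" for a b :: complex
  unfolding cmod_power2 by (simp add: power2_eq_square algebra_simps)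

lemma norm_diff_sq_le: "(norm (a - b))\<^sup>2 \<le> 2 * (norm a)\<^sup>2 + 2 * (norm b)\<^sup>2" for a b :: complex
  using norm_parallelogram[of a b] zero_le_power2[of "norm (a + b)"] by linarith

lemma integrable_diff_sq:
  fixes f g :: "'a \<Rightarrow> complex"
  assumes [measurable]: "f \<in> borel_measurable M" "g \<in> borel_measurable M"
    and "integrable M (\<lambda>x. (norm (f x))\<^sup>2)" "integrable M (\<lambda>x. (norm (g x))\<^sup>2)"
  shows "integrable M (\<lambda>x. (norm (f x - g x))\<^sup>2)"
proof (rule Bochner_Integration.integrable_bound)
  show "integrable M (\<lambda>x. 2 * (norm (f x))\<^sup>2 + 2 * (norm (g x))\<^sup>2)" using assms by simp
  show "AE x in M. norm ((norm (f x - g x))\<^sup>2) \<le> norm (2 * (norm (f x))\<^sup>2 + 2 * (norm (g x))\<^sup>2)"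
    using norm_diff_sq_le[of "f _" "g _"] by (auto intro!: AE_I2)
qed measurable

lemma integral_diff_sq_le:
  fixes f g h :: "'a \<Rightarrow> complex"
  assumes [measurable]: "f \<in> borel_measurable M" "g \<in> borel_measurable M" "h \<in> borel_measurable M"
    and "integrable M (\<lambda>x. (norm (f x))\<^sup>2)" "integrable M (\<lambda>x. (norm (g x))\<^sup>2)" "integrable M (\<lambda>x. (norm (h x))\<^sup>2)"
  shows "(\<integral>x. (norm (f x - h x))\<^sup>2 \<partial>M) \<le> 2 * (\<integral>x. (norm (f x - g x))\<^sup>2 \<partial>M) + 2 * (\<integral>x. (norm (g x - h x))\<^sup>2 \<partial>M)"
proof -
  have "(\<integral>x. (norm (f x - h x))\<^sup>2 \<partial>M) \<le> (\<integral>x. 2 * (norm (f x - g x))\<^sup>2 + 2 * (norm (g x - h x))\<^sup>2 \<partial>M)"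
  proof (rule integral_mono)
    show "(norm (f x - h x))\<^sup>2 \<le> 2 * (norm (f x - g x))\<^sup>2 + 2 * (norm (g x - h x))\<^sup>2" for x
      using norm_diff_sq_le[of "f x - g x" "h x - g x"] by (simp add: norm_minus_commute)
  qed (use assms in \<open>auto intro!: integrable_diff_sq Bochner_Integration.integrable_add\<close>)
  also have "\<dots> = 2 * (\<integral>x. (norm (f x - g x))\<^sup>2 \<partial>M) + 2 * (\<integral>x. (norm (g x - h x))\<^sup>2 \<partial>M)"
    using assms by (subst Bochner_Integration.integral_add) (auto intro!: integrable_diff_sq)
  finally show ?thesis .
qed

text \<open>By the parallelogram law and Scheffe's lemma, applied to \<open>|F(u + x) + F(x)|\<^sup>2 \<rightarrow> |2 F(x)|\<^sup>2\<close>.\<close>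
lemma L2_translation_tendsto:
  fixes F :: "real \<Rightarrow> complex"
  assumes cont: "\<And>x. x \<noteq> 0 \<Longrightarrow> isCont F x" and F2: "integrable lborel (\<lambda>x. (norm (F x))\<^sup>2)" and u: "u \<longlonglongrightarrow> 0"
  shows "(\<lambda>n. \<integral>x. (norm (F (u n + x) - F x))\<^sup>2 \<partial>lborel) \<longlonglongrightarrow> 0"
proof -
  have [measurable]: "F \<in> borel_measurable borel" by (rule borel_measurable_isCont_except_0[OF cont])
  have Fu2: "integrable lborel (\<lambda>x. (norm (F (u n + x)))\<^sup>2)" "(\<integral>x. (norm (F (u n + x)))\<^sup>2 \<partial>lborel) = (\<integral>x. (norm (F x))\<^sup>2 \<partial>lborel)" for n
    using lborel_shift[OF F2, of "u n"] by auto
  define R where "R = (\<lambda>n x. (norm (F (u n + x) + F x))\<^sup>2)"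
  define S where "S = (\<integral>x. (norm (F x))\<^sup>2 \<partial>lborel)"
  have Rint: "integrable lborel (R n)" for n
    using integrable_diff_sq[of "\<lambda>x. F (u n + x)" lborel "\<lambda>x. - F x"] Fu2 F2 by (simp add: R_def)
  have Qint: "integrable lborel (\<lambda>x. (norm (F (u n + x) - F x))\<^sup>2)" for n
    using Fu2 F2 by (intro integrable_diff_sq) auto
  have par: "(norm (F (u n + x) - F x))\<^sup>2 = 2 * (norm (F (u n + x)))\<^sup>2 + 2 * (norm (F x))\<^sup>2 - R n x" for n x
    using norm_parallelogram[of "F (u n + x)" "F x"] unfolding R_def by linarith
  have Q: "(\<integral>x. (norm (F (u n + x) - F x))\<^sup>2 \<partial>lborel) = 4 * S - (\<integral>x. R n x \<partial>lborel)" for n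
    unfolding par using Fu2 F2 Rint by (simp add: S_def)
  have "(\<lambda>n. \<integral>\<^sup>+x. norm (R n x - 4 * (norm (F x))\<^sup>2) \<partial>lborel) \<longlonglongrightarrow> 0"
  proof (rule Scheffe_lemma2)
    show "R n \<in> borel_measurable lborel" for n by (simp add: R_def)
    show "integrable lborel (\<lambda>x. 4 * (norm (F x))\<^sup>2)" using F2 by simp
    show "AE x in lborel. (\<lambda>n. R n x) \<longlonglongrightarrow> 4 * (norm (F x))\<^sup>2"
      using AE_lborel_singleton[of 0]
    proof eventually_elim
      fix x :: real assume "x \<noteq> 0"
      have "(\<lambda>n. u n + x) \<longlonglongrightarrow> 0 + x" by (intro tendsto_intros u)
      then have "(\<lambda>n. F (u n + x)) \<longlonglongrightarrow> F x"
        using isCont_tendsto_compose[OF cont[OF \<open>x \<noteq> 0\<close>]] by simp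
      then have "(\<lambda>n. R n x) \<longlonglongrightarrow> (norm (F x + F x))\<^sup>2"
        unfolding R_def by (intro tendsto_intros)
      moreover have "norm (F x + F x) = 2 * norm (F x)"
        by (simp only: mult_2[symmetric] norm_mult norm_numeral)
      ultimately show "(\<lambda>n. R n x) \<longlonglongrightarrow> 4 * (norm (F x))\<^sup>2"
        by (simp add: power_mult_distrib)
    qed
    show "(\<integral>\<^sup>+x. norm (R n x) \<partial>lborel) \<le> (\<integral>\<^sup>+x. norm (4 * (norm (F x))\<^sup>2) \<partial>lborel)" for n
    proof -
      \<comment> \<open>In the parallelogram law, nonnegativity of the integrated squared difference
        is the inequality of integrals that Scheffe's lemma requires.\<close>
      have "0 \<le> (\<integral>x. (norm (F (u n + x) - F x))\<^sup>2 \<partial>lborel)" by simp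
      then have "(\<integral>x. R n x \<partial>lborel) \<le> (\<integral>x. 4 * (norm (F x))\<^sup>2 \<partial>lborel)"
        unfolding Q by (simp add: S_def)
      then show ?thesis
        using F2 Rint[of n] by (simp add: nn_integral_eq_integral R_def ennreal_leI)
    qed
  qed
  then have "(\<lambda>n. \<integral>x. norm (R n x - 4 * (norm (F x))\<^sup>2) \<partial>lborel) \<longlonglongrightarrow> 0"
  proof -
    assume lim: "(\<lambda>n. \<integral>\<^sup>+x. norm (R n x - 4 * (norm (F x))\<^sup>2) \<partial>lborel) \<longlonglongrightarrow> 0"
    have "(\<integral>\<^sup>+x. norm (R n x - 4 * (norm (F x))\<^sup>2) \<partial>lborel) = ennreal (\<integral>x. norm (R n x - 4 * (norm (F x))\<^sup>2) \<partial>lborel)" for n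
      using F2 Rint[of n] by (intro nn_integral_eq_integral) auto
    with lim have "(\<lambda>n. ennreal (\<integral>x. norm (R n x - 4 * (norm (F x))\<^sup>2) \<partial>lborel)) \<longlonglongrightarrow> ennreal 0"
      by simp
    then show ?thesis by (subst (asm) tendsto_ennreal_iff) auto
  qed
  then have "(\<lambda>n. \<integral>x. R n x - 4 * (norm (F x))\<^sup>2 \<partial>lborel) \<longlonglongrightarrow> 0"
    by (rule Lim_null_comparison[OF always_eventually, rotated]) (auto intro!: integral_norm_bound)
  moreover have "(\<integral>x. R n x - 4 * (norm (F x))\<^sup>2 \<partial>lborel) = - (\<integral>x. (norm (F (u n + x) - F x))\<^sup>2 \<partial>lborel)" for n
    unfolding Q using F2 Rint by (simp add: S_def)
  ultimately show ?thesis by (simp add: tendsto_minus_cancel_left[symmetric])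
qed

text \<open>Cauchy-Schwarz in weighted form, |a b| <= M |a|^2 + |b|^2 / M: a large M makes the
  second part small, and continuity of translation in L2 then makes the first small.\<close>

lemma correlation_tendsto_0:
  fixes F G :: "real \<Rightarrow> complex"
  assumes cont: "\<And>x. x \<noteq> 0 \<Longrightarrow> isCont F x" and F2: "integrable lborel (\<lambda>x. (norm (F x))\<^sup>2)"
    and [measurable]: "G \<in> borel_measurable borel" and G2: "integrable lborel (\<lambda>x. (norm (G x))\<^sup>2)" and u: "u \<longlonglongrightarrow> 0"
  shows "(\<lambda>n. \<integral>y. F (u n + y) * G y \<partial>lborel) \<longlonglongrightarrow> (\<integral>y. F y * G y \<partial>lborel)"
proof (rule LIMSEQ_I)
  fix e :: real assume e: "e > 0"
  have [measurable]: "F \<in> borel_measurable borel" by (rule borel_measurable_isCont_except_0[OF cont])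
  define S where "S = (\<integral>x. (norm (G x))\<^sup>2 \<partial>lborel)"
  have S: "S \<ge> 0" by (simp add: S_def)
  \<comment> \<open>Chosen so that S / M < e / 2; the summand 1 keeps M positive when S = 0.\<close>
  define M where "M = 2 * S / e + 1"
  have M: "M > 0" using S e by (auto simp: M_def intro: add_nonneg_pos)
  have SM: "S / M < e / 2"
  proof -
    have "S * 2 < e * M" using e S by (simp add: M_def field_simps)
    then show ?thesis using M by (simp add: field_simps)
  qed
  have Fu2: "integrable lborel (\<lambda>x. (norm (F (u n + x)))\<^sup>2)" for n
    using lborel_shift[OF F2, of "u n"] by auto
  have Qint: "integrable lborel (\<lambda>x. (norm (F (u n + x) - F x))\<^sup>2)" for n
    using Fu2 F2 by (intro integrable_diff_sq) auto
  have bound: "norm ((\<integral>y. F (u n + y) * G y \<partial>lborel) - (\<integral>y. F y * G y \<partial>lborel)) \<le> M * (\<integral>x. (norm (F (u n + x) - F x))\<^sup>2 \<partial>lborel) + S / M" for n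
  proof -
    have "(\<integral>y. F (u n + y) * G y \<partial>lborel) - (\<integral>y. F y * G y \<partial>lborel) = (\<integral>y. (F (u n + y) - F y) * G y \<partial>lborel)"
      using integrable_mult_sq[of "\<lambda>y. F (u n + y)" lborel G] integrable_mult_sq[of F lborel G] Fu2 F2 G2
      by (simp add: ring_distribs)
    also have "norm \<dots> \<le> (\<integral>y. M * (norm (F (u n + y) - F y))\<^sup>2 + (norm (G y))\<^sup>2 / M \<partial>lborel)"
    proof (rule Bochner_Integration.integral_norm_bound_integral)
      show "integrable lborel (\<lambda>y. (F (u n + y) - F y) * G y)"
        using Qint G2 by (intro integrable_mult_sq) auto
      show "integrable lborel (\<lambda>y. M * (norm (F (u n + y) - F y))\<^sup>2 + (norm (G y))\<^sup>2 / M)"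
        using Qint G2 by auto
      fix y
      let ?a = "norm (F (u n + y) - F y)" and ?b = "norm (G y)"
      have "0 \<le> (M * ?a - ?b)\<^sup>2 / M" using M by simp
      also have "(M * ?a - ?b)\<^sup>2 / M = M * ?a\<^sup>2 + ?b\<^sup>2 / M - 2 * (?a * ?b)"
        using M by (simp add: field_simps power2_eq_square)
      finally have "2 * (?a * ?b) \<le> M * ?a\<^sup>2 + ?b\<^sup>2 / M" by simp
      moreover have "0 \<le> ?a * ?b" by simp
      ultimately show "norm ((F (u n + y) - F y) * G y) \<le> M * ?a\<^sup>2 + ?b\<^sup>2 / M"
        unfolding norm_mult by linarith
    qed
    also have "\<dots> = M * (\<integral>x. (norm (F (u n + x) - F x))\<^sup>2 \<partial>lborel) + S / M"
      using Qint G2 by (simp add: S_def)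
    finally show ?thesis .
  qed
  have "(\<lambda>n. M * (\<integral>x. (norm (F (u n + x) - F x))\<^sup>2 \<partial>lborel)) \<longlonglongrightarrow> M * 0"
    by (intro tendsto_intros L2_translation_tendsto cont F2 u)
  then obtain N where N: "\<And>n. n \<ge> N \<Longrightarrow> M * (\<integral>x. (norm (F (u n + x) - F x))\<^sup>2 \<partial>lborel) < e / 2"
    using order_tendstoD(2)[of _ "M * 0" sequentially "e / 2"] e unfolding eventually_sequentially by auto
  show "\<exists>no. \<forall>n\<ge>no. norm ((\<integral>y. F (u n + y) * G y \<partial>lborel) - (\<integral>y. F y * G y \<partial>lborel)) < e"
  proof (intro exI[of _ N] allI impI)
    fix n assume "n \<ge> N"
    from N[OF this] SM bound[of n] show "norm ((\<integral>y. F (u n + y) * G y \<partial>lborel) - (\<integral>y. F y * G y \<partial>lborel)) < e" by linarith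
  qed
qed

section \<open>Gaussian summation and Plancherel's formula\<close>

lemma fourier_std_normal: "fourier (\<lambda>t. complex_of_real (std_normal_density t)) u = of_real (exp (- (u\<^sup>2) / 2))"
proof -
  have "char std_normal_distribution (- u) = (\<integral>x. std_normal_density x *\<^sub>R iexp (- u * x) \<partial>lborel)"
    unfolding char_def by (subst integral_density) auto
  also have "\<dots> = fourier (\<lambda>t. complex_of_real (std_normal_density t)) u"
    unfolding fourier_def by (intro Bochner_Integration.integral_cong refl) (simp add: cis_conv_exp scaleR_conv_of_real mult_ac)
  finally show ?thesis by (simp add: char_std_normal_distribution)
qed

text \<open>Fourier inversion at the origin, by Gaussian summation.\<close>
lemma integral_fourier:
  fixes A :: "real \<Rightarrow> complex"
  assumes A: "integrable lborel A" and fA: "integrable lborel (fourier A)"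
    and bound: "\<And>u. norm (A u) \<le> B"
    and cont: "\<And>u. u \<longlonglongrightarrow> 0 \<Longrightarrow> (\<lambda>n. A (u n)) \<longlonglongrightarrow> A 0"
  shows "(\<integral>t. fourier A t \<partial>lborel) = 2 * pi * A 0"
proof -
  define k where "k = (\<lambda>t. complex_of_real (std_normal_density t))"
  have kint: "integrable lborel k"
    unfolding k_def by (intro integrable_of_real integrable_normal_density) auto
  have [measurable]: "A \<in> borel_measurable borel" "fourier A \<in> borel_measurable borel" "k \<in> borel_measurable borel"
    using A fA kint by auto
  have kexp: "k u = of_real (1 / sqrt (2 * pi)) * of_real (exp (- (u\<^sup>2) / 2))" for u
    by (simp add: k_def std_normal_density_def normal_density_def)
  \<comment> \<open>Fubini moves the transform from A to the wide Gaussian, giving a narrow one;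
    rescaling turns it into the fixed Gaussian against A(v/N), which concentrates A at 0.\<close>
  have eq: "(\<integral>t. fourier A t * k (t / real (Suc n)) \<partial>lborel) = (\<integral>v. A (v / real (Suc n)) * of_real (exp (- (v\<^sup>2) / 2)) \<partial>lborel)" for n
  proof -
    let ?N = "real (Suc n)"
    have kN: "integrable lborel (\<lambda>t. k (t / ?N))"
      using lborel_integrable_real_affine[OF kint, of "1 / ?N" 0] by simp
    have I: "integrable (lborel \<Otimes>\<^sub>M lborel) (\<lambda>(t, u). k (t / ?N) * A u)"
    proof (rule lborel_pair.Fubini_integrable)
      have "(\<lambda>t. \<integral>u. norm (k (t / ?N) * A u) \<partial>lborel) = (\<lambda>t. norm (k (t / ?N)) * (\<integral>u. norm (A u) \<partial>lborel))"
        by (simp add: norm_mult)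
      then show "integrable lborel (\<lambda>t. \<integral>u. norm (case (t, u) of (t, u) \<Rightarrow> k (t / ?N) * A u) \<partial>lborel)"
        using integrable_norm[OF kN] by simp
      show "AE t in lborel. integrable lborel (\<lambda>u. case (t, u) of (t, u) \<Rightarrow> k (t / ?N) * A u)"
        using A by (auto intro!: AE_I2)
    qed measurable
    have J: "integrable (lborel \<Otimes>\<^sub>M lborel) (\<lambda>(t, u). cis (- (t * u)) * (k (t / ?N) * A u))"
    proof (rule Bochner_Integration.integrable_bound[OF I])
      show "(\<lambda>(t, u). cis (- (t * u)) * (k (t / ?N) * A u)) \<in> borel_measurable (lborel \<Otimes>\<^sub>M lborel)"
        by measurable
    qed (auto simp: norm_mult)
    have "(\<integral>t. fourier A t * k (t / ?N) \<partial>lborel) = (\<integral>t. (\<integral>u. cis (- (t * u)) * (k (t / ?N) * A u) \<partial>lborel) \<partial>lborel)"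
    proof (rule Bochner_Integration.integral_cong[OF refl])
      fix t
      have "fourier A t * k (t / ?N) = (\<integral>u. cis (- (t * u)) * A u * k (t / ?N) \<partial>lborel)"
        unfolding fourier_def by (rule integral_mult_left_zero[symmetric])
      then show "fourier A t * k (t / ?N) = (\<integral>u. cis (- (t * u)) * (k (t / ?N) * A u) \<partial>lborel)"
        by (simp only: mult_ac)
    qed
    also have "\<dots> = (\<integral>u. (\<integral>t. cis (- (t * u)) * (k (t / ?N) * A u) \<partial>lborel) \<partial>lborel)"
      using lborel_pair.Fubini_integral[OF J] by simp
    also have "\<dots> = (\<integral>u. A u * (of_real ?N * of_real (exp (- ((?N * u)\<^sup>2) / 2))) \<partial>lborel)"
    proof (rule Bochner_Integration.integral_cong[OF refl])
      fix u
      have "(\<integral>t. cis (- (t * u)) * (k (t / ?N) * A u) \<partial>lborel) = (\<integral>t. cis (- (u * t)) * k (t / ?N) * A u \<partial>lborel)"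
        by (simp only: mult_ac)
      also have "\<dots> = (\<integral>t. cis (- (u * t)) * k (t / ?N) \<partial>lborel) * A u"
        by (rule integral_mult_left_zero)
      also have "(\<integral>t. cis (- (u * t)) * k (t / ?N) \<partial>lborel) = \<bar>?N\<bar> *\<^sub>R (\<integral>t. cis (- (u * (0 + ?N * t))) * k ((0 + ?N * t) / ?N) \<partial>lborel)"
        by (rule lborel_integral_real_affine) simp
      also have "(\<integral>t. cis (- (u * (0 + ?N * t))) * k ((0 + ?N * t) / ?N) \<partial>lborel) = fourier k (?N * u)"
        unfolding fourier_def by (intro Bochner_Integration.integral_cong refl) (simp add: mult_ac del: of_nat_Suc)
      also have "fourier k (?N * u) = of_real (exp (- ((?N * u)\<^sup>2) / 2))"
        unfolding k_def by (rule fourier_std_normal)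
      finally show "(\<integral>t. cis (- (t * u)) * (k (t / ?N) * A u) \<partial>lborel) = A u * (of_real ?N * of_real (exp (- ((?N * u)\<^sup>2) / 2)))"
        by (simp add: scaleR_conv_of_real mult_ac del: of_nat_Suc)
    qed
    also have "\<dots> = \<bar>1 / ?N\<bar> *\<^sub>R (\<integral>v. A (0 + (1 / ?N) * v) * (of_real ?N * of_real (exp (- ((?N * (0 + (1 / ?N) * v))\<^sup>2) / 2))) \<partial>lborel)"
      by (rule lborel_integral_real_affine) simp
    also have "(\<integral>v. A (0 + (1 / ?N) * v) * (of_real ?N * of_real (exp (- ((?N * (0 + (1 / ?N) * v))\<^sup>2) / 2))) \<partial>lborel)
        = (\<integral>v. of_real ?N * (A (v / ?N) * of_real (exp (- (v\<^sup>2) / 2))) \<partial>lborel)"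
      by (intro Bochner_Integration.integral_cong refl) (simp del: of_nat_Suc)
    also have "\<bar>1 / ?N\<bar> *\<^sub>R (\<integral>v. of_real ?N * (A (v / ?N) * of_real (exp (- (v\<^sup>2) / 2))) \<partial>lborel) = (\<integral>v. A (v / ?N) * of_real (exp (- (v\<^sup>2) / 2)) \<partial>lborel)"
      by (simp add: scaleR_conv_of_real del: of_nat_Suc)
    finally show ?thesis .
  qed
  have scale: "(\<lambda>n. v / real (Suc n)) \<longlonglongrightarrow> 0" for v
    by real_asymp
  have gint: "integrable lborel (\<lambda>v. exp (- (v\<^sup>2) / 2) :: real)" and gval: "(\<integral>v. exp (- (v\<^sup>2) / 2) \<partial>lborel) = sqrt (2 * pi)"
  proof -
    have e: "exp (- (v\<^sup>2) / 2) = sqrt (2 * pi) * std_normal_density v" for v :: real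
      by (simp add: std_normal_density_def normal_density_def)
    show "integrable lborel (\<lambda>v. exp (- (v\<^sup>2) / 2) :: real)"
      unfolding e by (intro integrable_mult_right integrable_normal_density) auto
    show "(\<integral>v. exp (- (v\<^sup>2) / 2) \<partial>lborel) = sqrt (2 * pi)"
      unfolding e using integral_normal_density[of 1 0] by simp
  qed
  have "(\<lambda>n. \<integral>t. fourier A t * k (t / real (Suc n)) \<partial>lborel) \<longlonglongrightarrow> (\<integral>t. fourier A t * k 0 \<partial>lborel)"
  proof (rule integral_dominated_convergence)
    have kn: "norm (k t) \<le> 1 / sqrt (2 * pi)" for t
      unfolding kexp norm_mult norm_of_real by (auto intro!: divide_right_mono)
    show "AE t in lborel. norm (fourier A t * k (t / real (Suc n))) \<le> norm (fourier A t) * (1 / sqrt (2 * pi))" for n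
      unfolding norm_mult by (intro AE_I2 mult_left_mono kn norm_ge_zero)
    show "integrable lborel (\<lambda>t. norm (fourier A t) * (1 / sqrt (2 * pi)))"
      using fA by simp
    show "AE t in lborel. (\<lambda>n. fourier A t * k (t / real (Suc n))) \<longlonglongrightarrow> fourier A t * k 0"
    proof (rule AE_I2)
      fix t
      have "(\<lambda>n. of_real (1 / sqrt (2 * pi)) * complex_of_real (exp (- ((t / real (Suc n))\<^sup>2) / 2))) \<longlonglongrightarrow> of_real (1 / sqrt (2 * pi)) * of_real (exp (- (0\<^sup>2) / 2))"
        by (intro tendsto_intros scale) auto
      then show "(\<lambda>n. fourier A t * k (t / real (Suc n))) \<longlonglongrightarrow> fourier A t * k 0"
        unfolding kexp by (rule tendsto_mult_left)
    qed
  qed measurable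
  moreover have "(\<lambda>n. \<integral>v. A (v / real (Suc n)) * of_real (exp (- (v\<^sup>2) / 2)) \<partial>lborel) \<longlonglongrightarrow> (\<integral>v. A 0 * of_real (exp (- (v\<^sup>2) / 2)) \<partial>lborel)"
  proof (rule integral_dominated_convergence)
    show "integrable lborel (\<lambda>v. B * exp (- (v\<^sup>2) / 2) :: real)" using gint by simp
    show "AE v in lborel. norm (A (v / real (Suc n)) * of_real (exp (- (v\<^sup>2) / 2))) \<le> B * exp (- (v\<^sup>2) / 2)" for n
      using bound by (auto intro!: AE_I2 mult_right_mono simp: norm_mult simp del: of_nat_Suc)
    show "AE v in lborel. (\<lambda>n. A (v / real (Suc n)) * of_real (exp (- (v\<^sup>2) / 2))) \<longlonglongrightarrow> A 0 * of_real (exp (- (v\<^sup>2) / 2))"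
      by (intro AE_I2 tendsto_intros cont scale)
  qed measurable
  ultimately have "(\<integral>t. fourier A t * k 0 \<partial>lborel) = (\<integral>v. A 0 * of_real (exp (- (v\<^sup>2) / 2)) \<partial>lborel)"
    unfolding eq by (rule LIMSEQ_unique)
  moreover have "(\<integral>v. A 0 * complex_of_real (exp (- (v\<^sup>2) / 2)) \<partial>lborel) = A 0 * of_real (sqrt (2 * pi))"
    unfolding integral_mult_right_zero integral_complex_of_real gval ..
  \<comment> \<open>The peak value 1/sqrt(2 pi) on one side and the mass sqrt(2 pi) on the other
    combine to 2 pi.\<close>
  moreover have "k 0 = 1 / of_real (sqrt (2 * pi))" by (simp add: kexp)
  ultimately have "(\<integral>t. fourier A t \<partial>lborel) = A 0 * (of_real (sqrt (2 * pi)) * of_real (sqrt (2 * pi)))"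
    by (simp add: field_simps)
  then show ?thesis by (simp flip: of_real_mult)
qed

text \<open>The correlation A of F with G has transform \<open>fourier F\<close> times the conjugate
  of \<open>fourier G\<close>, and A(0) is the inner product. Continuity of F away from 0 enters
  through the continuity of A at 0.\<close>

theorem parseval:
  fixes F G :: "real \<Rightarrow> complex"
  assumes cont: "\<And>x. x \<noteq> 0 \<Longrightarrow> isCont F x"
    and F: "integrable lborel F" and F2: "integrable lborel (\<lambda>x. (norm (F x))\<^sup>2)"
    and G: "integrable lborel G" and G2: "integrable lborel (\<lambda>x. (norm (G x))\<^sup>2)"
    and FG: "integrable lborel (\<lambda>t. fourier F t * cnj (fourier G t))"
  shows "(\<integral>t. fourier F t * cnj (fourier G t) \<partial>lborel) = 2 * pi * (\<integral>x. F x * cnj (G x) \<partial>lborel)"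
proof -
  have [measurable]: "F \<in> borel_measurable borel" "G \<in> borel_measurable borel" using F G by auto
  define A where "A = (\<lambda>u. \<integral>y. F (u + y) * cnj (G y) \<partial>lborel)"
  have G': "integrable lborel (\<lambda>y. cnj (G y))" using G by simp
  have c: "fourier (\<lambda>y. cnj (G y)) (- t) = cnj (fourier G t)" for t
    unfolding fourier_def Bochner_Integration.integral_cnj[symmetric] by (simp add: cis_cnj)
  have fA: "fourier A = (\<lambda>t. fourier F t * cnj (fourier G t))"
    using fourier_correlation[OF F G'] by (simp add: fun_eq_iff A_def c)
  have Aint: "integrable lborel A" unfolding A_def by (rule integrable_correlation[OF F G'])
  have bound: "norm (A u) \<le> (\<integral>x. (norm (F x))\<^sup>2 \<partial>lborel) + (\<integral>x. (norm (G x))\<^sup>2 \<partial>lborel)" for u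
  proof -
    note s = lborel_shift[OF F2, of u]
    have "norm (A u) \<le> (\<integral>y. (norm (F (u + y)))\<^sup>2 + (norm (G y))\<^sup>2 \<partial>lborel)"
      unfolding A_def
    proof (rule Bochner_Integration.integral_norm_bound_integral)
      show "integrable lborel (\<lambda>y. F (u + y) * cnj (G y))"
        using s G2 borel_measurable_integrable[OF G'] by (intro integrable_mult_sq) auto
      show "integrable lborel (\<lambda>y. (norm (F (u + y)))\<^sup>2 + (norm (G y))\<^sup>2)" using s G2 by simp
      show "norm (F (u + y) * cnj (G y)) \<le> (norm (F (u + y)))\<^sup>2 + (norm (G y))\<^sup>2" for y
        using norm_mult_le_sq[of "F (u + y)" "cnj (G y)"] by simp
    qed
    then show ?thesis using s G2 by simp
  qed
  have "(\<integral>t. fourier A t \<partial>lborel) = 2 * pi * A 0"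
  proof (rule integral_fourier[OF Aint _ bound])
    show "integrable lborel (fourier A)" unfolding fA by (rule FG)
    show "(\<lambda>n. A (u n)) \<longlonglongrightarrow> A 0" if "u \<longlonglongrightarrow> 0" for u
      using correlation_tendsto_0[OF cont F2 _ _ that, of "\<lambda>y. cnj (G y)"] G2 borel_measurable_integrable[OF G'] by (simp add: A_def)
  qed
  then show ?thesis unfolding fA by (simp add: A_def)
qed

section \<open>The Cayley map and orthonormality\<close>

definition cayley :: "real \<Rightarrow> complex" where
  "cayley t = (1/2 + \<i> * of_real t) / (1/2 - \<i> * of_real t)"

lemma norm_half_imag: "(norm (1/2 - \<i> * complex_of_real t))\<^sup>2 = 1/4 + t\<^sup>2" "(norm (1/2 + \<i> * complex_of_real t))\<^sup>2 = 1/4 + t\<^sup>2"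
  unfolding cmod_power2 by (simp_all add: power2_eq_square)

lemma norm_half_imag_eq: "norm (1/2 - \<i> * complex_of_real t) = norm (1/2 + \<i> * complex_of_real t)"
  by (rule power2_eq_imp_eq) (simp_all only: norm_half_imag norm_ge_zero)

lemma norm_cayley [simp]: "norm (cayley t) = 1" and cayley_nonzero [simp]: "cayley t \<noteq> 0"
  using half_plus_imag[of t] by (auto simp: cayley_def norm_divide norm_half_imag_eq)

text \<open>Shows both that the Cayley map omits the value -1 and that it tends to -1 at either end
  of the line.\<close>

lemma cayley_plus_1: "cayley t + 1 = 1 / (1/2 - \<i> * of_real t)"
proof -
  have "x / y + 1 = 1 / y" if "y \<noteq> 0" "x + y = 1" for x y :: complex
    using that by (metis add_divide_distrib div_self)
  from this[OF half_plus_imag(4)] show ?thesis by (simp add: cayley_def)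
qed

lemma laguerre_hat_cayley: "laguerre_hat \<rho> (s + of_int k) t = cayley t powi k * laguerre_hat \<rho> s t"
proof -
  have 1: "laguerre_hat \<rho> (s + 1) t = cayley t * laguerre_hat \<rho> s t" for s
    using laguerre_hat_shift[of t \<rho> s] half_plus_imag[of t] by (simp add: cayley_def field_simps)
  have nat: "laguerre_hat \<rho> (s + real n) t = cayley t ^ n * laguerre_hat \<rho> s t" for n s
  proof (induction n)
    case (Suc n)
    have "s + real (Suc n) = (s + real n) + 1" by simp
    then show ?case by (simp only: 1 Suc power_Suc mult.assoc)
  qed simp
  show ?thesis
  proof (cases "k \<ge> 0")
    case True
    then show ?thesis using nat[of s "nat k"] by (simp add: power_int_def)
  next
    case False
    then have "laguerre_hat \<rho> s t = cayley t ^ nat (- k) * laguerre_hat \<rho> (s + of_int k) t"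
      using nat[of "s + of_int k" "nat (- k)"] by simp
    then show ?thesis using False by (simp add: power_int_def field_simps)
  qed
qed

text \<open>The two bases are conjugate and the exponents have the same imaginary part, so the
  factors exp(\<rho> Arg) cancel, while the real parts of the exponents add up to -1. The modulus is
  therefore independent of s and \<rho>.\<close>

lemma norm_laguerre_hat_sq: "(norm (laguerre_hat \<rho> s t))\<^sup>2 = 1 / (1/4 + t\<^sup>2)"
proof -
  define A where "A = 1/2 + \<i> * complex_of_real t"
  have B: "1/2 - \<i> * complex_of_real t = cnj A" by (simp add: A_def)
  have A: "A \<notin> \<real>\<^sub>\<le>\<^sub>0" "A \<noteq> 0" unfolding A_def by (rule half_plus_imag)+
  have "Arg (cnj A) = - Arg A"
    using A by (simp add: Arg_eq_Im_Ln cnj_Ln[symmetric])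
  then have "norm (laguerre_hat \<rho> s t) = norm A powr (- (1/2 - s)) * norm A powr (- (1/2 + s)) * (exp (\<rho> * Arg A) * exp (- \<rho> * Arg A))"
    unfolding laguerre_hat_def A_def[symmetric] B by (simp add: norm_mult norm_powr_complex mult_ac)
  also have "exp (\<rho> * Arg A) * exp (- \<rho> * Arg A) = 1" by (simp flip: exp_add)
  also have "norm A powr (- (1/2 - s)) * norm A powr (- (1/2 + s)) = norm A powr (- 1)"
    by (simp only: powr_add[symmetric]) simp
  also have "norm A powr (- 1) = 1 / norm A" using A by (simp add: powr_minus_divide)
  finally show ?thesis
    using norm_half_imag(2)[of t] by (simp add: power_divide A_def)
qed

lemma integrable_cauchy: "integrable lborel (\<lambda>t::real. 1 / (1/4 + t\<^sup>2))"
  and integral_cauchy: "(\<integral>t. 1 / (1/4 + t\<^sup>2) \<partial>lborel) = 2 * pi"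
proof -
  have 1: "integrable lborel (\<lambda>x::real. inverse (1 + x\<^sup>2))"
    using integrable_inverse_1_plus_square by (simp add: set_integrable_def)
  have 2: "(\<integral>x. inverse (1 + x\<^sup>2) \<partial>lborel) = pi"
    using LBINT_inverse_1_plus_square by (simp add: interval_lebesgue_integral_def set_lebesgue_integral_def)
  have e: "(\<lambda>t::real. 1 / (1/4 + t\<^sup>2)) = (\<lambda>t. 4 * inverse (1 + (0 + 2 * t)\<^sup>2))"
    by (simp add: fun_eq_iff divide_simps power2_eq_square)
  show "integrable lborel (\<lambda>t::real. 1 / (1/4 + t\<^sup>2))"
    unfolding e by (intro integrable_mult_right lborel_integrable_real_affine[OF 1]) simp
  have "(\<integral>x. inverse (1 + x\<^sup>2) \<partial>lborel) = \<bar>2\<bar> *\<^sub>R (\<integral>x. inverse (1 + (0 + 2 * x :: real)\<^sup>2) \<partial>lborel)"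
    by (rule lborel_integral_real_affine) simp
  then show "(\<integral>t. 1 / (1/4 + t\<^sup>2) \<partial>lborel) = 2 * pi"
    unfolding e integral_mult_right_zero 2 by simp
qed

lemma continuous_cayley: "isCont cayley t"
  unfolding cayley_def using half_plus_imag[of t] by (intro continuous_intros) auto

lemma cayley_measurable [measurable]: "cayley \<in> borel_measurable borel"
  by (intro borel_measurable_continuous_onI continuous_at_imp_continuous_on ballI continuous_cayley)

lemma integrable_cayley_power: "integrable lborel (\<lambda>t. cayley t powi k * complex_of_real (1 / (1/4 + t\<^sup>2)))"
proof (rule Bochner_Integration.integrable_bound[OF integrable_cauchy])
  show "(\<lambda>t. cayley t powi k * complex_of_real (1 / (1/4 + t\<^sup>2))) \<in> borel_measurable lborel"
    by (cases "k \<ge> 0") (simp_all add: power_int_def)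
  show "AE t in lborel. norm (cayley t powi k * complex_of_real (1 / (1/4 + t\<^sup>2))) \<le> norm (1 / (1/4 + t\<^sup>2))"
    unfolding norm_mult norm_power_int norm_of_real by simp
qed

text \<open>The density 1/(1/4 + t^2) is the derivative of the angle on the circle, so the integrand
  has antiderivative \<open>cayley t powi k\<close> / (i k); both ends of the line go to the same
  point -1.\<close>

lemma integral_cayley_power:
  assumes k: "k \<noteq> 0"
  shows "(\<integral>t. cayley t powi k * of_real (1 / (1/4 + t\<^sup>2)) \<partial>lborel) = 0"
proof -
  let ?g = "\<lambda>t. cayley t powi k * of_real (1 / (1/4 + t\<^sup>2))"
  define G where "G = (\<lambda>t. cayley t powi k / (\<i> * of_int k))"
  have pos: "1/4 + t\<^sup>2 \<noteq> 0" for t :: real by (smt (verit) zero_le_power2 divide_pos_pos)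
  have int: "integrable lborel ?g"
    by (rule integrable_cayley_power)
  have der: "(G has_vector_derivative ?g t) (at t)" for t
  proof -
    have i: "(complex_of_real has_vector_derivative 1) (at t)"
      using has_vector_derivative_of_real[OF DERIV_ident] by simp
    have nz: "1/2 - \<i> * complex_of_real t \<noteq> 0" by (rule half_plus_imag)
    define c where "c = (1/2 + \<i> * complex_of_real t) / (1/2 - \<i> * complex_of_real t)"
    have c: "c \<noteq> 0" using cayley_nonzero[of t] by (simp add: c_def cayley_def)
    have "((\<lambda>z. (1/2 + \<i> * z) / (1/2 - \<i> * z)) has_field_derivative \<i> / (1/2 - \<i> * of_real t)\<^sup>2) (at (of_real t))"
    proof -
      have d: "((\<lambda>z. 1/2 + \<i> * z) has_field_derivative \<i>) (at (complex_of_real t))"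
        "((\<lambda>z. 1/2 - \<i> * z) has_field_derivative - \<i>) (at (complex_of_real t))"
        by (auto intro!: derivative_eq_intros)
      have "\<i> * (1/2 - \<i> * of_real t) - (1/2 + \<i> * of_real t) * - \<i> = \<i>"
        by (simp add: algebra_simps)
      with DERIV_divide[OF d nz] show ?thesis by (simp add: power2_eq_square)
    qed
    from DERIV_power_int[OF this, of k] c
    have "((\<lambda>z. ((1/2 + \<i> * z) / (1/2 - \<i> * z)) powi k) has_field_derivative of_int k * c powi (k - 1) * (\<i> / (1/2 - \<i> * of_real t)\<^sup>2)) (at (of_real t))"
      by (simp add: c_def)
    from field_vector_diff_chain_at[OF i DERIV_cdivide[OF this, of "\<i> * of_int k"]]
    have "(G has_vector_derivative of_int k * c powi (k - 1) * (\<i> / (1/2 - \<i> * of_real t)\<^sup>2) / (\<i> * of_int k)) (at t)"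
      by (simp add: o_def G_def cayley_def)
    also have "of_int k * c powi (k - 1) * (\<i> / (1/2 - \<i> * of_real t)\<^sup>2) / (\<i> * of_int k) = c powi (k - 1) / (1/2 - \<i> * of_real t)\<^sup>2"
      using k by simp
    also have "\<dots> = c powi (k - 1) * (c / ((1/2 - \<i> * of_real t) * (1/2 + \<i> * of_real t)))"
      using nz half_plus_imag[of t] by (simp add: c_def power2_eq_square)
    also have "\<dots> = c powi (k - 1) * c / ((1/2 - \<i> * of_real t) * (1/2 + \<i> * of_real t))" by simp
    also have "c powi (k - 1) * c = c powi k" using c power_int_minus_mult[of c k] by simp
    also have "(1/2 - \<i> * of_real t) * (1/2 + \<i> * of_real t) = complex_of_real (1/4 + t\<^sup>2)"
      by (simp add: algebra_simps power2_eq_square)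
    finally show ?thesis by (simp add: c_def cayley_def)
  qed
  have cont: "isCont ?g t" for t
    unfolding cayley_def using half_plus_imag[of t] cayley_nonzero[of t] pos[of t]
    by (intro continuous_intros) (auto simp: cayley_def)
  have lim: "(cayley \<longlongrightarrow> -1) F" if "F = at_top \<or> F = at_bot" for F
  proof -
    have "((\<lambda>t. cayley t + 1) \<longlongrightarrow> 0) F"
    proof (rule Lim_null_comparison)
      show "\<forall>\<^sub>F t in F. norm (cayley t + 1) \<le> 1 / \<bar>t\<bar>"
      proof (rule eventually_mono)
        show "\<forall>\<^sub>F t in F. t \<noteq> 0" using that eventually_gt_at_top[of 0] eventually_le_at_bot[of "-1"] by (auto elim: eventually_mono)
        fix t :: real assume t: "t \<noteq> 0"
        have "\<bar>t\<bar> \<le> norm (1/2 - \<i> * complex_of_real t)"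
          using abs_Im_le_cmod[of "1/2 - \<i> * complex_of_real t"] by simp
        then show "norm (cayley t + 1) \<le> 1 / \<bar>t\<bar>"
          unfolding cayley_plus_1 norm_divide norm_one using t by (intro frac_le) auto
      qed
      show "((\<lambda>t. 1 / \<bar>t\<bar>) \<longlongrightarrow> 0) F" using that by (auto; real_asymp)
    qed
    from tendsto_add[OF this tendsto_const[of "-1"]] show ?thesis by simp
  qed
  have Glim: "(G \<longlongrightarrow> (-1) powi k / (\<i> * of_int k)) F" if "F = at_top \<or> F = at_bot" for F
    unfolding G_def using k by (intro tendsto_intros lim that) auto
  have "(LBINT t=-\<infinity>..\<infinity>. ?g t) = (-1) powi k / (\<i> * of_int k) - (-1) powi k / (\<i> * of_int k)"
  proof (rule interval_integral_FTC_integrable[where F=G])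
    show "((G \<circ> real_of_ereal) \<longlongrightarrow> (-1) powi k / (\<i> * of_int k)) (at_right (-\<infinity>))"
      using Glim[OF disjI2[OF refl]] by (simp only: ereal_tendsto_simps)
    show "((G \<circ> real_of_ereal) \<longlongrightarrow> (-1) powi k / (\<i> * of_int k)) (at_left \<infinity>)"
      using Glim[OF disjI1[OF refl]] by (simp only: ereal_tendsto_simps)
    show "set_integrable lborel (einterval (-\<infinity>) \<infinity>) ?g"
      using int by (simp add: set_integrable_def)
  qed (use der cont in auto)
  then show ?thesis by (simp add: interval_lebesgue_integral_def set_lebesgue_integral_def)
qed

lemma laguerre_hat_inner:
  "laguerre_hat \<rho> (s + of_int n) t * cnj (laguerre_hat \<rho> (s + of_int m) t) = cayley t powi (n - m) * of_real (1 / (1/4 + t\<^sup>2))"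
proof -
  have "cnj (cayley t powi m) = inverse (cayley t powi m)"
  proof -
    have "norm (cayley t powi m) = 1" by (simp add: norm_power_int)
    then have "cayley t powi m * cnj (cayley t powi m) = 1"
      unfolding complex_norm_square[symmetric] by (simp only: one_power2 of_real_1)
    then show ?thesis by (metis inverse_unique)
  qed
  then have "laguerre_hat \<rho> (s + of_int n) t * cnj (laguerre_hat \<rho> (s + of_int m) t) = (cayley t powi n * inverse (cayley t powi m)) * (laguerre_hat \<rho> s t * cnj (laguerre_hat \<rho> s t))"
    unfolding laguerre_hat_cayley by (simp add: mult_ac)
  also have "cayley t powi n * inverse (cayley t powi m) = cayley t powi (n - m)"
    by (simp add: power_int_diff divide_inverse)
  also have "laguerre_hat \<rho> s t * cnj (laguerre_hat \<rho> s t) = of_real (1 / (1/4 + t\<^sup>2))"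
    by (simp only: complex_norm_square[symmetric] norm_laguerre_hat_sq)
  finally show ?thesis .
qed

text \<open>In the product of one transform with the conjugate of another everything but a power of
  the Cayley map times the Cauchy density cancels. Its integral is 0 or 2 pi, and 2 pi is the
  constant of Plancherel's formula.\<close>

theorem laguerre_fun_orthonormal:
  "(\<integral>x. laguerre_fun \<rho> (s + of_int n) x * cnj (laguerre_fun \<rho> (s + of_int m) x) \<partial>lborel) = (if n = m then 1 else 0)"
proof -
  let ?g = "\<lambda>t. cayley t powi (n - m) * complex_of_real (1 / (1/4 + t\<^sup>2))"
  have int: "integrable lborel ?g"
    by (rule integrable_cayley_power)
  have "(\<integral>t. ?g t \<partial>lborel) = 2 * pi * (\<integral>x. laguerre_fun \<rho> (s + of_int n) x * cnj (laguerre_fun \<rho> (s + of_int m) x) \<partial>lborel)"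
    using parseval[OF isCont_laguerre_fun integrable_laguerre_fun integrable_laguerre_fun_sq integrable_laguerre_fun integrable_laguerre_fun_sq, of \<rho> "s + of_int n" \<rho> "s + of_int m"] int
    unfolding fourier_laguerre_fun laguerre_hat_inner by blast
  moreover have "(\<integral>t. ?g t \<partial>lborel) = (if n = m then 2 * pi else 0)"
  proof (cases "n = m")
    case True
    have "(\<integral>t. complex_of_real (1 / (1/4 + t\<^sup>2)) \<partial>lborel) = of_real (2 * pi)"
      by (simp only: integral_complex_of_real integral_cauchy)
    then show ?thesis using True by simp
  qed (use integral_cayley_power[of "n - m"] in simp)
  ultimately show ?thesis by (auto split: if_splits)
qed

section \<open>Completeness\<close>

text \<open>In the variable y = exp(-x) this is x y times y^j, so polynomials in y are combinations
  of these functions. The factor x makes the transform decay like t^(-2), fast enough to be divided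
  by a \<open>laguerre_hat\<close>.\<close>

definition exp_bump :: "nat \<Rightarrow> real \<Rightarrow> complex" where
  "exp_bump j x = indicator {0<..} x *\<^sub>R of_real (x * exp (- (real (Suc j) * x)))"

lemma exp_bump_measurable [measurable]: "exp_bump j \<in> borel_measurable borel"
  unfolding exp_bump_def by measurable

lemma integrable_exp_bump: "integrable lborel (exp_bump j)"
  and integrable_exp_bump_sq: "integrable lborel (\<lambda>x. (norm (exp_bump j x))\<^sup>2)"
proof -
  have "set_integrable lborel {0<..} (\<lambda>x::real. x powr (2 - 1) * exp (- (real (Suc j) * x)))"
    by (intro set_integrable_powr_exp) auto
  then have "integrable lborel (\<lambda>x. complex_of_real (indicator {0<..} x *\<^sub>R (x powr (2 - 1) * exp (- (real (Suc j) * x)))))"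
    unfolding set_integrable_def by (rule integrable_of_real)
  then show "integrable lborel (exp_bump j)"
    by (rule Bochner_Integration.integrable_cong[THEN iffD1, OF refl, rotated]) (auto simp: exp_bump_def indicator_def)
  have "set_integrable lborel {0<..} (\<lambda>x::real. x powr (3 - 1) * exp (- ((2 * real (Suc j)) * x)))"
    by (intro set_integrable_powr_exp) auto
  then show "integrable lborel (\<lambda>x. (norm (exp_bump j x))\<^sup>2)"
    unfolding set_integrable_def
    by (rule Bochner_Integration.integrable_cong[THEN iffD1, OF refl, rotated])
       (auto simp: exp_bump_def indicator_def norm_mult power_mult_distrib exp_double[symmetric] mult_ac simp del: of_real_exp of_nat_Suc)
qed

lemma isCont_exp_bump: "x \<noteq> 0 \<Longrightarrow> isCont (exp_bump j) x"
proof -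
  assume "x \<noteq> 0"
  then consider "x > 0" | "x < 0" by linarith
  then show ?thesis
  proof cases
    case 1
    have "isCont (\<lambda>x. complex_of_real (x * exp (- (real (Suc j) * x)))) x" by (intro continuous_intros)
    then show ?thesis
      by (rule isCont_cong[THEN iffD1, rotated])
         (use eventually_nhds_in_open[of "{0<..}" x] 1 in \<open>auto elim!: eventually_mono simp: exp_bump_def\<close>)
  next
    case 2
    have "isCont (\<lambda>x. 0::complex) x" by (intro continuous_intros)
    then show ?thesis
      by (rule isCont_cong[THEN iffD1, rotated])
         (use eventually_nhds_in_open[of "{..<0}" x] 2 in \<open>auto elim!: eventually_mono simp: exp_bump_def\<close>)
  qed
qed

lemma fourier_exp_bump: "fourier (exp_bump j) t = 1 / (of_nat (Suc j) + \<i> * of_real t)\<^sup>2"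
proof -
  define w where "w = of_nat (Suc j) + \<i> * complex_of_real t"
  have Rew: "Re w = real (Suc j)" by (simp add: w_def del: of_nat_Suc)
  have w: "w \<noteq> 0" using Rew by auto
  have e: "cis (- (t * x)) * complex_of_real (x * exp (- (real (Suc j) * x))) = of_real x * exp (- w * of_real x)" for x
  proof -
    have "exp (- w * of_real x) = cis (- (t * x)) * of_real (exp (- (real (Suc j) * x)))"
      by (simp add: w_def cis_conv_exp exp_add[symmetric] ring_distribs mult_ac del: of_nat_Suc flip: exp_of_real)
    then show ?thesis by (simp add: mult_ac)
  qed
  have f: "(\<lambda>x. cis (- (t * x)) * exp_bump j x) = (\<lambda>x. indicator {0<..} x *\<^sub>R (of_real x * exp (- w * of_real x)))"
    unfolding exp_bump_def e[symmetric] by (simp add: fun_eq_iff)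
  have int: "set_integrable lborel {0<..} (\<lambda>x. of_real x * exp (- w * of_real x))"
    unfolding set_integrable_def f[symmetric] by (rule integrable_cis_mult[OF integrable_exp_bump])
  define G where "G = (\<lambda>x. - (complex_of_real x / w + 1 / w\<^sup>2) * exp (- w * of_real x))"
  have i: "(complex_of_real has_vector_derivative 1) (at x)" for x
    using has_vector_derivative_of_real[OF DERIV_ident] by simp
  have "(LBINT x:{0<..}. of_real x * exp (- w * of_real x)) = 0 - (- (1 / w\<^sup>2))"
  proof (rule set_integral_FTC_Ioi[where F=G])
    fix x :: real
    have "((\<lambda>z. - (z / w + 1 / w\<^sup>2) * exp (- w * z)) has_field_derivative - (1 / w) * exp (- w * of_real x) + (exp (- w * of_real x) * (- w)) * - (of_real x / w + 1 / w\<^sup>2)) (at (of_real x))"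
      using w by (auto intro!: derivative_eq_intros)
    also have "- (1 / w) * exp (- w * of_real x) + (exp (- w * of_real x) * (- w)) * - (of_real x / w + 1 / w\<^sup>2) = of_real x * exp (- w * of_real x)"
      using w by (simp add: field_simps power2_eq_square)
    finally have "((\<lambda>z. - (z / w + 1 / w\<^sup>2) * exp (- w * z)) has_field_derivative of_real x * exp (- w * of_real x)) (at (of_real x))" .
    from field_vector_diff_chain_at[OF i this] show "(G has_vector_derivative of_real x * exp (- w * of_real x)) (at x)"
      by (simp add: o_def G_def)
    show "isCont (\<lambda>x. complex_of_real x * exp (- w * of_real x)) x" by (intro continuous_intros)
    show "set_integrable lborel {0<..} (\<lambda>x. complex_of_real x * exp (- w * of_real x))" by (rule int)
    have "((\<lambda>x. - (complex_of_real x / w + 1 / w\<^sup>2) * exp (- w * of_real x)) \<longlongrightarrow> - (complex_of_real 0 / w + 1 / w\<^sup>2) * exp (- w * of_real 0)) (at_right 0)"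
      using w by (intro tendsto_intros) auto
    then show "(G \<longlongrightarrow> - (1 / w\<^sup>2)) (at_right 0)" by (simp add: G_def)
    show "(G \<longlongrightarrow> 0) at_top"
    proof (rule Lim_null_comparison)
      show "\<forall>\<^sub>F x in at_top. norm (G x) \<le> (x / norm w + 1 / (norm w)\<^sup>2) * exp (- (real (Suc j) * x))"
        using eventually_ge_at_top[of 0]
      proof eventually_elim
        case (elim x)
        have "norm (complex_of_real x / w + 1 / w\<^sup>2) \<le> x / norm w + 1 / (norm w)\<^sup>2"
          using norm_triangle_ineq[of "complex_of_real x / w" "1 / w\<^sup>2"] elim by (simp add: norm_divide norm_power)
        moreover have "norm (exp (- w * of_real x)) = exp (- (real (Suc j) * x))"
          using Rew by (simp add: norm_exp_eq_Re)
        ultimately show ?case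
          unfolding G_def norm_mult[of _ "exp _"] norm_minus_cancel by (simp only: mult_right_mono exp_ge_zero)
      qed
      have "norm w > 0" "real (Suc j) > 0" using w by auto
      then show "((\<lambda>x. (x / norm w + 1 / (norm w)\<^sup>2) * exp (- (real (Suc j) * x))) \<longlongrightarrow> 0) at_top"
        by real_asymp
    qed
  qed
  then show ?thesis
    unfolding fourier_def f set_lebesgue_integral_def by (simp add: w_def)
qed

section \<open>Trigonometric polynomials\<close>

text \<open>Agreement is asked for on the unit circle alone; there the conjugate of z is its
  inverse, so polynomials in Re z and Im z qualify.\<close>

definition laurent_on_circle :: "(complex \<Rightarrow> complex) \<Rightarrow> bool" where
  "laurent_on_circle f \<longleftrightarrow> (\<exists>I c. finite I \<and> (\<forall>z. norm z = 1 \<longrightarrow> f z = (\<Sum>k\<in>I. c k * z powi k)))"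

lemma laurent_monomial: "laurent_on_circle (\<lambda>z. c * z powi k)"
  unfolding laurent_on_circle_def by (intro exI[of _ "{k}"] exI[of _ "\<lambda>_. c"]) simp

lemma laurent_cong: "laurent_on_circle f \<Longrightarrow> (\<And>z. norm z = 1 \<Longrightarrow> f z = g z) \<Longrightarrow> laurent_on_circle g"
  unfolding laurent_on_circle_def by metis

lemma laurent_add:
  assumes "laurent_on_circle f" "laurent_on_circle g"
  shows "laurent_on_circle (\<lambda>z. f z + g z)"
proof -
  obtain I c J d where I: "finite I" "\<And>z. norm z = 1 \<Longrightarrow> f z = (\<Sum>k\<in>I. c k * z powi k)"
    and J: "finite J" "\<And>z. norm z = 1 \<Longrightarrow> g z = (\<Sum>k\<in>J. d k * z powi k)"
    using assms unfolding laurent_on_circle_def by metis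
  show ?thesis
    unfolding laurent_on_circle_def
  proof (intro exI conjI allI impI)
    show "finite (I \<union> J)" using I J by simp
    fix z :: complex assume z: "norm z = 1"
    have "(\<Sum>k\<in>I. c k * z powi k) = (\<Sum>k\<in>I \<union> J. (if k \<in> I then c k else 0) * z powi k)"
      using I J by (intro sum.mono_neutral_cong_left) auto
    moreover have "(\<Sum>k\<in>J. d k * z powi k) = (\<Sum>k\<in>I \<union> J. (if k \<in> J then d k else 0) * z powi k)"
      using I J by (intro sum.mono_neutral_cong_left) auto
    ultimately show "f z + g z = (\<Sum>k\<in>I \<union> J. ((if k \<in> I then c k else 0) + (if k \<in> J then d k else 0)) * z powi k)"
      using I(2)[OF z] J(2)[OF z] by (simp add: ring_distribs sum.distrib)
  qed
qed

lemma laurent_sum: "finite I \<Longrightarrow> (\<And>i. i \<in> I \<Longrightarrow> laurent_on_circle (f i)) \<Longrightarrow> laurent_on_circle (\<lambda>z. \<Sum>i\<in>I. f i z)"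
proof (induction I rule: finite_induct)
  case empty
  then show ?case using laurent_monomial[of 0 0] by simp
qed (simp add: laurent_add)

lemma laurent_mult:
  assumes "laurent_on_circle f" "laurent_on_circle g"
  shows "laurent_on_circle (\<lambda>z. f z * g z)"
proof -
  obtain I c J d where I: "finite I" "\<And>z. norm z = 1 \<Longrightarrow> f z = (\<Sum>k\<in>I. c k * z powi k)"
    and J: "finite J" "\<And>z. norm z = 1 \<Longrightarrow> g z = (\<Sum>k\<in>J. d k * z powi k)"
    using assms unfolding laurent_on_circle_def by metis
  have "laurent_on_circle (\<lambda>z. \<Sum>k\<in>I. \<Sum>l\<in>J. (c k * d l) * z powi (k + l))"
    using I J by (intro laurent_sum laurent_monomial) auto
  then show ?thesis
  proof (rule laurent_cong)
    fix z :: complex assume z: "norm z = 1"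
    then have "z \<noteq> 0" by auto
    then show "(\<Sum>k\<in>I. \<Sum>l\<in>J. (c k * d l) * z powi (k + l)) = f z * g z"
      unfolding I(2)[OF z] J(2)[OF z] by (simp add: sum_product power_int_add mult_ac)
  qed
qed

lemma laurent_of_polynomial:
  assumes "real_polynomial_function p"
  shows "laurent_on_circle (\<lambda>z. of_real (p z))"
  using assms
proof (induction rule: real_polynomial_function.induct)
  case (linear f)
  \<comment> \<open>From Re z = (z + 1/z)/2 and Im z = (z - 1/z)/(2 i), inserted in f z = Re z f(1)
    + Im z f(i).\<close>
  have "laurent_on_circle (\<lambda>z. ((of_real (f 1) - \<i> * of_real (f \<i>)) / 2) * z powi 1 + ((of_real (f 1) + \<i> * of_real (f \<i>)) / 2) * z powi (-1))"
    by (intro laurent_add laurent_monomial)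
  then show ?case
  proof (rule laurent_cong)
    fix z :: complex assume z: "norm z = 1"
    have "z = Re z *\<^sub>R 1 + Im z *\<^sub>R \<i>" by (simp add: complex_eq_iff)
    then have "f z = f (Re z *\<^sub>R 1 + Im z *\<^sub>R \<i>)" by simp
    then have fz: "f z = Re z * f 1 + Im z * f \<i>"
      using linear by (simp add: bounded_linear.linear linear_add linear_scale)
    have "z * cnj z = 1" using z by (simp add: complex_norm_square[symmetric])
    then have "z powi (-1) = cnj z" by (simp add: power_int_minus inverse_unique)
    then show "((of_real (f 1) - \<i> * of_real (f \<i>)) / 2) * z powi 1 + ((of_real (f 1) + \<i> * of_real (f \<i>)) / 2) * z powi (-1) = of_real (f z)"
      unfolding fz \<open>z powi (-1) = cnj z\<close> power_int_1_right by (simp add: complex_eq_iff field_simps)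
  qed
next
  case (const c)
  show ?case using laurent_monomial[of "of_real c" 0] by simp
qed (auto intro: laurent_add laurent_mult)

lemma laurent_approximation:
  fixes f :: "complex \<Rightarrow> complex"
  assumes "continuous_on (sphere 0 1) f" "e > 0"
  obtains I c where "finite I" "\<And>z. norm z = 1 \<Longrightarrow> norm (f z - (\<Sum>k\<in>I. c k * z powi k)) < e"
proof -
  obtain g where g: "polynomial_function g" "\<And>z. z \<in> sphere 0 1 \<Longrightarrow> norm (f z - g z) < e"
    using Stone_Weierstrass_polynomial_function[OF compact_sphere assms] by blast
  have "real_polynomial_function (\<lambda>z. Re (g z))" "real_polynomial_function (\<lambda>z. Im (g z))"
    using g(1) bounded_linear_Re bounded_linear_Im unfolding polynomial_function_def by (auto simp: o_def)
  then have "laurent_on_circle (\<lambda>z. of_real (Re (g z)) + (\<i> * z powi 0) * of_real (Im (g z)))"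
    by (intro laurent_add laurent_mult laurent_monomial laurent_of_polynomial)
  then have "laurent_on_circle g"
    by (rule laurent_cong) (simp add: complex_eq[symmetric])
  then show ?thesis using g(2) that unfolding laurent_on_circle_def by (metis dist_0_norm mem_sphere)
qed

text \<open>A bounded function of \<open>y = exp (- x)\<close> is an almost everywhere limit of continuous functions,
  and these are uniform limits of polynomials in \<open>y\<close>.\<close>
lemma half_line_density:
  fixes g :: "real \<Rightarrow> complex"
  assumes [measurable]: "g \<in> borel_measurable borel" and g2: "integrable lborel (\<lambda>x. (norm (g x))\<^sup>2)"
    and g0: "\<And>x. x \<le> 0 \<Longrightarrow> g x = 0" and \<delta>: "\<delta> > 0"
  obtains d :: nat and a where "(\<integral>x. (norm (g x - (\<Sum>j\<le>d. a j * exp_bump j x)))\<^sup>2 \<partial>lborel) < \<delta>"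
proof -
  \<comment> \<open>Truncation away from 0 and infinity, in x and in the values, makes the quotient
    by x exp(-x) bounded.\<close>
  define gR where "gR = (\<lambda>n x. if 1 / real (Suc n) \<le> x \<and> x \<le> real (Suc n) \<and> norm (g x) \<le> real (Suc n) then g x else 0)"
  have [measurable]: "gR n \<in> borel_measurable borel" for n unfolding gR_def by measurable
  have gR2: "integrable lborel (\<lambda>x. (norm (gR n x))\<^sup>2)" for n
    by (rule Bochner_Integration.integrable_bound[OF g2]) (auto simp: gR_def)
  have "(\<lambda>n. \<integral>x. (norm (g x - gR n x))\<^sup>2 \<partial>lborel) \<longlonglongrightarrow> (\<integral>x. 0 \<partial>(lborel :: real measure))"
  proof (rule integral_dominated_convergence[OF _ _ g2])
    show "AE x in lborel. norm ((norm (g x - gR n x))\<^sup>2) \<le> (norm (g x))\<^sup>2" for n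
      by (auto simp: gR_def)
    show "AE x in lborel. (\<lambda>n. (norm (g x - gR n x))\<^sup>2) \<longlonglongrightarrow> 0"
    proof (rule AE_I2)
      fix x :: real
      show "(\<lambda>n. (norm (g x - gR n x))\<^sup>2) \<longlonglongrightarrow> 0"
      proof (cases "x > 0")
        case True
        obtain N where N: "real N \<ge> max (1 / x) (max x (norm (g x)))" using real_arch_simple by blast
        have "gR n x = g x" if "n \<ge> N" for n
        proof -
          have n: "1 / x \<le> real (Suc n)" "x \<le> real (Suc n)" "norm (g x) \<le> real (Suc n)" using N that by auto
          then have "1 / real (Suc n) \<le> x" using True by (simp add: divide_le_eq mult.commute del: of_nat_Suc)
          with n show ?thesis by (simp add: gR_def)
        qed
        then have "\<forall>\<^sub>F n in sequentially. 0 = (norm (g x - gR n x))\<^sup>2"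
          by (intro eventually_sequentiallyI[of N]) simp
        then show ?thesis by (rule Lim_transform_eventually[OF tendsto_const])
      next
        case False
        then have "g x = 0" using g0[of x] by simp
        then have "gR n x = 0" for n unfolding gR_def by (simp only: if_cancel)
        with \<open>g x = 0\<close> show ?thesis by simp
      qed
    qed
  qed measurable
  then have "(\<lambda>n. \<integral>x. (norm (g x - gR n x))\<^sup>2 \<partial>lborel) \<longlonglongrightarrow> 0" by simp
  then have "\<forall>\<^sub>F n in sequentially. (\<integral>x. (norm (g x - gR n x))\<^sup>2 \<partial>lborel) < \<delta> / 4"
    by (rule order_tendstoD(2)) (use \<delta> in simp)
  then obtain n where n: "(\<integral>x. (norm (g x - gR n x))\<^sup>2 \<partial>lborel) < \<delta> / 4"
    using eventually_happens'[OF sequentially_bot] by blast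
  define R where "R = real (Suc n)"
  have R: "R \<ge> 1" by (simp add: R_def)
  \<comment> \<open>The quotient of \<open>gR n\<close> by x exp(-x), as a function of y = exp(-x);
    positive x corresponds to 0 < y < 1.\<close>
  define v where "v = (\<lambda>y. if 0 < y \<and> y < 1 then gR n (- ln y) / of_real (- ln y * y) else 0)"
  \<comment> \<open>On the support x >= 1/R and x <= R, so x exp(-x) >= exp(-R)/R, while the
    numerator is at most R.\<close>
  define B where "B = R * R * exp R"
  have B: "B \<ge> 0" using R by (simp add: B_def)
  have vB: "norm (v y) \<le> B" for y
  proof (cases "0 < y \<and> y < 1 \<and> gR n (- ln y) \<noteq> 0")
    case True
    then have y: "0 < y" "1 / R \<le> - ln y" "- ln y \<le> R" "norm (gR n (- ln y)) \<le> R"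
      by (auto simp: gR_def R_def split: if_splits)
    have "exp (- R) \<le> y" using y(1,3) by (metis exp_le_cancel_iff exp_ln minus_le_iff)
    then have "1 / R * exp (- R) \<le> - ln y * y" using y R True by (intro mult_mono) auto
    moreover have "0 < 1 / R * exp (- R)" using R by simp
    ultimately have "norm (gR n (- ln y)) / (- ln y * y) \<le> R / (1 / R * exp (- R))"
      using y R by (intro frac_le) auto
    also have "\<dots> = B" by (simp add: B_def exp_minus field_simps)
    finally have q: "norm (gR n (- ln y)) / (- ln y * y) \<le> B" .
    have p: "\<bar>- ln y * y\<bar> = - ln y * y"
      using \<open>1 / R * exp (- R) \<le> - ln y * y\<close> \<open>0 < 1 / R * exp (- R)\<close> by linarith
    have "0 < y \<and> y < 1" using True by blast
    then have "v y = gR n (- ln y) / of_real (- ln y * y)" by (simp only: v_def if_True simp_thms)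
    then have "norm (v y) = norm (gR n (- ln y)) / (- ln y * y)"
      by (simp only: norm_divide norm_of_real p)
    with q show ?thesis by simp
  qed (auto simp: v_def B)
  have gRv: "gR n x = of_real (x * exp (- x)) * v (exp (- x))" if "x > 0" for x
    using that by (simp add: v_def)
  have [measurable]: "v \<in> borel_measurable borel" unfolding v_def by measurable
  have "v measurable_on UNIV"
  proof -
    have "v \<in> borel_measurable lborel" by simp
    then have "v \<in> borel_measurable lebesgue" by (rule measurable_completion)
    then show ?thesis by (simp add: measurable_on_iff_borel_measurable lebesgue_on_UNIV_eq)
  qed
  then obtain N vn where N: "negligible N" and vn: "\<And>m. continuous_on UNIV (vn m)" "\<And>y. y \<notin> N \<Longrightarrow> (\<lambda>m. vn m y) \<longlonglongrightarrow> v y"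
    unfolding measurable_on_def by auto
  \<comment> \<open>Projection onto the ball keeps continuity and the limit \<open>v y\<close>,
    which already lies in the ball, and adds the uniform bound needed for dominated
    convergence.\<close>
  define c where "c = (\<lambda>m y. closest_point (cball 0 B) (vn m y))"
  have cc: "continuous_on UNIV (c m)" for m
    unfolding c_def using B by (intro continuous_on_compose2[OF continuous_on_closest_point vn(1)]) auto
  have cB: "norm (c m y) \<le> B" for m y
    using closest_point_in_set[of "cball 0 B" "vn m y"] B by (auto simp: c_def)
  have cl: "(\<lambda>m. c m y) \<longlonglongrightarrow> v y" if "y \<notin> N" for y
  proof -
    have "continuous_on UNIV (closest_point (cball (0::complex) B))"
      using B by (intro continuous_on_closest_point) auto
    then have "isCont (closest_point (cball (0::complex) B)) (v y)"
      by (simp add: continuous_on_eq_continuous_at)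
    from isCont_tendsto_compose[OF this vn(2)[OF that]]
    have "(\<lambda>m. c m y) \<longlonglongrightarrow> closest_point (cball 0 B) (v y)" by (simp add: c_def)
    also have "closest_point (cball 0 B) (v y) = v y" using vB by (intro closest_point_self) auto
    finally show ?thesis .
  qed
  have [measurable]: "c m \<in> borel_measurable borel" for m by (rule borel_measurable_continuous_onI[OF cc])
  define b where "b = (\<lambda>m x. indicator {0<..} x *\<^sub>R (of_real (x * exp (- x)) * c m (exp (- x))))"
  have [measurable]: "b m \<in> borel_measurable borel" for m unfolding b_def by measurable
  have e0: "exp_bump 0 x = indicator {0<..} x *\<^sub>R of_real (x * exp (- x))" for x by (simp add: exp_bump_def)
  have b_e0: "b m x = exp_bump 0 x * c m (exp (- x))" for m x by (simp add: b_def e0)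
  have b2: "integrable lborel (\<lambda>x. (norm (b m x))\<^sup>2)" for m
  proof (rule Bochner_Integration.integrable_bound)
    show "integrable lborel (\<lambda>x. B\<^sup>2 * (norm (exp_bump 0 x))\<^sup>2)" using integrable_exp_bump_sq[of 0] by simp
    show "AE x in lborel. norm ((norm (b m x))\<^sup>2) \<le> norm (B\<^sup>2 * (norm (exp_bump 0 x))\<^sup>2)"
    proof (rule AE_I2)
      fix x
      have "(norm (exp_bump 0 x))\<^sup>2 * (norm (c m (exp (- x))))\<^sup>2 \<le> (norm (exp_bump 0 x))\<^sup>2 * B\<^sup>2"
        using cB by (intro mult_left_mono power_mono) auto
      then show "norm ((norm (b m x))\<^sup>2) \<le> norm (B\<^sup>2 * (norm (exp_bump 0 x))\<^sup>2)"
        by (simp add: b_e0 norm_mult power_mult_distrib mult.commute)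
    qed
  qed measurable
  have gRe: "gR n x = exp_bump 0 x * v (exp (- x))" for x
  proof (cases "x > 0")
    case False
    then show ?thesis using g0[of x] by (simp add: gR_def e0)
  qed (simp add: gRv e0)
  \<comment> \<open>The exceptional set lives in the variable y; its preimage is its image under the
    differentiable map y -> -ln y and hence negligible.\<close>
  have AE: "AE x in lborel. exp (- x) \<notin> N"
  proof -
    have "negligible ((\<lambda>y. - ln y) ` (N \<inter> {0<..}))"
    proof (rule negligible_differentiable_image_negligible)
      show "negligible (N \<inter> {0<..})" using N by (rule negligible_subset) auto
      show "(\<lambda>y. - ln y) differentiable_on (N \<inter> {0<..})"
        unfolding differentiable_on_def
      proof
        fix y assume "y \<in> N \<inter> {0<..}"
        then have "DERIV (\<lambda>y. - ln y) y :> - (1 / y)" by (auto intro!: derivative_eq_intros)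
        then show "(\<lambda>y. - ln y) differentiable at y within N \<inter> {0<..}"
          by (meson differentiable_at_withinI real_differentiable_def)
      qed
    qed simp
    then have "negligible {x. exp (- x) \<in> N}"
    proof (rule negligible_subset)
      show "{x. exp (- x) \<in> N} \<subseteq> (\<lambda>y. - ln y) ` (N \<inter> {0<..})"
      proof
        fix x assume "x \<in> {x. exp (- x) \<in> N}"
        then have "exp (- x) \<in> N \<inter> {0<..}" "x = - ln (exp (- x))" by auto
        then show "x \<in> (\<lambda>y. - ln y) ` (N \<inter> {0<..})" by blast
      qed
    qed
    then have "AE x in lebesgue. x \<notin> {x. exp (- x) \<in> N}"
      by (intro AE_not_in) (simp add: negligible_iff_null_sets)
    then show ?thesis by (simp add: AE_completion_iff)
  qed
  have "(\<lambda>m. \<integral>x. (norm (gR n x - b m x))\<^sup>2 \<partial>lborel) \<longlonglongrightarrow> (\<integral>x. 0 \<partial>(lborel :: real measure))"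
  proof (rule integral_dominated_convergence)
    show "integrable lborel (\<lambda>x. (2 * B)\<^sup>2 * (norm (exp_bump 0 x))\<^sup>2)" using integrable_exp_bump_sq[of 0] by simp
    show "AE x in lborel. norm ((norm (gR n x - b m x))\<^sup>2) \<le> (2 * B)\<^sup>2 * (norm (exp_bump 0 x))\<^sup>2" for m
    proof (rule AE_I2)
      fix x
      have "norm (v (exp (- x)) - c m (exp (- x))) \<le> 2 * B"
        using norm_triangle_ineq4[of "v (exp (- x))" "c m (exp (- x))"] vB[of "exp (- x)"] cB[of m "exp (- x)"] by linarith
      then have "(norm (v (exp (- x)) - c m (exp (- x))))\<^sup>2 \<le> (2 * B)\<^sup>2" by (intro power_mono) auto
      then have "(norm (exp_bump 0 x))\<^sup>2 * (norm (v (exp (- x)) - c m (exp (- x))))\<^sup>2 \<le> (norm (exp_bump 0 x))\<^sup>2 * (2 * B)\<^sup>2"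
        by (intro mult_left_mono) auto
      moreover have "gR n x - b m x = exp_bump 0 x * (v (exp (- x)) - c m (exp (- x)))" by (simp add: gRe b_e0 ring_distribs)
      ultimately show "norm ((norm (gR n x - b m x))\<^sup>2) \<le> (2 * B)\<^sup>2 * (norm (exp_bump 0 x))\<^sup>2"
        by (simp only: norm_mult power_mult_distrib real_norm_def abs_power2 mult.commute)
           (simp add: norm_mult power_mult_distrib mult.commute)
    qed
    show "AE x in lborel. (\<lambda>m. (norm (gR n x - b m x))\<^sup>2) \<longlonglongrightarrow> 0"
      using AE
    proof eventually_elim
      case (elim x)
      have "(\<lambda>m. (norm (exp_bump 0 x * (v (exp (- x)) - c m (exp (- x)))))\<^sup>2) \<longlonglongrightarrow> (norm (exp_bump 0 x * (v (exp (- x)) - v (exp (- x)))))\<^sup>2"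
        by (intro tendsto_intros cl elim)
      then show ?case by (simp add: gRe b_e0 ring_distribs)
    qed
  qed measurable
  then have "(\<lambda>m. \<integral>x. (norm (gR n x - b m x))\<^sup>2 \<partial>lborel) \<longlonglongrightarrow> 0" by simp
  then have "\<forall>\<^sub>F m in sequentially. (\<integral>x. (norm (gR n x - b m x))\<^sup>2 \<partial>lborel) < \<delta> / 16"
    by (rule order_tendstoD(2)) (use \<delta> in simp)
  then obtain m where m: "(\<integral>x. (norm (gR n x - b m x))\<^sup>2 \<partial>lborel) < \<delta> / 16"
    using eventually_happens'[OF sequentially_bot] by blast
  define S where "S = (\<integral>x. (norm (exp_bump 0 x))\<^sup>2 \<partial>lborel)"
  have S: "S \<ge> 0" by (simp add: S_def)
  \<comment> \<open>A uniform error e in y costs at most e^2 S in the squared norm, and this choice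
    makes that at most \<delta>/16.\<close>
  define e where "e = sqrt (\<delta> / (16 * (S + 1)))"
  have e: "e > 0" using \<delta> S by (simp add: e_def)
  obtain q where q: "polynomial_function q" "\<And>y. y \<in> {0..1} \<Longrightarrow> norm (c m y - q y) < e"
    using Stone_Weierstrass_polynomial_function[OF compact_Icc continuous_on_subset[OF cc subset_UNIV] e, of 0 1 m] by blast
  have rp: "real_polynomial_function (\<lambda>y. Re (q y))" "real_polynomial_function (\<lambda>y. Im (q y))"
    using q(1) bounded_linear_Re bounded_linear_Im unfolding polynomial_function_def by (auto simp: o_def)
  obtain a1 d1 where "(\<lambda>y. Re (q y)) = (\<lambda>y. \<Sum>i\<le>d1. a1 i * y ^ i)"
    using real_polynomial_function_imp_sum[OF rp(1)] by blast
  then have q1: "Re (q y) = (\<Sum>i\<le>d1. a1 i * y ^ i)" for y by (rule fun_cong)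
  obtain a2 d2 where "(\<lambda>y. Im (q y)) = (\<lambda>y. \<Sum>i\<le>d2. a2 i * y ^ i)"
    using real_polynomial_function_imp_sum[OF rp(2)] by blast
  then have q2: "Im (q y) = (\<Sum>i\<le>d2. a2 i * y ^ i)" for y by (rule fun_cong)
  define d where "d = max d1 d2"
  define a where "a = (\<lambda>i. Complex (if i \<le> d1 then a1 i else 0) (if i \<le> d2 then a2 i else 0))"
  have qa: "q y = (\<Sum>i\<le>d. a i * of_real y ^ i)" for y :: real
  proof -
    have "(\<Sum>i\<le>d1. a1 i * y ^ i) = (\<Sum>i\<le>d. Re (a i) * y ^ i)"
      by (intro sum.mono_neutral_cong_left) (auto simp: d_def a_def)
    moreover have "(\<Sum>i\<le>d2. a2 i * y ^ i) = (\<Sum>i\<le>d. Im (a i) * y ^ i)"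
      by (intro sum.mono_neutral_cong_left) (auto simp: d_def a_def)
    moreover have "Re (a i * of_real y ^ i) = Re (a i) * y ^ i" "Im (a i * of_real y ^ i) = Im (a i) * y ^ i" for i
      by (simp_all flip: of_real_power)
    ultimately show ?thesis by (simp add: complex_eq_iff q1 q2)
  qed
  define h where "h = (\<lambda>x. \<Sum>j\<le>d. a j * exp_bump j x)"
  have hq: "h x = exp_bump 0 x * q (exp (- x))" for x
  proof -
    have hj: "a j * exp_bump j x = exp_bump 0 x * (a j * of_real (exp (- x)) ^ j)" for j
    proof -
      have "exp (- (real (Suc j) * x)) = exp (- x) * exp (- x) ^ j"
        by (simp add: exp_of_nat_mult[symmetric] exp_add[symmetric] algebra_simps)
      then show ?thesis by (simp add: exp_bump_def mult_ac del: of_nat_Suc of_real_exp)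
    qed
    show ?thesis
      unfolding h_def qa sum_distrib_left by (intro sum.cong refl hj)
  qed
  have [measurable]: "h \<in> borel_measurable borel" unfolding h_def by measurable
  have bh: "(norm (b m x - h x))\<^sup>2 \<le> e\<^sup>2 * (norm (exp_bump 0 x))\<^sup>2" for x
  proof (cases "x > 0")
    case True
    then have "norm (c m (exp (- x)) - q (exp (- x))) < e" by (intro q(2)) auto
    then have "(norm (exp_bump 0 x))\<^sup>2 * (norm (c m (exp (- x)) - q (exp (- x))))\<^sup>2 \<le> (norm (exp_bump 0 x))\<^sup>2 * e\<^sup>2"
      by (intro mult_left_mono power_mono) auto
    moreover have "b m x - h x = exp_bump 0 x * (c m (exp (- x)) - q (exp (- x)))" by (simp add: hq b_e0 ring_distribs)
    ultimately show ?thesis by (simp add: norm_mult power_mult_distrib mult.commute)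
  qed (simp add: hq b_e0 e0)
  have bh2: "integrable lborel (\<lambda>x. (norm (b m x - h x))\<^sup>2)"
    by (rule Bochner_Integration.integrable_bound[OF integrable_mult_right[OF integrable_exp_bump_sq[of 0], of "e\<^sup>2"]])
       (auto intro!: AE_I2 order.trans[OF bh])
  have h2: "integrable lborel (\<lambda>x. (norm (h x))\<^sup>2)"
    using integrable_diff_sq[of "b m" lborel "\<lambda>x. b m x - h x"] b2[of m] bh2 by simp
  have "(\<integral>x. (norm (b m x - h x))\<^sup>2 \<partial>lborel) \<le> (\<integral>x. e\<^sup>2 * (norm (exp_bump 0 x))\<^sup>2 \<partial>lborel)"
    by (intro integral_mono bh2 bh integrable_mult_right integrable_exp_bump_sq)
  also have "\<dots> = e\<^sup>2 * S" by (simp add: S_def)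
  also have "\<dots> = \<delta> / 16 * (S / (S + 1))" using \<delta> S by (simp add: e_def field_simps)
  also have "\<dots> \<le> \<delta> / 16" using \<delta> S by (intro mult_left_le) auto
  finally have 3: "(\<integral>x. (norm (b m x - h x))\<^sup>2 \<partial>lborel) \<le> \<delta> / 16" .
  have "(\<integral>x. (norm (gR n x - h x))\<^sup>2 \<partial>lborel) \<le> 2 * (\<integral>x. (norm (gR n x - b m x))\<^sup>2 \<partial>lborel) + 2 * (\<integral>x. (norm (b m x - h x))\<^sup>2 \<partial>lborel)"
    by (intro integral_diff_sq_le gR2 b2 h2) measurable
  moreover have "(\<integral>x. (norm (g x - h x))\<^sup>2 \<partial>lborel) \<le> 2 * (\<integral>x. (norm (g x - gR n x))\<^sup>2 \<partial>lborel) + 2 * (\<integral>x. (norm (gR n x - h x))\<^sup>2 \<partial>lborel)"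
    by (intro integral_diff_sq_le g2 gR2 h2) measurable
  \<comment> \<open>The two triangle inequalities add up to 2 (\<delta>/4) + 4 (\<delta>/16) + 4
    (\<delta>/16) = \<delta>, with a strict first term.\<close>
  ultimately have "(\<integral>x. (norm (g x - h x))\<^sup>2 \<partial>lborel) < \<delta>" using n m 3 by linarith
  then show ?thesis using that[of a d] by (simp add: h_def)
qed

lemma laguerre_hat_nonzero: "laguerre_hat \<rho> s t \<noteq> 0"
proof
  assume "laguerre_hat \<rho> s t = 0"
  then have "1 / (1/4 + t\<^sup>2) = 0" using norm_laguerre_hat_sq[of \<rho> s t] by simp
  moreover have "1/4 + t\<^sup>2 > 0" by (intro add_pos_nonneg) auto
  ultimately show False by simp
qed

lemma isCont_laguerre_hat: "isCont (laguerre_hat \<rho> s) t"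
  using laguerre_hat_deriv by (rule has_vector_derivative_continuous)

section \<open>Transport to the circle and density\<close>

text \<open>For z = exp(i \<theta>) this is tan(\<theta>/2)/2, stereographic projection from -1. At
  z = -1 the default value 0 of the division results.\<close>

definition inverse_cayley :: "complex \<Rightarrow> real" where
  "inverse_cayley z = Im z / (2 * (1 + Re z))"

lemma inverse_cayley_cayley: "inverse_cayley (cayley t) = t"
proof -
  have p: "1/4 + t\<^sup>2 > 0" by (intro add_pos_nonneg) auto
  have "cayley t = (1/2 + \<i> * of_real t)\<^sup>2 / of_real (1/4 + t\<^sup>2)"
  proof -
    have "(1/2 - \<i> * of_real t) * (1/2 + \<i> * of_real t) = complex_of_real (1/4 + t\<^sup>2)"
      by (simp add: algebra_simps power2_eq_square)
    moreover have "x / y = x\<^sup>2 / (y * x)" if "x \<noteq> 0" for x y :: complex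
      using that by (simp add: power2_eq_square)
    ultimately show ?thesis unfolding cayley_def using half_plus_imag(2)[of t] by metis
  qed
  also have "(1/2 + \<i> * of_real t)\<^sup>2 = Complex (1/4 - t\<^sup>2) t"
    by (simp add: complex_eq_iff power2_eq_square)
  finally have c: "Re (cayley t) = (1/4 - t\<^sup>2) / (1/4 + t\<^sup>2)" "Im (cayley t) = t / (1/4 + t\<^sup>2)"
    by (simp_all only: Re_divide_of_real Im_divide_of_real complex.sel)
  have "1 + Re (cayley t) = (1/2) / (1/4 + t\<^sup>2)" unfolding c(1) using p by (simp add: field_simps)
  moreover have "t / q / (2 * (1 / 2 / q)) = t" if "q > 0" for q :: real using that by simp
  ultimately show ?thesis unfolding inverse_cayley_def c(2) using p by (simp only:)
qed

text \<open>With t the inverse image of z, |z + 1|^2 = 1/(1/4 + t^2), the squared modulus of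
  \<open>laguerre_hat\<close>: decay at infinity becomes a zero at -1.\<close>

lemma norm_plus_1_inverse_cayley:
  assumes "norm z = 1" "z \<noteq> -1"
  shows "1 + Re z > 0" "(norm (z + 1))\<^sup>2 * (1/4 + (inverse_cayley z)\<^sup>2) = 1"
proof -
  have n: "(Re z)\<^sup>2 + (Im z)\<^sup>2 = 1" using assms(1) cmod_power2[of z] by simp
  have "Re z \<ge> -1" using abs_Re_le_cmod[of z] assms(1) by linarith
  moreover have "Re z \<noteq> -1"
  proof
    assume "Re z = -1"
    with n have "Im z = 0" by simp
    with \<open>Re z = -1\<close> assms(2) show False by (simp add: complex_eq_iff)
  qed
  ultimately show p: "1 + Re z > 0" by linarith
  have "(norm (z + 1))\<^sup>2 = (Re z)\<^sup>2 + (Im z)\<^sup>2 + 2 * Re z + 1"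
    unfolding cmod_power2 by (simp add: power2_eq_square algebra_simps)
  then have 1: "(norm (z + 1))\<^sup>2 = 2 * (1 + Re z)" using n by simp
  have "(Im z)\<^sup>2 = (1 + Re z) * (1 - Re z)" using n by (simp add: algebra_simps power2_eq_square)
  then have "(inverse_cayley z)\<^sup>2 = (1 - Re z) / (4 * (1 + Re z))"
    unfolding inverse_cayley_def power_divide power_mult_distrib using p by (simp add: power2_eq_square divide_simps)
  then show "(norm (z + 1))\<^sup>2 * (1/4 + (inverse_cayley z)\<^sup>2) = 1"
    unfolding 1 using p by (simp add: field_simps)
qed

text \<open>Transported to the circle by the Cayley map, the quotient extends continuously by 0 to \<open>-1\<close>;
  a Laurent polynomial in \<open>cayley t\<close> times \<open>laguerre_hat\<close> is a combination of the shifted functions.\<close>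
lemma laguerre_hat_approximation:
  assumes cont: "\<And>t. isCont H t" and bound: "\<And>t. norm (H t) \<le> C / (1/4 + t\<^sup>2)" and e: "e > 0"
  obtains I c where "finite I" "\<And>t. (norm (H t - (\<Sum>k\<in>I. c k * laguerre_hat \<rho> (s + of_int k) t)))\<^sup>2 \<le> e\<^sup>2 * (1 / (1/4 + t\<^sup>2))"
proof -
  define \<Psi> where "\<Psi> = (\<lambda>z. if z = -1 then 0 else H (inverse_cayley z) / laguerre_hat \<rho> s (inverse_cayley z))"
  have pos: "1/4 + t\<^sup>2 > 0" for t :: real by (intro add_pos_nonneg) auto
  have C: "C \<ge> 0" using order.trans[OF norm_ge_zero bound[of 0]] by (simp add: zero_le_divide_iff)
  \<comment> \<open>The numerator is at most C r^2 and the denominator has modulus r = |z + 1|, so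
    the quotient vanishes at -1 to first order; this is why decay like t^(-2) is required.\<close>
  have \<Psi>b: "norm (\<Psi> z) \<le> C * norm (z + 1)" if z: "norm z = 1" for z
  proof (cases "z = -1")
    case False
    let ?t = "inverse_cayley z"
    define r where "r = norm (z + 1)"
    have r: "r > 0" using False by (simp add: r_def add_eq_0_iff2)
    have r2: "1 / (1/4 + ?t\<^sup>2) = r\<^sup>2"
      using norm_plus_1_inverse_cayley(2)[OF z False] pos[of ?t] by (simp add: r_def field_simps)
    have "(norm (laguerre_hat \<rho> s ?t))\<^sup>2 = r\<^sup>2" unfolding norm_laguerre_hat_sq by (rule r2)
    then have "norm (laguerre_hat \<rho> s ?t) = r" using r by (simp add: power2_eq_iff_nonneg)
    moreover have "norm (H ?t) \<le> C * r\<^sup>2" using bound[of ?t] r2 by (metis mult.right_neutral times_divide_eq_right)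
    ultimately have "norm (\<Psi> z) \<le> C * r\<^sup>2 / r" using False r by (simp add: \<Psi>_def norm_divide divide_right_mono)
    then show ?thesis using r by (simp add: r_def power2_eq_square)
  qed (simp add: \<Psi>_def)
  have "continuous_on (sphere 0 1) \<Psi>"
    unfolding continuous_on_eq_continuous_within
  proof
    fix z :: complex assume "z \<in> sphere 0 1"
    then have z: "norm z = 1" by simp
    show "continuous (at z within sphere 0 1) \<Psi>"
    proof (cases "z = -1")
      case True
      have "((\<lambda>z::complex. C * norm (z + 1)) \<longlongrightarrow> C * norm (-1 + 1 :: complex)) (at (-1) within sphere 0 1)"
        by (intro tendsto_mult tendsto_norm tendsto_add tendsto_const tendsto_ident_at)
      then have "((\<lambda>z::complex. C * norm (z + 1)) \<longlongrightarrow> 0) (at (-1) within sphere 0 1)" by simp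
      then have "(\<Psi> \<longlongrightarrow> 0) (at (-1) within sphere 0 1)"
        by (rule Lim_null_comparison[rotated]) (use \<Psi>b in \<open>auto simp: eventually_at_filter\<close>)
      then show ?thesis using True by (simp add: continuous_within \<Psi>_def)
    next
      case False
      have p: "1 + Re z > 0" by (rule norm_plus_1_inverse_cayley(1)[OF z False])
      have ic: "isCont inverse_cayley z"
        unfolding inverse_cayley_def using p by (intro continuous_intros) auto
      have "isCont (\<lambda>z. H (inverse_cayley z) / laguerre_hat \<rho> s (inverse_cayley z)) z"
        by (intro continuous_divide isCont_o2[OF ic cont] isCont_o2[OF ic isCont_laguerre_hat] laguerre_hat_nonzero)
      then have "isCont \<Psi> z"
        by (rule isCont_cong[THEN iffD1, rotated])
           (rule eventually_mono[OF t1_space_nhds[OF False]], simp add: \<Psi>_def)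
      then show ?thesis by (rule continuous_at_imp_continuous_within)
    qed
  qed
  from laurent_approximation[OF this e] obtain I c where I: "finite I" "\<And>z. norm z = 1 \<Longrightarrow> norm (\<Psi> z - (\<Sum>k\<in>I. c k * z powi k)) < e" by blast
  show ?thesis
  proof (rule that[OF I(1), of c])
    fix t
    have cn: "cayley t \<noteq> -1"
      using cayley_plus_1[of t] half_plus_imag[of t] by (auto simp: add_eq_0_iff)
    have "\<Psi> (cayley t) * laguerre_hat \<rho> s t = H t"
      using cn laguerre_hat_nonzero by (simp add: \<Psi>_def inverse_cayley_cayley)
    then have "H t - (\<Sum>k\<in>I. c k * laguerre_hat \<rho> (s + of_int k) t) = (\<Psi> (cayley t) - (\<Sum>k\<in>I. c k * cayley t powi k)) * laguerre_hat \<rho> s t"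
      by (simp add: laguerre_hat_cayley ring_distribs sum_distrib_left mult_ac)
    then have "(norm (H t - (\<Sum>k\<in>I. c k * laguerre_hat \<rho> (s + of_int k) t)))\<^sup>2 = (norm (\<Psi> (cayley t) - (\<Sum>k\<in>I. c k * cayley t powi k)))\<^sup>2 * (1 / (1/4 + t\<^sup>2))"
      by (simp add: norm_mult power_mult_distrib norm_laguerre_hat_sq)
    also have "\<dots> \<le> e\<^sup>2 * (1 / (1/4 + t\<^sup>2))"
      using I(2)[of "cayley t"] pos[of t] by (intro mult_right_mono power_mono) auto
    finally show "(norm (H t - (\<Sum>k\<in>I. c k * laguerre_hat \<rho> (s + of_int k) t)))\<^sup>2 \<le> e\<^sup>2 * (1 / (1/4 + t\<^sup>2))" .
  qed
qed

lemma integrable_sum_sq: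
  fixes f :: "'i \<Rightarrow> 'a \<Rightarrow> complex"
  assumes "finite I" "\<And>i. i \<in> I \<Longrightarrow> f i \<in> borel_measurable M" "\<And>i. i \<in> I \<Longrightarrow> integrable M (\<lambda>x. (norm (f i x))\<^sup>2)"
  shows "integrable M (\<lambda>x. (norm (\<Sum>i\<in>I. c i * f i x))\<^sup>2)"
  using assms
proof (induction I rule: finite_induct)
  case (insert i I)
  have "integrable M (\<lambda>x. (norm ((\<Sum>i\<in>I. c i * f i x) - - (c i * f i x)))\<^sup>2)"
    using insert by (intro integrable_diff_sq) (auto simp: norm_mult power_mult_distrib)
  then show ?case using insert by (simp add: add.commute)
qed simp

lemma parseval_norm:
  assumes "\<And>x. x \<noteq> 0 \<Longrightarrow> isCont F x" "integrable lborel F" "integrable lborel (\<lambda>x. (norm (F x))\<^sup>2)"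
    and "integrable lborel (\<lambda>t. (norm (fourier F t))\<^sup>2)"
  shows "(\<integral>t. (norm (fourier F t))\<^sup>2 \<partial>lborel) = 2 * pi * (\<integral>x. (norm (F x))\<^sup>2 \<partial>lborel)"
proof -
  have "integrable lborel (\<lambda>t. complex_of_real ((norm (fourier F t))\<^sup>2))"
    using assms(4) by (rule integrable_of_real)
  then have "(\<integral>t. complex_of_real ((norm (fourier F t))\<^sup>2) \<partial>lborel) = 2 * pi * (\<integral>x. complex_of_real ((norm (F x))\<^sup>2) \<partial>lborel)"
    using parseval[OF assms(1-3) assms(2,3)] unfolding complex_norm_square by blast
  then have "complex_of_real (\<integral>t. (norm (fourier F t))\<^sup>2 \<partial>lborel) = of_real (2 * pi * (\<integral>x. (norm (F x))\<^sup>2 \<partial>lborel))"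
    unfolding integral_complex_of_real by simp
  then show ?thesis by (simp only: of_real_eq_iff)
qed

text \<open>Uniform approximation on the circle needs a continuous transform decaying like t^(-2),
  which a general g does not have. Hence g is replaced by a combination h of \<open>exp_bump\<close>
  functions and their reflections. Plancherel's formula is then applied to h minus a finite sum, a
  difference of integrable functions, so the transform never has to be extended to all of
  L2.\<close>

theorem laguerre_fun_dense:
  fixes g :: "real \<Rightarrow> complex"
  assumes [measurable]: "g \<in> borel_measurable borel" and g2: "integrable lborel (\<lambda>x. (norm (g x))\<^sup>2)" and \<delta>: "\<delta> > 0"
  obtains I c where "finite I" "(\<integral>x. (norm (g x - (\<Sum>k\<in>I. c k * laguerre_fun \<rho> (s + of_int k) x)))\<^sup>2 \<partial>lborel) < \<delta>"
proof -
  define gp gm where "gp = (\<lambda>x. if x > 0 then g x else 0)" and "gm = (\<lambda>x. if x > 0 then g (- x) else 0)"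
  have [measurable]: "gp \<in> borel_measurable borel" "gm \<in> borel_measurable borel" unfolding gp_def gm_def by measurable
  have gp2: "integrable lborel (\<lambda>x. (norm (gp x))\<^sup>2)"
    by (rule Bochner_Integration.integrable_bound[OF g2]) (auto simp: gp_def)
  have gm2: "integrable lborel (\<lambda>x. (norm (gm x))\<^sup>2)"
  proof (rule Bochner_Integration.integrable_bound)
    show "integrable lborel (\<lambda>x. (norm (g (0 + -1 * x)))\<^sup>2)" by (rule lborel_integrable_real_affine[OF g2]) simp
  qed (auto simp: gm_def)
  have gp0: "gp x = 0" and gm0: "gm x = 0" if "x \<le> 0" for x using that by (auto simp: gp_def gm_def)
  \<comment> \<open>Each half line is counted twice by the inequality for squares, giving a total
    below \<delta>/4.\<close>
  have \<delta>': "\<delta> / 16 > 0" using \<delta> by simp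
  obtain d a where a: "(\<integral>x. (norm (gp x - (\<Sum>j\<le>d. a j * exp_bump j x)))\<^sup>2 \<partial>lborel) < \<delta> / 16"
    by (rule half_line_density[OF \<open>gp \<in> borel_measurable borel\<close> gp2 gp0 \<delta>'])
  obtain d' b where b: "(\<integral>x. (norm (gm x - (\<Sum>j\<le>d'. b j * exp_bump j x)))\<^sup>2 \<partial>lborel) < \<delta> / 16"
    by (rule half_line_density[OF \<open>gm \<in> borel_measurable borel\<close> gm2 gm0 \<delta>'])
  define hp hm where "hp = (\<lambda>x. \<Sum>j\<le>d. a j * exp_bump j x)" and "hm = (\<lambda>x. \<Sum>j\<le>d'. b j * exp_bump j x)"
  define h where "h = (\<lambda>x. hp x + hm (- x))"
  have [measurable]: "hp \<in> borel_measurable borel" "hm \<in> borel_measurable borel" unfolding hp_def hm_def by measurable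
  have [measurable]: "h \<in> borel_measurable borel" unfolding h_def by measurable
  have hint: "integrable lborel hp" "integrable lborel hm" unfolding hp_def hm_def
    by (intro Bochner_Integration.integrable_sum integrable_mult_right integrable_exp_bump)+
  have hm_refl: "integrable lborel (\<lambda>x. hm (- x))"
    using lborel_integrable_real_affine[OF hint(2), of "-1" 0] by simp
  have h2: "integrable lborel (\<lambda>x. (norm (hp x))\<^sup>2)" "integrable lborel (\<lambda>x. (norm (hm x))\<^sup>2)"
    unfolding hp_def hm_def by (intro integrable_sum_sq integrable_exp_bump_sq; simp)+
  have hm_refl2: "integrable lborel (\<lambda>x. (norm (hm (- x)))\<^sup>2)"
    using lborel_integrable_real_affine[OF h2(2), of "-1" 0] by simp
  have hh2: "integrable lborel (\<lambda>x. (norm (h x))\<^sup>2)"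
    using integrable_diff_sq[of hp lborel "\<lambda>x. - hm (- x)"] h2 hm_refl2 by (simp add: h_def)
  have hcont: "isCont h x" if "x \<noteq> 0" for x
  proof -
    have "isCont (\<lambda>x. exp_bump j (- x)) x" for j
    proof (rule isCont_o2[where f="\<lambda>x. - x"])
      show "isCont (\<lambda>x::real. - x) x" by (intro continuous_intros)
      show "isCont (exp_bump j) (- x)" using that by (intro isCont_exp_bump) simp
    qed
    then show ?thesis unfolding h_def hp_def hm_def
      by (intro continuous_add continuous_sum continuous_mult continuous_const isCont_exp_bump that)
  qed
  have gh: "(\<integral>x. (norm (g x - h x))\<^sup>2 \<partial>lborel) < \<delta> / 4"
  proof -
    let ?u = "\<lambda>x. gp x - hp x" and ?v = "\<lambda>x. gm (- x) - hm (- x)"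
    have gm2': "integrable lborel (\<lambda>x. (norm (gm (- x)))\<^sup>2)"
      using lborel_integrable_real_affine[OF gm2, of "-1" 0] by simp
    have u2: "integrable lborel (\<lambda>x. (norm (?u x))\<^sup>2)" using gp2 h2 by (intro integrable_diff_sq) auto
    have v2: "integrable lborel (\<lambda>x. (norm (?v x))\<^sup>2)" using gm2' hm_refl2 by (intro integrable_diff_sq) auto
    have "(\<integral>x. (norm (g x - h x))\<^sup>2 \<partial>lborel) \<le> (\<integral>x. 2 * (norm (?u x))\<^sup>2 + 2 * (norm (?v x))\<^sup>2 \<partial>lborel)"
    proof (rule integral_mono_AE)
      show "integrable lborel (\<lambda>x. (norm (g x - h x))\<^sup>2)" using g2 hh2 by (intro integrable_diff_sq) auto
      show "integrable lborel (\<lambda>x. 2 * (norm (?u x))\<^sup>2 + 2 * (norm (?v x))\<^sup>2)" using u2 v2 by simp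
      show "AE x in lborel. (norm (g x - h x))\<^sup>2 \<le> 2 * (norm (?u x))\<^sup>2 + 2 * (norm (?v x))\<^sup>2"
        using AE_lborel_singleton[of 0]
      proof eventually_elim
        case (elim x)
        then have "g x - h x = ?u x - - ?v x" by (auto simp: gp_def gm_def h_def)
        then show ?case using norm_diff_sq_le[of "?u x" "- ?v x"] by (simp only: norm_minus_cancel)
      qed
    qed
    also have "\<dots> = 2 * (\<integral>x. (norm (?u x))\<^sup>2 \<partial>lborel) + 2 * (\<integral>x. (norm (?v x))\<^sup>2 \<partial>lborel)"
      using u2 v2 by simp
    also have "(\<integral>x. (norm (?v x))\<^sup>2 \<partial>lborel) = (\<integral>x. (norm (gm x - hm x))\<^sup>2 \<partial>lborel)"
      using lborel_integral_real_affine[of "-1" "\<lambda>x. (norm (gm x - hm x))\<^sup>2" 0] by simp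
    finally show ?thesis using a b unfolding hp_def hm_def by simp
  qed
  define C where "C = (\<Sum>j\<le>d. norm (a j)) + (\<Sum>j\<le>d'. norm (b j))"
  have fh: "fourier h t = (\<Sum>j\<le>d. a j * (1 / (of_nat (Suc j) + \<i> * of_real t)\<^sup>2)) + (\<Sum>j\<le>d'. b j * (1 / (of_nat (Suc j) - \<i> * of_real t)\<^sup>2))" for t
  proof -
    have "fourier hp t = (\<Sum>j\<le>d. a j * fourier (exp_bump j) t)" "fourier hm t = (\<Sum>j\<le>d'. b j * fourier (exp_bump j) t)" for t
      unfolding hp_def hm_def by (simp_all add: fourier_sum fourier_mult integrable_exp_bump)
    then show ?thesis
      unfolding h_def fourier_add[OF hint(1) hm_refl] fourier_minus[of hm] by (simp add: fourier_exp_bump)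
  qed
  have nz: "of_nat (Suc j) + \<i> * complex_of_real t \<noteq> 0" "of_nat (Suc j) - \<i> * complex_of_real t \<noteq> 0" for j t
    by (auto simp: complex_eq_iff simp del: of_nat_Suc)
  \<comment> \<open>The squared modulus of the denominator's base is (j + 1)^2 + t^2, and j + 1 >= 1
    > 1/2.\<close>
  have nb: "norm (1 / (of_nat (Suc j) + \<i> * complex_of_real t)\<^sup>2) \<le> 1 / (1/4 + t\<^sup>2)" "norm (1 / (of_nat (Suc j) - \<i> * complex_of_real t)\<^sup>2) \<le> 1 / (1/4 + t\<^sup>2)" for j t
  proof -
    have "(norm (of_nat (Suc j) + \<i> * complex_of_real t))\<^sup>2 = (real (Suc j))\<^sup>2 + t\<^sup>2" "(norm (of_nat (Suc j) - \<i> * complex_of_real t))\<^sup>2 = (real (Suc j))\<^sup>2 + t\<^sup>2"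
      unfolding cmod_power2 by (simp_all del: of_nat_Suc)
    moreover have "1 \<le> (real (Suc j))\<^sup>2" by (simp add: one_le_power)
    moreover have "1/4 + t\<^sup>2 > 0" by (intro add_pos_nonneg) auto
    moreover have le: "1 / N \<le> 1 / (1/4 + T)" if "N = A + T" "1 \<le> A" "1/4 + T > 0" for N A T :: real
      using that by (auto intro!: frac_le)
    ultimately show "norm (1 / (of_nat (Suc j) + \<i> * complex_of_real t)\<^sup>2) \<le> 1 / (1/4 + t\<^sup>2)" "norm (1 / (of_nat (Suc j) - \<i> * complex_of_real t)\<^sup>2) \<le> 1 / (1/4 + t\<^sup>2)"
      unfolding norm_divide norm_power norm_one by (metis le)+
  qed
  have fcont: "isCont (fourier h) t" for t
    unfolding fh using nz by (intro continuous_intros) auto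
  have fbound: "norm (fourier h t) \<le> C / (1/4 + t\<^sup>2)" for t
  proof -
    have "norm (fourier h t) \<le> (\<Sum>j\<le>d. norm (a j) * (1 / (1/4 + t\<^sup>2))) + (\<Sum>j\<le>d'. norm (b j) * (1 / (1/4 + t\<^sup>2)))"
      unfolding fh by (intro order.trans[OF norm_triangle_ineq] add_mono sum_norm_le; unfold norm_mult; intro mult_left_mono nb norm_ge_zero)
    also have "\<dots> = C / (1/4 + t\<^sup>2)"
      unfolding C_def sum_distrib_right[symmetric] by (simp add: add_divide_distrib)
    finally show ?thesis .
  qed
  \<comment> \<open>The Cauchy density has mass 2 pi, which cancels the constant of Plancherel's
    formula, so the squared distance from h is at most e^2 = \<delta>/8. In total 2 (\<delta>/4) + 2
    (\<delta>/8) < \<delta>.\<close>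
  define e where "e = sqrt (\<delta> / 8)"
  have e: "e > 0" using \<delta> by (simp add: e_def)
  obtain I c where I: "finite I" and c: "\<And>t. (norm (fourier h t - (\<Sum>k\<in>I. c k * laguerre_hat \<rho> (s + of_int k) t)))\<^sup>2 \<le> e\<^sup>2 * (1 / (1/4 + t\<^sup>2))"
    using laguerre_hat_approximation[OF fcont fbound e] by blast
  define L where "L = (\<lambda>x. \<Sum>k\<in>I. c k * laguerre_fun \<rho> (s + of_int k) x)"
  have [measurable]: "L \<in> borel_measurable borel" unfolding L_def by measurable
  have Lint: "integrable lborel L" unfolding L_def
    by (intro Bochner_Integration.integrable_sum integrable_mult_right integrable_laguerre_fun)
  have L2: "integrable lborel (\<lambda>x. (norm (L x))\<^sup>2)"
    unfolding L_def by (intro integrable_sum_sq I integrable_laguerre_fun_sq) simp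
  have hL2: "integrable lborel (\<lambda>x. (norm (h x - L x))\<^sup>2)" by (intro integrable_diff_sq hh2 L2) measurable
  have hint': "integrable lborel h" unfolding h_def using hint(1) hm_refl by simp
  have fD: "fourier (\<lambda>x. h x - L x) t = fourier h t - (\<Sum>k\<in>I. c k * laguerre_hat \<rho> (s + of_int k) t)" for t
  proof -
    have "fourier L t = (\<Sum>k\<in>I. c k * laguerre_hat \<rho> (s + of_int k) t)"
      unfolding L_def by (simp add: fourier_sum fourier_mult integrable_laguerre_fun fourier_laguerre_fun)
    then show ?thesis by (simp add: fourier_diff[OF hint' Lint])
  qed
  have fD2: "integrable lborel (\<lambda>t. (norm (fourier (\<lambda>x. h x - L x) t))\<^sup>2)"
  proof (rule Bochner_Integration.integrable_bound[OF integrable_mult_right[OF integrable_cauchy, of "e\<^sup>2"]])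
    have [measurable]: "fourier h \<in> borel_measurable borel" "laguerre_hat \<rho> s' \<in> borel_measurable borel" for s'
      by (intro borel_measurable_continuous_onI continuous_at_imp_continuous_on ballI fcont isCont_laguerre_hat)+
    show "(\<lambda>t. (norm (fourier (\<lambda>x. h x - L x) t))\<^sup>2) \<in> borel_measurable lborel"
      unfolding fD by measurable
    show "AE t in lborel. norm ((norm (fourier (\<lambda>x. h x - L x) t))\<^sup>2) \<le> norm (e\<^sup>2 * (1 / (1/4 + t\<^sup>2)))"
      unfolding fD by (auto intro!: AE_I2 order.trans[OF c])
  qed
  have "2 * pi * (\<integral>x. (norm (h x - L x))\<^sup>2 \<partial>lborel) = (\<integral>t. (norm (fourier (\<lambda>x. h x - L x) t))\<^sup>2 \<partial>lborel)"
  proof (rule parseval_norm[symmetric])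
    show "isCont (\<lambda>x. h x - L x) x" if "x \<noteq> 0" for x
      unfolding L_def using that
      by (intro continuous_diff hcont continuous_sum continuous_mult continuous_const isCont_laguerre_fun)
  qed (use hint' Lint hL2 fD2 in auto)
  also have "\<dots> \<le> (\<integral>t. e\<^sup>2 * (1 / (1/4 + t\<^sup>2)) \<partial>lborel)"
    using fD2 c by (intro integral_mono integrable_mult_right integrable_cauchy) (auto simp: fD)
  also have "\<dots> = 2 * pi * e\<^sup>2" unfolding integral_mult_right_zero integral_cauchy by simp
  finally have "(\<integral>x. (norm (h x - L x))\<^sup>2 \<partial>lborel) \<le> \<delta> / 8" using \<delta> by (simp add: e_def)
  moreover have "(\<integral>x. (norm (g x - L x))\<^sup>2 \<partial>lborel) \<le> 2 * (\<integral>x. (norm (g x - h x))\<^sup>2 \<partial>lborel) + 2 * (\<integral>x. (norm (h x - L x))\<^sup>2 \<partial>lborel)"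
    by (intro integral_diff_sq_le g2 hh2 L2) measurable
  ultimately have "(\<integral>x. (norm (g x - L x))\<^sup>2 \<partial>lborel) < \<delta>" using gh \<delta> by linarith
  then show ?thesis using that[OF I, of c] unfolding L_def by blast
qed

section \<open>Weighted Laguerre functions\<close>

definition laguerre_index :: "real \<Rightarrow> real \<Rightarrow> int \<Rightarrow> complex" where
  "laguerre_index \<rho> \<epsilon> n = Complex (1/2 + (\<epsilon> + of_int n)) \<rho>"

definition laguerre_phase :: "real \<Rightarrow> real \<Rightarrow> int \<Rightarrow> complex" where
  "laguerre_phase \<rho> \<epsilon> n = Gamma (laguerre_index \<rho> \<epsilon> n) / of_real (norm (Gamma (laguerre_index \<rho> \<epsilon> n)))"

definition laguerre_sine :: "real \<Rightarrow> real \<Rightarrow> complex" where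
  "laguerre_sine \<rho> \<epsilon> = sin (of_real pi * laguerre_index \<rho> \<epsilon> 0)"

text \<open>Independent of n, so it cancels in inner products and can be moved to the function being
  approximated. For x > 0 the power undoes the x^(2 i \<rho>) in \<open>laguerre_half\<close>, and
  the constant is the phase of the sine.\<close>

definition laguerre_twist :: "real \<Rightarrow> real \<Rightarrow> real \<Rightarrow> complex" where
  "laguerre_twist \<rho> \<epsilon> x = (if x > 0 then of_real (norm (laguerre_sine \<rho> \<epsilon>)) / cnj (laguerre_sine \<rho> \<epsilon>) * of_real x powr (- Complex 0 (2 * \<rho>)) else 1)"

text \<open>An integer value forces \<rho> = 0, and 1/2 + \<epsilon> lies in [1/2, 3/2), where 1 is
  the only integer.\<close>

lemma laguerre_index_not_Int:
  assumes "\<epsilon> \<in> {0..<1}" "(\<rho>, \<epsilon>) \<noteq> (0, 1/2)"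
  shows "laguerre_index \<rho> \<epsilon> n \<notin> \<int>"
proof
  assume "laguerre_index \<rho> \<epsilon> n \<in> \<int>"
  then obtain m where "laguerre_index \<rho> \<epsilon> n = of_int m" by (auto elim: Ints_cases)
  then have m: "\<rho> = 0" "1/2 + (\<epsilon> + of_int n) = of_int m"
    by (auto simp: laguerre_index_def complex_eq_iff)
  then have "of_int (m - n) = 1/2 + \<epsilon>" by simp
  then have "of_int (m - n) > (0::real)" "of_int (m - n) < (2::real)" using assms by auto
  then have "m - n = 1" by linarith
  with \<open>of_int (m - n) = 1/2 + \<epsilon>\<close> m assms show False by simp
qed

lemma laguerre_sine_nonzero:
  assumes "\<epsilon> \<in> {0..<1}" "(\<rho>, \<epsilon>) \<noteq> (0, 1/2)"
  shows "laguerre_sine \<rho> \<epsilon> \<noteq> 0"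
proof
  assume "laguerre_sine \<rho> \<epsilon> = 0"
  then obtain m :: int where "of_real pi * laguerre_index \<rho> \<epsilon> 0 = of_real (of_int m * pi)"
    unfolding laguerre_sine_def sin_eq_0 by (auto simp: mult.commute)
  then have "laguerre_index \<rho> \<epsilon> 0 = of_int m" by simp
  with laguerre_index_not_Int[OF assms, of 0] show False by simp
qed

lemma sin_pi_shift: "sin (of_real pi * (z + of_int n)) = (-1) powi n * sin (of_real pi * z)" for z :: complex
proof -
  have 1: "sin (of_real pi * (z + of_int n)) = sin (of_real pi * z) * cos (of_real pi * of_int n) + cos (of_real pi * z) * sin (of_real pi * of_int n)"
    unfolding distrib_left by (rule sin_add)
  have "sin (complex_of_real pi * of_int n) = 0" unfolding sin_eq_0 by (intro exI[of _ n]) (simp add: mult.commute)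
  moreover have "cos (complex_of_real pi * of_int n) = (-1) powi n"
  proof -
    have "complex_of_real pi * of_int n = of_real (pi * of_int n)" by simp
    then have "cos (complex_of_real pi * of_int n) = of_real (cos (pi * of_int n))"
      by (simp only: cos_of_real)
    also have "\<dots> = (if even n then 1 else -1)" by (simp only: cos_npi_int) simp
    finally show ?thesis by (simp add: power_int_minus_left)
  qed
  ultimately show ?thesis unfolding 1 by simp
qed

lemma sqrt_laguerre_weight:
  "sqrt (laguerre_weight \<rho> \<epsilon> x) = norm (laguerre_sine \<rho> \<epsilon>) / pi * exp (- \<bar>x\<bar> / 2)"
proof -
  have "of_real \<epsilon> + 1/2 + \<i> * of_real \<rho> = laguerre_index \<rho> \<epsilon> 0"
    by (simp add: laguerre_index_def complex_eq_iff)
  then have "laguerre_weight \<rho> \<epsilon> x = (norm (laguerre_sine \<rho> \<epsilon>) / pi)\<^sup>2 * exp (- \<bar>x\<bar>)"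
    by (simp add: laguerre_weight_def laguerre_sine_def power_divide)
  also have "exp (- \<bar>x\<bar>) = (exp (- \<bar>x\<bar> / 2))\<^sup>2"
    by (simp add: exp_double[symmetric])
  finally show ?thesis by (simp add: real_sqrt_mult)
qed

lemma borel_measurable_cnj [measurable (raw)]:
  "f \<in> borel_measurable M \<Longrightarrow> (\<lambda>x. cnj (f x)) \<in> borel_measurable M"
  by (rule borel_measurable_continuous_on[of cnj]) (auto intro: continuous_intros)

context
  fixes \<rho> \<epsilon> :: real
  assumes eps: "\<epsilon> \<in> {0..<1}" and ne: "(\<rho>, \<epsilon>) \<noteq> (0, 1/2)"
begin

lemma laguerre_Gamma_nonzero: "Gamma (laguerre_index \<rho> \<epsilon> n) \<noteq> 0"
  using laguerre_index_not_Int[OF eps ne, of n] by (auto simp: Gamma_eq_zero_iff)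

lemma norm_laguerre_phase: "norm (laguerre_phase \<rho> \<epsilon> n) = 1"
  using laguerre_Gamma_nonzero[of n] by (simp add: laguerre_phase_def norm_divide)

lemma norm_laguerre_twist: "norm (laguerre_twist \<rho> \<epsilon> x) = 1"
  using laguerre_sine_nonzero[OF eps ne] by (simp add: laguerre_twist_def norm_mult norm_divide norm_cpowr)

text \<open>Reflection at the conjugate of \<beta>, because 1 minus that conjugate is \<alpha>. This
  is where the sine of the weight and the sign (-1)^n of psi originate.\<close>

lemma rGamma_laguerre:
  "rGamma (Complex (1/2 - (\<epsilon> + of_int n)) \<rho>) = (-1) powi n * cnj (Gamma (laguerre_index \<rho> \<epsilon> n)) * cnj (laguerre_sine \<rho> \<epsilon>) / pi"
proof -
  let ?\<beta> = "laguerre_index \<rho> \<epsilon> n"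
  have e: "1 - cnj ?\<beta> = Complex (1/2 - (\<epsilon> + of_int n)) \<rho>"
    by (simp add: laguerre_index_def complex_eq_iff)
  have s: "sin (of_real pi * cnj ?\<beta>) = (-1) powi n * cnj (laguerre_sine \<rho> \<epsilon>)"
  proof -
    have "?\<beta> = laguerre_index \<rho> \<epsilon> 0 + of_int n" by (simp add: laguerre_index_def complex_eq_iff)
    then have "sin (of_real pi * ?\<beta>) = (-1) powi n * laguerre_sine \<rho> \<epsilon>"
      by (simp only: sin_pi_shift laguerre_sine_def)
    from arg_cong[OF this, of cnj] show ?thesis by (simp add: cnj_sin)
  qed
  have "rGamma (cnj ?\<beta>) * rGamma (Complex (1/2 - (\<epsilon> + of_int n)) \<rho>) = (-1) powi n * cnj (laguerre_sine \<rho> \<epsilon>) / pi"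
    using rGamma_reflection_complex[of "cnj ?\<beta>"] unfolding e s .
  moreover have "rGamma (cnj ?\<beta>) = inverse (cnj (Gamma ?\<beta>))"
    by (simp add: rGamma_inverse_Gamma cnj_Gamma)
  ultimately show ?thesis
    using laguerre_Gamma_nonzero[of n] by (simp add: field_simps)
qed

text \<open>For x > 0 the reflection formula turns 1/Gamma(\<alpha>) into the conjugate of
  Gamma(\<beta>) times a sine, and the phase makes the former |Gamma(\<beta>)|. For x < 0 the factor
  1/Gamma(\<beta>) is matched with |Gamma(\<alpha>)| by the modulus of the same formula.\<close>

lemma laguerre_psi_eq:
  assumes x: "x \<noteq> 0"
  shows "of_real (sqrt (laguerre_weight \<rho> \<epsilon> x)) * laguerre_psi \<rho> \<epsilon> n x
    = laguerre_phase \<rho> \<epsilon> n * laguerre_twist \<rho> \<epsilon> x * laguerre_fun \<rho> (\<epsilon> + of_int n) x"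
proof -
  define s where "s = \<epsilon> + of_int n"
  define \<alpha> \<beta> where "\<alpha> = Complex (1/2 - s) \<rho>" and "\<beta> = laguerre_index \<rho> \<epsilon> n"
  define \<sigma> where "\<sigma> = laguerre_sine \<rho> \<epsilon>"
  have \<beta>: "\<beta> = Complex (1/2 + s) \<rho>" by (simp add: \<beta>_def laguerre_index_def s_def)
  have ab: "\<alpha> + \<beta> = Complex 1 (2 * \<rho>)" "\<beta> + \<alpha> = Complex 1 (2 * \<rho>)" by (simp_all add: \<alpha>_def \<beta> complex_eq_iff)
  have G: "Gamma \<beta> \<noteq> 0" unfolding \<beta>_def by (rule laguerre_Gamma_nonzero)
  have S: "\<sigma> \<noteq> 0" unfolding \<sigma>_def by (rule laguerre_sine_nonzero[OF eps ne])
  have ra: "rGamma \<alpha> = (-1) powi n * cnj (Gamma \<beta>) * cnj \<sigma> / pi"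
    unfolding \<alpha>_def s_def \<beta>_def \<sigma>_def by (rule rGamma_laguerre)
  have ph: "laguerre_phase \<rho> \<epsilon> n = Gamma \<beta> / of_real (norm (Gamma \<beta>))"
    by (simp add: laguerre_phase_def \<beta>_def)
  have ph': "laguerre_phase \<rho> \<epsilon> n * cnj (Gamma \<beta>) = of_real (norm (Gamma \<beta>))"
    unfolding ph using G complex_norm_square[of "Gamma \<beta>"] by (simp add: field_simps power2_eq_square)
  have w: "sqrt (laguerre_weight \<rho> \<epsilon> x) = norm \<sigma> / pi * exp (- \<bar>x\<bar> / 2)"
    unfolding \<sigma>_def by (rule sqrt_laguerre_weight)
  have p1: "(-1) powi n * (-1) powi n = (1 :: complex)"
    by (simp flip: power_int_mult_distrib)
  show ?thesis
  proof (cases "x > 0")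
    case True
    define U where "U = tricomi_U \<beta> (Complex 1 (2 * \<rho>)) (of_real x)"
    have e: "of_int n + of_real \<epsilon> + 1/2 + \<i> * of_real \<rho> = \<beta>" "1 + 2 * \<i> * of_real \<rho> = Complex 1 (2 * \<rho>)"
      by (simp_all add: \<beta> s_def complex_eq_iff)
    have psi: "laguerre_psi \<rho> \<epsilon> n x = (-1) powi n * of_real (norm (Gamma \<beta>)) * U"
      using True unfolding laguerre_psi_def e U_def by simp
    have f: "laguerre_fun \<rho> s x = of_real (exp (- x / 2)) * of_real x powr (Complex 1 (2 * \<rho>) - 1) * U * rGamma \<alpha>"
      using True unfolding laguerre_fun_def laguerre_half_def \<alpha>_def[symmetric] \<beta>[symmetric] ab U_def by simp
    have tw: "laguerre_twist \<rho> \<epsilon> x = of_real (norm \<sigma>) / cnj \<sigma> * of_real x powr (- Complex 0 (2 * \<rho>))"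
      using True by (simp add: laguerre_twist_def \<sigma>_def)
    have px: "of_real x powr (- Complex 0 (2 * \<rho>)) * complex_of_real x powr (Complex 1 (2 * \<rho>) - 1) = 1"
    proof -
      have "- Complex 0 (2 * \<rho>) + (Complex 1 (2 * \<rho>) - 1) = 0" by (simp add: complex_eq_iff)
      then show ?thesis using True by (simp only: powr_add[symmetric]) simp
    qed
    have "laguerre_phase \<rho> \<epsilon> n * laguerre_twist \<rho> \<epsilon> x * laguerre_fun \<rho> s x
      = (laguerre_phase \<rho> \<epsilon> n * cnj (Gamma \<beta>)) * of_real (norm \<sigma>) * (cnj \<sigma> / cnj \<sigma>) * (of_real x powr (- Complex 0 (2 * \<rho>)) * of_real x powr (Complex 1 (2 * \<rho>) - 1)) * of_real (exp (- x / 2)) * U * (-1) powi n / pi"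
      unfolding tw f ra by simp
    also have "\<dots> = of_real (norm (Gamma \<beta>)) * of_real (norm \<sigma>) * of_real (exp (- x / 2)) * U * (-1) powi n / pi"
      unfolding ph' px using S by simp
    finally show ?thesis
      unfolding w psi using True by (simp add: s_def mult_ac)
  next
    case False
    then have xn: "x < 0" using x by simp
    define V where "V = tricomi_U (cnj \<alpha>) (2 - Complex 1 (2 * \<rho>)) (of_real (- x))"
    have e: "1/2 - of_int n - of_real \<epsilon> - \<i> * of_real \<rho> = cnj \<alpha>" "1 - 2 * \<i> * of_real \<rho> = 2 - Complex 1 (2 * \<rho>)" "\<alpha> - Complex 1 (2 * \<rho>) + 1 = cnj \<alpha>"
      by (simp_all add: \<alpha>_def s_def complex_eq_iff)
    have psi: "laguerre_psi \<rho> \<epsilon> n x = of_real (norm (Gamma \<alpha>)) * V"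
      using xn unfolding laguerre_psi_def e V_def by (simp flip: cnj_Gamma)
    have "tricomi_U \<alpha> (Complex 1 (2 * \<rho>)) (of_real (- x)) = of_real (- x) powr (1 - Complex 1 (2 * \<rho>)) * V"
      using tricomi_U_kummer[of "Complex 1 (2 * \<rho>)" "- x" \<alpha>] xn unfolding e V_def by simp
    moreover have "complex_of_real (- x) powr (Complex 1 (2 * \<rho>) - 1) * of_real (- x) powr (1 - Complex 1 (2 * \<rho>)) = 1"
      using xn by (simp only: powr_add[symmetric]) simp
    moreover have "a * t = V" if "t = b * V" "a * b = 1" for a b t :: complex
      using that by (simp flip: mult.assoc)
    ultimately have k: "complex_of_real (- x) powr (Complex 1 (2 * \<rho>) - 1) * tricomi_U \<alpha> (Complex 1 (2 * \<rho>)) (of_real (- x)) = V"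
      by blast
    have f: "laguerre_fun \<rho> s x = of_real (exp (x / 2)) * V * rGamma \<beta>"
    proof -
      have "laguerre_fun \<rho> s x = of_real (exp (- (- x) / 2)) * (complex_of_real (- x) powr (Complex 1 (2 * \<rho>) - 1) * tricomi_U \<alpha> (Complex 1 (2 * \<rho>)) (of_real (- x))) * rGamma \<beta>"
        using xn unfolding laguerre_fun_def laguerre_half_def \<alpha>_def[symmetric] \<beta>[symmetric] ab by simp
      then show ?thesis unfolding k by simp
    qed
    have "norm (rGamma \<alpha>) = norm (Gamma \<beta>) * norm \<sigma> / pi"
      unfolding ra by (simp add: norm_mult norm_divide norm_power_int)
    \<comment> \<open>Thus |Gamma(\<alpha>)| times the factor |sine|/pi of the root of the weight
      equals 1/|Gamma(\<beta>)|.\<close>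
    then have na: "norm (Gamma \<alpha>) = pi / (norm (Gamma \<beta>) * norm \<sigma>)"
      unfolding rGamma_inverse_Gamma norm_inverse by (metis inverse_inverse_eq inverse_divide)
    have "laguerre_phase \<rho> \<epsilon> n * laguerre_twist \<rho> \<epsilon> x * laguerre_fun \<rho> s x = of_real (exp (x / 2)) * V / of_real (norm (Gamma \<beta>))"
      unfolding f ph using False G by (simp add: laguerre_twist_def rGamma_inverse_Gamma)
    moreover have "of_real (sqrt (laguerre_weight \<rho> \<epsilon> x)) * laguerre_psi \<rho> \<epsilon> n x = of_real (1 / norm (Gamma \<beta>)) * of_real (exp (x / 2)) * V"
    proof -
      have "norm \<sigma> / pi * norm (Gamma \<alpha>) = 1 / norm (Gamma \<beta>)"
        unfolding na using S G by (simp add: field_simps)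
      from this[symmetric] show ?thesis unfolding w psi using xn by (simp add: mult_ac)
    qed
    ultimately show ?thesis unfolding s_def by simp
  qed
qed

lemma laguerre_weight_pos: "laguerre_weight \<rho> \<epsilon> x > 0"
proof -
  have "sqrt (laguerre_weight \<rho> \<epsilon> x) > 0"
    unfolding sqrt_laguerre_weight using laguerre_sine_nonzero[OF eps ne] by simp
  then show ?thesis by simp
qed

lemma laguerre_twist_measurable [measurable]: "laguerre_twist \<rho> \<epsilon> \<in> borel_measurable borel"
  unfolding laguerre_twist_def by measurable

lemma laguerre_weight_measurable [measurable]: "laguerre_weight \<rho> \<epsilon> \<in> borel_measurable borel"
  unfolding laguerre_weight_def by measurable

lemma laguerre_psi_measurable [measurable]: "laguerre_psi \<rho> \<epsilon> n \<in> borel_measurable borel"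
proof -
  \<comment> \<open>Measurability of psi is inherited from \<open>laguerre_fun\<close> by dividing
    by the positive weight; x = 0 carries the default value.\<close>
  have eq: "laguerre_psi \<rho> \<epsilon> n x = (if x = 0 then 0 else laguerre_phase \<rho> \<epsilon> n * laguerre_twist \<rho> \<epsilon> x * laguerre_fun \<rho> (\<epsilon> + of_int n) x / of_real (sqrt (laguerre_weight \<rho> \<epsilon> x)))" for x
    using laguerre_psi_eq[of x n] laguerre_weight_pos[of x] by (auto simp: laguerre_psi_def[of _ _ _ 0] field_simps)
  show ?thesis unfolding ext[of "laguerre_psi \<rho> \<epsilon> n", OF eq] by measurable
qed

lemma laguerre_integrable:
  fixes f :: "real \<Rightarrow> 'b::{banach, second_countable_topology}"
  assumes "f \<in> borel_measurable borel"
  shows "integrable (laguerre_measure \<rho> \<epsilon>) f \<longleftrightarrow> integrable lborel (\<lambda>x. laguerre_weight \<rho> \<epsilon> x *\<^sub>R f x)"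
  unfolding laguerre_measure_def using assms laguerre_weight_pos
  by (intro integrable_density) (auto intro: less_imp_le)

lemma laguerre_integral:
  fixes f :: "real \<Rightarrow> 'b::{banach, second_countable_topology}"
  assumes "f \<in> borel_measurable borel"
  shows "integral\<^sup>L (laguerre_measure \<rho> \<epsilon>) f = (\<integral>x. laguerre_weight \<rho> \<epsilon> x *\<^sub>R f x \<partial>lborel)"
  unfolding laguerre_measure_def using assms laguerre_weight_pos
  by (intro integral_density) (auto intro: less_imp_le)

lemma of_real_laguerre_weight:
  "complex_of_real (laguerre_weight \<rho> \<epsilon> x) = of_real (sqrt (laguerre_weight \<rho> \<epsilon> x)) * of_real (sqrt (laguerre_weight \<rho> \<epsilon> x))"
  using laguerre_weight_pos[of x] by (simp flip: of_real_mult)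

lemma laguerre_psi_orthonormal: "L2_orthonormal (laguerre_measure \<rho> \<epsilon>) (laguerre_psi \<rho> \<epsilon>)"
  unfolding L2_orthonormal_def
proof (intro conjI allI)
  fix n
  have "integrable lborel (\<lambda>x. laguerre_weight \<rho> \<epsilon> x *\<^sub>R (norm (laguerre_psi \<rho> \<epsilon> n x))\<^sup>2)"
  proof (rule integrable_cong_AE[THEN iffD1, OF _ _ _ integrable_laguerre_fun_sq[of \<rho> "\<epsilon> + of_int n"]])
    show "AE x in lborel. (norm (laguerre_fun \<rho> (\<epsilon> + of_int n) x))\<^sup>2 = laguerre_weight \<rho> \<epsilon> x *\<^sub>R (norm (laguerre_psi \<rho> \<epsilon> n x))\<^sup>2"
      using AE_lborel_singleton[of 0]
    proof eventually_elim
      case (elim x)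
      have "norm (of_real (sqrt (laguerre_weight \<rho> \<epsilon> x)) * laguerre_psi \<rho> \<epsilon> n x) = norm (laguerre_fun \<rho> (\<epsilon> + of_int n) x)"
        unfolding laguerre_psi_eq[OF elim] norm_mult norm_laguerre_phase norm_laguerre_twist by simp
      then have "sqrt (laguerre_weight \<rho> \<epsilon> x) * norm (laguerre_psi \<rho> \<epsilon> n x) = norm (laguerre_fun \<rho> (\<epsilon> + of_int n) x)"
        using laguerre_weight_pos[of x] by (simp add: norm_mult)
      from arg_cong[OF this, of "\<lambda>r. r\<^sup>2"] show ?case
        using laguerre_weight_pos[of x] by (simp add: power_mult_distrib)
    qed
  qed measurable
  then show "laguerre_psi \<rho> \<epsilon> n \<in> L2_space (laguerre_measure \<rho> \<epsilon>)"
    unfolding L2_space_def by (simp add: laguerre_integrable) (simp add: laguerre_measure_def)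
next
  fix n m
  have "L2_inner (laguerre_measure \<rho> \<epsilon>) (laguerre_psi \<rho> \<epsilon> n) (laguerre_psi \<rho> \<epsilon> m)
     = (\<integral>x. laguerre_weight \<rho> \<epsilon> x *\<^sub>R (laguerre_psi \<rho> \<epsilon> n x * cnj (laguerre_psi \<rho> \<epsilon> m x)) \<partial>lborel)"
    unfolding L2_inner_def by (intro laguerre_integral borel_measurable_times) (auto intro: borel_measurable_cnj)
  also have "\<dots> = (\<integral>x. (laguerre_phase \<rho> \<epsilon> n * cnj (laguerre_phase \<rho> \<epsilon> m)) * (laguerre_fun \<rho> (\<epsilon> + of_int n) x * cnj (laguerre_fun \<rho> (\<epsilon> + of_int m) x)) \<partial>lborel)"
  proof (rule integral_cong_AE)
    show "AE x in lborel. laguerre_weight \<rho> \<epsilon> x *\<^sub>R (laguerre_psi \<rho> \<epsilon> n x * cnj (laguerre_psi \<rho> \<epsilon> m x))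
       = (laguerre_phase \<rho> \<epsilon> n * cnj (laguerre_phase \<rho> \<epsilon> m)) * (laguerre_fun \<rho> (\<epsilon> + of_int n) x * cnj (laguerre_fun \<rho> (\<epsilon> + of_int m) x))"
      using AE_lborel_singleton[of 0]
    proof eventually_elim
      case (elim x)
      let ?r = "complex_of_real (sqrt (laguerre_weight \<rho> \<epsilon> x))" and ?t = "laguerre_twist \<rho> \<epsilon> x"
      have t: "?t * cnj ?t = 1" using norm_laguerre_twist[of x] by (simp add: complex_norm_square[symmetric])
      have "laguerre_weight \<rho> \<epsilon> x *\<^sub>R (laguerre_psi \<rho> \<epsilon> n x * cnj (laguerre_psi \<rho> \<epsilon> m x)) = (?r * laguerre_psi \<rho> \<epsilon> n x) * cnj (?r * laguerre_psi \<rho> \<epsilon> m x)"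
        unfolding scaleR_conv_of_real of_real_laguerre_weight by (simp add: mult_ac)
      also have "\<dots> = (?t * cnj ?t) * ((laguerre_phase \<rho> \<epsilon> n * cnj (laguerre_phase \<rho> \<epsilon> m)) * (laguerre_fun \<rho> (\<epsilon> + of_int n) x * cnj (laguerre_fun \<rho> (\<epsilon> + of_int m) x)))"
        unfolding laguerre_psi_eq[OF elim] by (simp add: mult_ac)
      finally show ?case unfolding t by simp
    qed
  qed measurable
  also have "\<dots> = (laguerre_phase \<rho> \<epsilon> n * cnj (laguerre_phase \<rho> \<epsilon> m)) * (if n = m then 1 else 0)"
    unfolding integral_mult_right_zero laguerre_fun_orthonormal ..
  also have "\<dots> = (if n = m then 1 else 0)"
    using norm_laguerre_phase[of n] by (auto simp: complex_norm_square[symmetric])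
  finally show "L2_inner (laguerre_measure \<rho> \<epsilon>) (laguerre_psi \<rho> \<epsilon> n) (laguerre_psi \<rho> \<epsilon> m) = (if n = m then 1 else 0)" .
qed

lemma laguerre_psi_dense:
  assumes f: "f \<in> L2_space (laguerre_measure \<rho> \<epsilon>)" and \<delta>: "\<delta> > 0"
  shows "\<exists>I c. finite I \<and> L2_norm (laguerre_measure \<rho> \<epsilon>) (\<lambda>x. f x - (\<Sum>i\<in>I. c i * laguerre_psi \<rho> \<epsilon> i x)) < \<delta>"
proof -
  have [measurable]: "f \<in> borel_measurable borel"
    using f by (simp add: L2_space_def laguerre_measure_def)
  have f2: "integrable lborel (\<lambda>x. laguerre_weight \<rho> \<epsilon> x *\<^sub>R (norm (f x))\<^sup>2)"
    using f by (simp add: L2_space_def laguerre_integrable)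
  \<comment> \<open>The conjugate of the twist is its inverse. Hence the difference of g and a sum
    of \<open>laguerre_fun\<close> has the modulus of the weighted difference of f and the
    corresponding sum of psi, once the coefficients are divided by the phases.\<close>
  define g where "g = (\<lambda>x. cnj (laguerre_twist \<rho> \<epsilon> x) * (of_real (sqrt (laguerre_weight \<rho> \<epsilon> x)) * f x))"
  have [measurable]: "(\<lambda>x. cnj (laguerre_twist \<rho> \<epsilon> x)) \<in> borel_measurable borel"
    by (intro borel_measurable_cnj) measurable
  have [measurable]: "g \<in> borel_measurable borel" unfolding g_def by measurable
  have g2: "integrable lborel (\<lambda>x. (norm (g x))\<^sup>2)"
  proof -
    have "(norm (g x))\<^sup>2 = laguerre_weight \<rho> \<epsilon> x *\<^sub>R (norm (f x))\<^sup>2" for x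
      using laguerre_weight_pos[of x] by (simp add: g_def norm_mult norm_laguerre_twist power_mult_distrib)
    then show ?thesis using f2 by simp
  qed
  obtain I c where I: "finite I" "(\<integral>x. (norm (g x - (\<Sum>k\<in>I. c k * laguerre_fun \<rho> (\<epsilon> + of_int k) x)))\<^sup>2 \<partial>lborel) < \<delta>\<^sup>2"
    by (rule laguerre_fun_dense[OF \<open>g \<in> borel_measurable borel\<close> g2 zero_less_power[OF \<delta>]])
  define d where "d = (\<lambda>k. c k / laguerre_phase \<rho> \<epsilon> k)"
  have ph: "laguerre_phase \<rho> \<epsilon> k \<noteq> 0" for k using norm_laguerre_phase[of k] by auto
  let ?D = "\<lambda>x. f x - (\<Sum>k\<in>I. d k * laguerre_psi \<rho> \<epsilon> k x)"
  have "(\<integral>x. (norm (?D x))\<^sup>2 \<partial>laguerre_measure \<rho> \<epsilon>) = (\<integral>x. laguerre_weight \<rho> \<epsilon> x *\<^sub>R (norm (?D x))\<^sup>2 \<partial>lborel)"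
    by (rule laguerre_integral) measurable
  also have "\<dots> = (\<integral>x. (norm (g x - (\<Sum>k\<in>I. c k * laguerre_fun \<rho> (\<epsilon> + of_int k) x)))\<^sup>2 \<partial>lborel)"
  proof (rule integral_cong_AE)
    show "AE x in lborel. laguerre_weight \<rho> \<epsilon> x *\<^sub>R (norm (?D x))\<^sup>2 = (norm (g x - (\<Sum>k\<in>I. c k * laguerre_fun \<rho> (\<epsilon> + of_int k) x)))\<^sup>2"
      using AE_lborel_singleton[of 0]
    proof eventually_elim
      case (elim x)
      let ?r = "complex_of_real (sqrt (laguerre_weight \<rho> \<epsilon> x))" and ?t = "laguerre_twist \<rho> \<epsilon> x"
      have t: "?t * cnj ?t = 1" using norm_laguerre_twist[of x] by (simp add: complex_norm_square[symmetric])
      have "?r * (d k * laguerre_psi \<rho> \<epsilon> k x) = ?t * (c k * laguerre_fun \<rho> (\<epsilon> + of_int k) x)" for k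
      proof -
        have "?r * (d k * laguerre_psi \<rho> \<epsilon> k x) = d k * (?r * laguerre_psi \<rho> \<epsilon> k x)" by (simp only: mult_ac)
        then show ?thesis unfolding laguerre_psi_eq[OF elim] d_def using ph[of k] by simp
      qed
      then have "?r * ?D x = ?r * f x - ?t * (\<Sum>k\<in>I. c k * laguerre_fun \<rho> (\<epsilon> + of_int k) x)"
        by (simp only: right_diff_distrib sum_distrib_left)
      also have "?r * f x = ?t * g x" unfolding g_def using t by (simp flip: mult.assoc)
      finally have "norm (?r * ?D x) = norm (?t * (g x - (\<Sum>k\<in>I. c k * laguerre_fun \<rho> (\<epsilon> + of_int k) x)))"
        by (simp only: right_diff_distrib)
      then have "sqrt (laguerre_weight \<rho> \<epsilon> x) * norm (?D x) = norm (g x - (\<Sum>k\<in>I. c k * laguerre_fun \<rho> (\<epsilon> + of_int k) x))"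
        unfolding norm_mult norm_laguerre_twist using laguerre_weight_pos[of x] by simp
      from arg_cong[OF this, of "\<lambda>r. r\<^sup>2"] show ?case
        using laguerre_weight_pos[of x] by (simp add: power_mult_distrib)
    qed
  qed measurable
  finally have "L2_norm (laguerre_measure \<rho> \<epsilon>) ?D < \<delta>"
    unfolding L2_norm_def using I(2) \<delta> by (simp add: real_less_lsqrt)
  then show ?thesis using I(1) by blast
qed

end

theorem theorem2p9:
  fixes \<rho> \<epsilon> :: real
  assumes "\<rho> \<ge> 0" and "\<epsilon> \<in> {0..<1}" and "(\<rho>, \<epsilon>) \<noteq> (0, 1/2)"
  shows "L2_orthonormal_basis (laguerre_measure \<rho> \<epsilon>) (laguerre_psi \<rho> \<epsilon>)"
  using laguerre_psi_orthonormal[OF assms(2,3)] laguerre_psi_dense[OF assms(2,3)]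
  unfolding L2_orthonormal_basis_def by blast

end
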